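(* Let $G$ be a periodic soluble group in which every subnormal subgroup of infinite rank is commensurable with some normal subgroup of $G$. Suppose that the Hirsch-Plotkin radical of $G$ has infinite rank. Then every subnormal subgroup of $G$ is commensurable with some normal subgroup of $G$.
   Context: Two subgroups $H,K$ of a group are commensurable if $H\cap K$ has finite index in both $H$ and $K$. A group has finite rank $r$ if every finitely generated subgroup can be generated by at most $r$ elements and $r$ is the least such positive integer; it has infinite rank if no such $r$ exists. The Hirsch-Plotkin radical is the largest locally nilpotent normal subgroup. *)

theory Defs
  imports "HOL-Algebra.Algebra"
begin

definition periodic_group :: "('a, 'b) monoid_scheme \<Rightarrow> bool" where
  "periodic_group G \<longleftrightarrow> (\<forall>x \<in> carrier G. group.ord G x \<noteq> 0)"

inductive subnormal :: "('a, 'b) monoid_scheme \<Rightarrow> 'a set \<Rightarrow> bool" for G where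
  top: "subnormal G (carrier G)"
| step: "\<lbrakk> subnormal G K; subgroup H G; H \<lhd> (G\<lparr>carrier := K\<rparr>) \<rbrakk> \<Longrightarrow> subnormal G H"

definition commensurable :: "('a, 'b) monoid_scheme \<Rightarrow> 'a set \<Rightarrow> 'a set \<Rightarrow> bool" where
  "commensurable G H K \<longleftrightarrow>
     finite {(H \<inter> K) #>\<^bsub>G\<^esub> h | h. h \<in> H} \<and> finite {(H \<inter> K) #>\<^bsub>G\<^esub> k | k. k \<in> K}"

definition finite_rank :: "('a, 'b) monoid_scheme \<Rightarrow> 'a set \<Rightarrow> bool" where
  "finite_rank G H \<longleftrightarrow> (\<exists>r::nat. \<forall>S. finite S \<and> S \<subseteq> H \<longrightarrow>
      (\<exists>T. finite T \<and> T \<subseteq> H \<and> card T \<le> r \<and> generate G T = generate G S))"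

definition commutator_set :: "('a, 'b) monoid_scheme \<Rightarrow> 'a set \<Rightarrow> 'a set \<Rightarrow> 'a set" where
  "commutator_set G A B = (\<Union>a \<in> A. \<Union>b \<in> B.
      { a \<otimes>\<^bsub>G\<^esub> b \<otimes>\<^bsub>G\<^esub> inv\<^bsub>G\<^esub> a \<otimes>\<^bsub>G\<^esub> inv\<^bsub>G\<^esub> b })"

fun lower_central :: "('a, 'b) monoid_scheme \<Rightarrow> 'a set \<Rightarrow> nat \<Rightarrow> 'a set" where
  "lower_central G H 0 = H"
| "lower_central G H (Suc n) = generate G (commutator_set G (lower_central G H n) H)"

definition nilpotent_subgroup :: "('a, 'b) monoid_scheme \<Rightarrow> 'a set \<Rightarrow> bool" where
  "nilpotent_subgroup G H \<longleftrightarrow> subgroup H G \<and> (\<exists>n. lower_central G H n = {\<one>\<^bsub>G\<^esub>})"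

definition locally_nilpotent :: "('a, 'b) monoid_scheme \<Rightarrow> 'a set \<Rightarrow> bool" where
  "locally_nilpotent G H \<longleftrightarrow> subgroup H G \<and>
     (\<forall>S. finite S \<and> S \<subseteq> H \<longrightarrow> nilpotent_subgroup G (generate G S))"

definition hirsch_plotkin_radical :: "('a, 'b) monoid_scheme \<Rightarrow> 'a set \<Rightarrow> bool" where
  "hirsch_plotkin_radical G R \<longleftrightarrow> R \<lhd> G \<and> locally_nilpotent G R \<and>
     (\<forall>N. N \<lhd> G \<and> locally_nilpotent G N \<longrightarrow> N \<subseteq> R)"

end

theory Submission
  imports Defs
begin

text \<open>
  Let \<open>H\<close> be subnormal; we may assume that \<open>H\<close> has finite rank. It suffices to find normal
  subgroups \<open>N\<^sub>1\<close>, \<open>N\<^sub>2\<close> of infinite rank such that \<open>H\<close> has finite index in \<open>HN\<^sub>1 \<inter> HN\<^sub>2\<close>: the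
  subnormal groups \<open>HN\<^sub>i\<close> have infinite rank, hence are commensurable with normal subgroups
  \<open>M\<^sub>i\<close>, and then \<open>H\<close> is commensurable with \<open>M\<^sub>1 \<inter> M\<^sub>2\<close>.

  The radical \<open>R\<close> is the direct product of its primary components \<open>R\<^sub>p\<close>. If all of them have finite
  rank, their ranks are unbounded, so there are disjoint sets of primes \<open>\<pi>\<close>, \<open>\<rho>\<close> for which \<open>R\<^sub>\<pi>\<close> and
  \<open>R\<^sub>\<rho>\<close> have infinite rank, and \<open>HR\<^sub>\<pi> \<inter> HR\<^sub>\<rho> = H\<close> by coprimality.

  If some \<open>R\<^sub>p\<close> has infinite rank, then it contains an infinite elementary abelian subnormal
  subgroup \<open>V\<close>. Choose infinite \<open>A, B \<le> V\<close> with \<open>A \<inter> B = 1\<close> and let \<open>N\<^sub>1\<close>, \<open>N\<^sub>2\<close> be normal subgroups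
  commensurable with \<open>A\<close> and \<open>B\<close>. Then \<open>N\<^sub>1 \<inter> N\<^sub>2\<close> is finite, and so is \<open>H \<inter> N\<^sub>1N\<^sub>2\<close>, because
  \<open>H \<inter> V\<close> is an elementary abelian group of finite rank.

  To find \<open>V\<close>, suppose that all abelian subnormal subgroups of a soluble \<open>p\<close>-group \<open>K\<close> have finite
  socle. A \<open>p\<close>-group acting on an abelian \<open>p\<close>-group with finite socle induces a finite group of
  automorphisms. By induction on the derived length, \<open>K'\<close> is abelian-by-finite; passing to
  centralizers of finite index one reaches a subgroup of class two, in which a maximal abelian
  subgroup is self-centralizing and so of finite index. Thus \<open>K\<close> is a finite extension of an
  abelian group with finite socle, and has finite rank.
\<close>

section \<open>Coverings by finitely many cosets\<close>

context group
begin

text \<open>\<open>H\<close> lies in finitely many right cosets of \<open>K\<close>. For a subgroup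
  \<open>K\<close> of \<open>H\<close> this is finite index, but neither inclusion nor closure is
  demanded, so that arbitrary pairs of sets can be compared.\<close>

definition finitely_covered :: "'a set \<Rightarrow> 'a set \<Rightarrow> bool" where
  "finitely_covered H K \<longleftrightarrow>
     (\<exists>F. finite F \<and> F \<subseteq> carrier G \<and> (\<forall>h\<in>H. \<exists>f\<in>F. h \<otimes> inv f \<in> K))"

definition commuting :: "'a set \<Rightarrow> 'a set \<Rightarrow> bool" where
  "commuting A B \<longleftrightarrow> (\<forall>a\<in>A. \<forall>b\<in>B. a \<otimes> b = b \<otimes> a)"

definition centralizer_in :: "'a set \<Rightarrow> 'a set \<Rightarrow> 'a set" where
  "centralizer_in H A = {h \<in> H. \<forall>a\<in>A. h \<otimes> a = a \<otimes> h}"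

text \<open>Only one inclusion is asked for; if \<open>H\<close> is a subgroup, applying it to
  \<open>h\<close> and to its inverse shows that conjugation by \<open>h\<close> maps
  \<open>K\<close> onto itself.\<close>

definition normalizes :: "'a set \<Rightarrow> 'a set \<Rightarrow> bool" where
  "normalizes H K \<longleftrightarrow> (\<forall>h\<in>H. \<forall>k\<in>K. h \<otimes> k \<otimes> inv h \<in> K)"

text \<open>For an abelian \<open>p\<close>-group \<open>W\<close> the set
  \<open>torsion W p\<close> is the socle of \<open>W\<close>.\<close>

definition torsion :: "'a set \<Rightarrow> nat \<Rightarrow> 'a set" where
  "torsion W n = {w \<in> W. w [^] n = \<one>}"

definition p_elements :: "nat \<Rightarrow> 'a set \<Rightarrow> bool" where
  "p_elements p W \<longleftrightarrow> (\<forall>w\<in>W. \<exists>n. w [^] (p ^ n) = \<one>)"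

lemma inv_cancel [simp]:
  assumes "x \<in> carrier G" "y \<in> carrier G"
  shows "inv x \<otimes> (x \<otimes> y) = y" "x \<otimes> (inv x \<otimes> y) = y"
  using assms by (simp_all add: m_assoc [symmetric])

lemma conj_pow:
  assumes "x \<in> carrier G" "g \<in> carrier G"
  shows "(g \<otimes> x \<otimes> inv g) [^] (n::nat) = g \<otimes> x [^] n \<otimes> inv g"
  by (induction n) (use assms in \<open>simp_all add: m_assoc\<close>)

lemma subgroup_nat_pow:
  assumes "subgroup H G" "x \<in> H" shows "x [^] (n::nat) \<in> H"
  by (induction n) (use assms subgroup.m_closed subgroup.one_closed in auto)

lemma subgroup_mult_inv:
  assumes "subgroup H G" "x \<in> H" "y \<in> H" shows "x \<otimes> inv y \<in> H"
  using assms by (simp add: subgroup.m_closed subgroup.m_inv_closed)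

lemma subgroup_memI:
  assumes "subgroup H G" "x \<otimes> y \<in> H" "x \<in> carrier G" "y \<in> carrier G"
  shows "x \<in> H \<longleftrightarrow> y \<in> H"
proof
  assume "x \<in> H"
  then have "inv x \<otimes> (x \<otimes> y) \<in> H" using assms by (meson subgroup.m_closed subgroup.m_inv_closed)
  then show "y \<in> H" using assms by simp
next
  assume "y \<in> H"
  then have "x \<otimes> y \<otimes> inv y \<in> H" using assms by (meson subgroup_mult_inv)
  then show "x \<in> H" using assms by (simp add: m_assoc)
qed

lemma finitely_covered_mono:
  assumes "finitely_covered H K" "H' \<subseteq> H" "K \<subseteq> K'" shows "finitely_covered H' K'"
proof -
  obtain F where F: "finite F" "F \<subseteq> carrier G" "\<forall>h\<in>H. \<exists>f\<in>F. h \<otimes> inv f \<in> K"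
    using assms finitely_covered_def by auto
  then show ?thesis unfolding finitely_covered_def using assms(2,3) by (intro exI [of _ F]) blast
qed

text \<open>If \<open>h\<close> lies in the coset of \<open>f\<close> modulo \<open>K\<close> and
  \<open>h \<otimes> inv f\<close> in that of \<open>e\<close> modulo \<open>L\<close>, then
  \<open>e \<otimes> f\<close> represents \<open>h\<close> modulo \<open>L\<close>.\<close>

lemma finitely_covered_trans:
  assumes "finitely_covered H K" "finitely_covered K L"
    and "H \<subseteq> carrier G" shows "finitely_covered H L"
proof -
  obtain F where F: "finite F" "F \<subseteq> carrier G" "\<forall>h\<in>H. \<exists>f\<in>F. h \<otimes> inv f \<in> K"
    using assms finitely_covered_def by auto
  obtain E where E: "finite E" "E \<subseteq> carrier G" "\<forall>h\<in>K. \<exists>f\<in>E. h \<otimes> inv f \<in> L"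
    using assms finitely_covered_def by auto
  let ?P = "(\<lambda>(e,f). e \<otimes> f) ` (E \<times> F)"
  have "\<exists>g\<in>?P. h \<otimes> inv g \<in> L" if h: "h \<in> H" for h
  proof -
    obtain f where f: "f \<in> F" "h \<otimes> inv f \<in> K" using F h by blast
    obtain e where e: "e \<in> E" "h \<otimes> inv f \<otimes> inv e \<in> L" using E f by blast
    have "h \<in> carrier G" "e \<in> carrier G" "f \<in> carrier G"
      using h assms(3) e f E(2) F(2) by auto
    then have "h \<otimes> inv (e \<otimes> f) \<in> L" using e by (simp add: m_assoc inv_mult_group)
    then show ?thesis using e f by force
  qed
  moreover have "finite ?P" "?P \<subseteq> carrier G" using E F by auto
  ultimately show ?thesis unfolding finitely_covered_def by (intro exI [of _ ?P]) blast
qed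

lemma finitely_covered_finite:
  assumes "finitely_covered H K" "finite K" "H \<subseteq> carrier G" shows "finite H"
proof -
  obtain F where F: "finite F" "F \<subseteq> carrier G" "\<forall>h\<in>H. \<exists>f\<in>F. h \<otimes> inv f \<in> K"
    using assms finitely_covered_def by auto
  have "H \<subseteq> (\<lambda>(k,f). k \<otimes> f) ` (K \<times> F)"
  proof
    fix h assume h: "h \<in> H"
    then obtain f where f: "f \<in> F" "h \<otimes> inv f \<in> K" using F by blast
    have "h = (h \<otimes> inv f) \<otimes> f" using h f F(2) assms(3)
      by (auto simp: m_assoc subset_iff)
    then show "h \<in> (\<lambda>(k,f). k \<otimes> f) ` (K \<times> F)" using f by force
  qed
  then show ?thesis using F(1) assms(2) by (meson finite_SigmaI finite_imageI finite_subset)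
qed

lemma finitely_covered_of_finite:
  assumes "finite H" "H \<subseteq> carrier G" "\<one> \<in> K" shows "finitely_covered H K"
  unfolding finitely_covered_def using assms
  by (intro exI [of _ H]) (auto simp: subset_iff intro!: bexI)

text \<open>Representatives can be moved into \<open>H\<close> without increasing their number. The
  cardinality bound matters later, when representatives serve as generators in a rank
  estimate.\<close>

lemma covering_representatives:
  assumes E: "finite E" "E \<subseteq> carrier G" "\<forall>h\<in>H. \<exists>f\<in>E. h \<otimes> inv f \<in> K"
    and "subgroup K G" "H \<subseteq> carrier G"
  obtains F where "finite F" "F \<subseteq> H" "card F \<le> card E" "\<forall>h\<in>H. \<exists>f\<in>F. h \<otimes> inv f \<in> K"
proof -
  define r where "r e = (SOME h. h \<in> H \<and> h \<otimes> inv e \<in> K)" for e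
  have r: "r e \<in> H \<and> r e \<otimes> inv e \<in> K" if "h \<in> H" "h \<otimes> inv e \<in> K" for e h
    unfolding r_def using that by (rule_tac someI [of _ h]) auto
  \<comment> \<open>If the coset of \<open>e\<close> misses \<open>H\<close>, then
    \<open>r e\<close> is an unspecified value; intersecting with \<open>H\<close> removes such
    values unless they happen to be harmless elements of \<open>H\<close>.\<close>
  let ?F = "r ` E \<inter> H"
  have "\<exists>f\<in>?F. h \<otimes> inv f \<in> K" if h: "h \<in> H" for h
  proof -
    obtain e where e: "e \<in> E" "h \<otimes> inv e \<in> K" using E h by blast
    note re = r [OF h e(2)]
    have c: "h \<in> carrier G" "e \<in> carrier G" "r e \<in> carrier G" using e E h assms(5) re by auto
    have "(h \<otimes> inv e) \<otimes> inv (r e \<otimes> inv e) \<in> K"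
      using e re assms(4) by (meson subgroup_mult_inv)
    then have "h \<otimes> inv (r e) \<in> K" using c by (simp add: m_assoc inv_mult_group)
    then show ?thesis using e re by blast
  qed
  moreover have "card ?F \<le> card E"
    using card_mono [of "r ` E" ?F] card_image_le [OF E(1), of r] E(1) by fastforce
  ultimately show ?thesis using that [of ?F] E(1) by blast
qed

lemma finitely_coveredE:
  assumes "finitely_covered H K" "subgroup K G" "H \<subseteq> carrier G"
  obtains F where "finite F" "F \<subseteq> H" "\<forall>h\<in>H. \<exists>f\<in>F. h \<otimes> inv f \<in> K"
proof -
  obtain E where "finite E" "E \<subseteq> carrier G" "\<forall>h\<in>H. \<exists>f\<in>E. h \<otimes> inv f \<in> K"
    using assms finitely_covered_def by auto
  from covering_representatives [OF this assms(2,3)]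
  obtain F where F: "finite F" "F \<subseteq> H" "card F \<le> card E" "\<forall>h\<in>H. \<exists>f\<in>F. h \<otimes> inv f \<in> K" .
  show ?thesis using that [OF F(1,2,4)] .
qed

text \<open>Each \<open>h\<close> determines a pair of cosets, one for \<open>K\<close> and one for
  \<open>L\<close>. Two elements of \<open>H\<close> with the same pair have their quotient in
  \<open>K \<inter> L\<close>, so one representative per occurring pair suffices.\<close>

lemma finitely_covered_Int:
  assumes "finitely_covered H K" "finitely_covered H L" "subgroup K G" "subgroup L G" "H \<subseteq> carrier G"
  shows "finitely_covered H (K \<inter> L)"
proof -
  obtain F where F: "finite F" "F \<subseteq> carrier G" "\<forall>h\<in>H. \<exists>f\<in>F. h \<otimes> inv f \<in> K"
    using assms finitely_covered_def by auto
  obtain E where E: "finite E" "E \<subseteq> carrier G" "\<forall>h\<in>H. \<exists>f\<in>E. h \<otimes> inv f \<in> L"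
    using assms finitely_covered_def by auto
  define r where "r u = (SOME h. h \<in> H \<and> h \<otimes> inv (fst u) \<in> K \<and> h \<otimes> inv (snd u) \<in> L)" for u
  have r: "r (f,e) \<in> H \<and> r (f,e) \<otimes> inv f \<in> K \<and> r (f,e) \<otimes> inv e \<in> L"
    if "h \<in> H" "h \<otimes> inv f \<in> K" "h \<otimes> inv e \<in> L" for e f h
    unfolding r_def fst_conv snd_conv using that by (rule_tac someI [of _ h]) auto
  let ?F = "r ` (F \<times> E) \<inter> H"
  have "\<exists>g\<in>?F. h \<otimes> inv g \<in> K \<inter> L" if h: "h \<in> H" for h
  proof -
    obtain f where f: "f \<in> F" "h \<otimes> inv f \<in> K" using F h by blast
    obtain e where e: "e \<in> E" "h \<otimes> inv e \<in> L" using E h by blast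
    note re = r [OF h f(2) e(2)]
    have c: "h \<in> carrier G" "e \<in> carrier G" "f \<in> carrier G" "r (f,e) \<in> carrier G"
      using e f E F h assms(5) re by auto
    have "(h \<otimes> inv f) \<otimes> inv (r (f,e) \<otimes> inv f) \<in> K"
      using f re assms(3) by (meson subgroup_mult_inv)
    moreover have "(h \<otimes> inv e) \<otimes> inv (r (f,e) \<otimes> inv e) \<in> L"
      using e re assms(4) by (meson subgroup_mult_inv)
    ultimately have "h \<otimes> inv (r (f,e)) \<in> K \<inter> L" using c by (simp add: m_assoc inv_mult_group)
    then show ?thesis using e f re by blast
  qed
  moreover have "finite ?F" "?F \<subseteq> carrier G" using F E assms(5) by auto
  ultimately show ?thesis unfolding finitely_covered_def by (intro exI [of _ ?F]) blast
qed

lemma finitely_covered_Int_left: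
  assumes "finitely_covered H K" "subgroup K G" "subgroup L G" "H \<subseteq> carrier G"
  shows "finitely_covered (H \<inter> L) (K \<inter> L)"
proof -
  have "finitely_covered (H \<inter> L) K" using assms(1) by (rule finitely_covered_mono) auto
  moreover have "finitely_covered (H \<inter> L) L"
    unfolding finitely_covered_def using assms
    by (intro exI [of _ "{\<one>}"]) (auto simp: subgroup.mem_carrier)
  ultimately show ?thesis using finitely_covered_Int assms by blast
qed

section \<open>Commensurability and subnormality in terms of elements\<close>

lemma rcos_eq_iff:
  assumes "subgroup L G" "h \<in> carrier G" "f \<in> carrier G"
  shows "L #> h = L #> f \<longleftrightarrow> h \<otimes> inv f \<in> L"
proof
  assume "L #> h = L #> f"
  then have "h \<in> L #> f" using rcos_self [OF assms(2,1)] by simp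
  then obtain l where "l \<in> L" "h = l \<otimes> f" unfolding r_coset_def by auto
  moreover have "l \<in> carrier G" using \<open>l \<in> L\<close> assms(1) by (simp add: subgroup.mem_carrier)
  ultimately show "h \<otimes> inv f \<in> L" using assms by (simp add: m_assoc)
next
  assume l: "h \<otimes> inv f \<in> L"
  have "h = (h \<otimes> inv f) \<otimes> f" using assms by (simp add: m_assoc)
  then have "h \<in> L #> f" unfolding r_coset_def using l by blast
  then show "L #> h = L #> f" using repr_independence [OF _ _ assms(1), of h f] assms by simp
qed

lemma finite_rcos_iff_finitely_covered:
  assumes "subgroup H G" "subgroup L G"
  shows "finite {L #> h | h. h \<in> H} \<longleftrightarrow> finitely_covered H L" (is "?l \<longleftrightarrow> ?r")
proof -
  have eq: "{L #> h | h. h \<in> H} = (\<lambda>h. L #> h) ` H" by auto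
  note sub = subgroup.subset [OF assms(1)]
  show ?thesis
  proof
    assume ?l
    from finite_subset_image [OF this [unfolded eq] subset_refl]
    obtain F where F: "F \<subseteq> H" "finite F" "(\<lambda>h. L #> h) ` H = (\<lambda>h. L #> h) ` F" by auto
    have "\<exists>f\<in>F. h \<otimes> inv f \<in> L" if "h \<in> H" for h
    proof -
      have "L #> h \<in> (\<lambda>h. L #> h) ` F" using F(3) that by blast
      then obtain f where f: "f \<in> F" "L #> h = L #> f" by auto
      then have "h \<otimes> inv f \<in> L" using rcos_eq_iff [OF assms(2), of h f] F(1) sub that by auto
      then show ?thesis using f by auto
    qed
    then show ?r unfolding finitely_covered_def using F(1,2) sub by (intro exI [of _ F]) auto
  next
    assume ?r
    then obtain F where F: "finite F" "F \<subseteq> carrier G" "\<forall>h\<in>H. \<exists>f\<in>F. h \<otimes> inv f \<in> L"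
      unfolding finitely_covered_def by auto
    have "(\<lambda>h. L #> h) ` H \<subseteq> (\<lambda>h. L #> h) ` F"
    proof
      fix y assume "y \<in> (\<lambda>h. L #> h) ` H"
      then obtain h where h: "h \<in> H" "y = L #> h" by auto
      then obtain f where f: "f \<in> F" "h \<otimes> inv f \<in> L" using F by blast
      then have "L #> h = L #> f" using rcos_eq_iff [OF assms(2), of h f] h F(2) sub by auto
      then show "y \<in> (\<lambda>h. L #> h) ` F" using f h by auto
    qed
    then show ?l unfolding eq using F(1) finite_subset by blast
  qed
qed

lemma commensurable_iff:
  assumes "subgroup H G" "subgroup K G"
  shows "commensurable G H K \<longleftrightarrow> finitely_covered H (H \<inter> K) \<and> finitely_covered K (H \<inter> K)"
  unfolding commensurable_def using assms
  by (simp add: finite_rcos_iff_finitely_covered subgroups_Inter_pair)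

lemma normal_restrictI:
  assumes "subgroup H G" "subgroup K G" "H \<subseteq> K" "normalizes K H"
  shows "H \<lhd> (G\<lparr>carrier := K\<rparr>)"
proof -
  interpret K: group "G\<lparr>carrier := K\<rparr>" using assms(2) by (rule subgroup_imp_group)
  have "subgroup H (G\<lparr>carrier := K\<rparr>)" using assms by (simp add: subgroup_incl)
  then show ?thesis unfolding K.normal_inv_iff using assms
    by (auto simp: normalizes_def m_inv_consistent)
qed

lemma normal_restrictD:
  assumes "H \<lhd> (G\<lparr>carrier := K\<rparr>)" "subgroup K G"
  shows "normalizes K H" "H \<subseteq> K"
proof -
  interpret K: group "G\<lparr>carrier := K\<rparr>" using assms(2) by (rule subgroup_imp_group)
  show "normalizes K H" "H \<subseteq> K" using assms unfolding K.normal_inv_iff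
    by (auto simp: normalizes_def m_inv_consistent dest!: subgroup.subset)
qed

lemma subnormal_subgroup: "subnormal G H \<Longrightarrow> subgroup H G"
  by (induction rule: subnormal.induct) (auto simp: subgroup_self)

lemma subnormal_stepI:
  assumes "subnormal G K" "subgroup H G" "H \<subseteq> K" "normalizes K H"
  shows "subnormal G H"
  using assms normal_restrictI subnormal_subgroup subnormal.step by metis

lemma normal_imp_normalizes: "N \<lhd> G \<Longrightarrow> normalizes (carrier G) N"
  unfolding normal_inv_iff normalizes_def by auto

lemma normalI': "subgroup N G \<Longrightarrow> normalizes (carrier G) N \<Longrightarrow> N \<lhd> G"
  unfolding normal_inv_iff normalizes_def by auto

lemma normal_imp_subnormal: "N \<lhd> G \<Longrightarrow> subnormal G N"
  using subnormal_stepI [OF subnormal.top]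
  by (metis normal_imp_normalizes normal_imp_subgroup subgroup.subset)

lemma generate_subset_subgroup:
  assumes "subgroup H G" "S \<subseteq> H" shows "generate G S \<subseteq> H"
  using assms by (rule generate_subgroup_incl [rotated])

lemma normalizes_generate:
  assumes "normalizes H S" "H \<subseteq> carrier G" "S \<subseteq> carrier G"
  shows "normalizes H (generate G S)"
  unfolding normalizes_def
proof (intro ballI)
  fix h k assume h: "h \<in> H" and k: "k \<in> generate G S"
  have hc: "h \<in> carrier G" using h assms by auto
  from k show "h \<otimes> k \<otimes> inv h \<in> generate G S"
  proof (induction rule: generate.induct)
    case one then show ?case using hc by (simp add: generate.one)
  next
    case (incl k) then show ?case using assms h by (simp add: normalizes_def generate.incl)
  next
    case (inv k)
    have "inv (h \<otimes> k \<otimes> inv h) \<in> generate G S"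
      using assms h inv by (simp add: normalizes_def generate.inv)
    moreover have "k \<in> carrier G" using inv assms by auto
    ultimately show ?case using hc by (simp add: inv_mult_group m_assoc)
  next
    case (eng a b)
    have "a \<in> carrier G" "b \<in> carrier G" using eng assms generate_in_carrier by blast+
    then have "h \<otimes> (a \<otimes> b) \<otimes> inv h = (h \<otimes> a \<otimes> inv h) \<otimes> (h \<otimes> b \<otimes> inv h)"
      using hc by (simp add: m_assoc)
    then show ?case using eng by (simp add: generate.eng)
  qed
qed

section \<open>Centralizers and their index\<close>

lemma centralizer_subgroup:
  assumes "subgroup H G" "A \<subseteq> carrier G" shows "subgroup (centralizer_in H A) G"
proof (rule subgroupI)
  have H: "H \<subseteq> carrier G" using assms subgroup.subset by auto
  show "centralizer_in H A \<subseteq> carrier G" using H by (auto simp: centralizer_in_def)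
  show "centralizer_in H A \<noteq> {}" using assms subgroup.one_closed [OF assms(1)]
    by (auto simp: centralizer_in_def intro!: exI [of _ \<one>])
  fix x y assume x: "x \<in> centralizer_in H A" and y: "y \<in> centralizer_in H A"
  have "x \<otimes> y \<otimes> a = a \<otimes> (x \<otimes> y)" if "a \<in> A" for a
  proof -
    have "x \<in> carrier G" "y \<in> carrier G" "a \<in> carrier G" using x y H assms that by (auto simp: centralizer_in_def)
    moreover have "x \<otimes> a = a \<otimes> x" "y \<otimes> a = a \<otimes> y" using x y that by (auto simp: centralizer_in_def)
    ultimately show ?thesis using m_assoc [of x y a] m_assoc [of x a y] m_assoc [of a x y] by simp
  qed
  then show "x \<otimes> y \<in> centralizer_in H A" using x y assms(1) by (auto simp: centralizer_in_def subgroup.m_closed)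
next
  have H: "H \<subseteq> carrier G" using assms subgroup.subset by auto
  fix x assume x: "x \<in> centralizer_in H A"
  have "inv x \<otimes> a = a \<otimes> inv x" if "a \<in> A" for a
  proof -
    have "x \<in> carrier G" "a \<in> carrier G" "x \<otimes> a = a \<otimes> x"
      using x H assms that by (auto simp: centralizer_in_def)
    note * = this
    then have "inv x \<otimes> (a \<otimes> x) \<otimes> inv x = inv x \<otimes> (x \<otimes> a) \<otimes> inv x" by simp
    then show ?thesis using *(1,2) by (simp add: m_assoc)
  qed
  then show "inv x \<in> centralizer_in H A" using x assms(1) by (auto simp: centralizer_in_def subgroup.m_inv_closed)
qed

lemma commuting_mono: "commuting A B \<Longrightarrow> A' \<subseteq> A \<Longrightarrow> B' \<subseteq> B \<Longrightarrow> commuting A' B'"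
  unfolding commuting_def by (meson subsetD)

text \<open>To test \<open>h \<otimes> k \<otimes> inv h\<close> against \<open>a\<close>, conjugate
  \<open>a\<close> back by \<open>inv h\<close>: the result is in \<open>A\<close> and commutes with
  \<open>k\<close>.\<close>

lemma normalizes_centralizer:
  assumes "normalizes H K" "normalizes H A" "subgroup H G" "K \<subseteq> carrier G" "A \<subseteq> carrier G"
  shows "normalizes H (centralizer_in K A)"
  unfolding normalizes_def
proof (intro ballI)
  fix h k assume h: "h \<in> H" and k: "k \<in> centralizer_in K A"
  have hc: "h \<in> carrier G" using subgroup.mem_carrier [OF assms(3) h] .
  have kc: "k \<in> carrier G" using k assms(4) by (auto simp: centralizer_in_def)
  have "(h \<otimes> k \<otimes> inv h) \<otimes> a = a \<otimes> (h \<otimes> k \<otimes> inv h)" if a: "a \<in> A" for a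
  proof -
    have ac: "a \<in> carrier G" using a assms by auto
    have "inv h \<otimes> a \<otimes> inv (inv h) \<in> A" using assms(2) a subgroup.m_inv_closed [OF assms(3) h]
      unfolding normalizes_def by blast
    then have "inv h \<otimes> a \<otimes> h \<in> A" using hc by simp
    then have e: "k \<otimes> (inv h \<otimes> a \<otimes> h) = (inv h \<otimes> a \<otimes> h) \<otimes> k"
      using k by (simp add: centralizer_in_def)
    have "(h \<otimes> k \<otimes> inv h) \<otimes> a = h \<otimes> (k \<otimes> (inv h \<otimes> a \<otimes> h)) \<otimes> inv h"
      using hc kc ac by (simp add: m_assoc)
    also have "\<dots> = a \<otimes> (h \<otimes> k \<otimes> inv h)" unfolding e using hc kc ac by (simp add: m_assoc)
    finally show ?thesis .
  qed
  then show "h \<otimes> k \<otimes> inv h \<in> centralizer_in K A"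
    using h k assms(1) by (auto simp: centralizer_in_def normalizes_def)
qed

text \<open>Orbit-stabilizer: the cosets of the centralizer of \<open>a\<close> correspond to the
  conjugates of \<open>a\<close>.\<close>

lemma finitely_covered_centralizer1:
  assumes "subgroup H G" "a \<in> carrier G" "finite ((\<lambda>h. h \<otimes> a \<otimes> inv h) ` H)"
  shows "finitely_covered H (centralizer_in H {a})"
proof -
  have H: "H \<subseteq> carrier G" using assms subgroup.subset by auto
  \<comment> \<open>Right cosets call for conjugation from the other side:
    \<open>h \<otimes> inv f\<close> centralizes \<open>a\<close> exactly if
    \<open>?c h = ?c f\<close>.\<close>
  let ?c = "\<lambda>h. inv h \<otimes> a \<otimes> h"
  have "?c ` H \<subseteq> (\<lambda>h. h \<otimes> a \<otimes> inv h) ` H"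
  proof
    fix y assume "y \<in> ?c ` H"
    then obtain h where h: "h \<in> H" "y = ?c h" by auto
    then show "y \<in> (\<lambda>h. h \<otimes> a \<otimes> inv h) ` H" using H assms(1)
      by (intro image_eqI [of _ _ "inv h"]) (auto simp: subgroup.m_inv_closed)
  qed
  then have "finite (?c ` H)" using assms(3) finite_subset by blast
  from finite_subset_image [OF this subset_refl]
  obtain F where F: "F \<subseteq> H" "finite F" "?c ` H = ?c ` F" by auto
  have "\<exists>f\<in>F. h \<otimes> inv f \<in> centralizer_in H {a}" if h: "h \<in> H" for h
  proof -
    have "?c h \<in> ?c ` F" using F h by blast
    then obtain f where f: "f \<in> F" "?c h = ?c f" by auto
    have c: "h \<in> carrier G" "f \<in> carrier G" using f F h H by auto
    have "h \<otimes> (?c h) \<otimes> inv f = h \<otimes> (?c f) \<otimes> inv f" using f by simp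
    then have "a \<otimes> (h \<otimes> inv f) = (h \<otimes> inv f) \<otimes> a" using c assms by (simp add: m_assoc)
    moreover have "h \<otimes> inv f \<in> H" using f F h assms by (meson subgroup_mult_inv subsetD)
    ultimately show ?thesis using f by (auto simp: centralizer_in_def)
  qed
  then show ?thesis unfolding finitely_covered_def using F(1,2) H by (intro exI [of _ F]) auto
qed

lemma finitely_covered_centralizer:
  assumes "finite A" "subgroup H G" "A \<subseteq> carrier G"
    and "\<And>a. a \<in> A \<Longrightarrow> finite ((\<lambda>h. h \<otimes> a \<otimes> inv h) ` H)"
  shows "finitely_covered H (centralizer_in H A)"
  using assms(1,3,4)
proof (induction A rule: finite_induct)
  case empty
  show ?case unfolding finitely_covered_def using assms(2)
    by (intro exI [of _ "{\<one>}"]) (auto simp: centralizer_in_def subgroup.mem_carrier)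
next
  case (insert a A)
  have "finitely_covered H (centralizer_in H {a} \<inter> centralizer_in H A)"
  proof (rule finitely_covered_Int)
    show "finitely_covered H (centralizer_in H {a})"
      using insert.prems assms(2) by (intro finitely_covered_centralizer1) auto
    show "finitely_covered H (centralizer_in H A)" using insert by simp
    show "subgroup (centralizer_in H {a}) G" "subgroup (centralizer_in H A) G"
      using insert.prems assms(2) by (intro centralizer_subgroup; simp)+
  qed (use assms(2) subgroup.subset in auto)
  moreover have "centralizer_in H {a} \<inter> centralizer_in H A = centralizer_in H (insert a A)"
    by (auto simp: centralizer_in_def)
  ultimately show ?case by simp
qed

section \<open>Abelian p-groups with finite socle\<close>

lemma mult_inv_eqD:
  assumes "x \<otimes> inv y = z" "x \<in> carrier G" "y \<in> carrier G"
  shows "x = z \<otimes> y"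
  using assms(2,3) unfolding assms(1) [symmetric] by (simp add: m_assoc)

lemma pow_one_dvd:
  assumes "x [^] (m::nat) = \<one>" "m dvd n" "x \<in> carrier G" shows "x [^] n = \<one>"
proof -
  obtain k where "n = m * k" using assms(2) by (elim dvdE)
  then show ?thesis using assms nat_pow_pow [of x m k] by simp
qed

lemma commuting_pow_distrib:
  assumes "subgroup W G" "commuting W W" "x \<in> W" "y \<in> W"
  shows "(x \<otimes> y) [^] (n::nat) = x [^] n \<otimes> y [^] n"
  using assms by (intro pow_mult_distrib) (auto simp: commuting_def subgroup.mem_carrier)

lemma commuting_pow_diff:
  assumes "subgroup W G" "commuting W W" "x \<in> W" "y \<in> W"
  shows "(x \<otimes> inv y) [^] (n::nat) = x [^] n \<otimes> inv (y [^] n)"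
  using assms
  by (simp add: commuting_pow_distrib subgroup.m_inv_closed nat_pow_inv subgroup.mem_carrier)

lemma torsion_subgroup:
  assumes "subgroup W G" "commuting W W" shows "subgroup (torsion W n) G"
proof (rule subgroupI)
  show "torsion W n \<subseteq> carrier G" using subgroup.subset [OF assms(1)] by (auto simp: torsion_def)
  show "torsion W n \<noteq> {}" using subgroup.one_closed [OF assms(1)] by (auto simp: torsion_def)
  fix x assume x: "x \<in> torsion W n"
  then have "inv x [^] n = \<one>" using assms by (simp add: torsion_def nat_pow_inv subgroup.mem_carrier)
  then show "inv x \<in> torsion W n" using x assms by (auto simp: torsion_def subgroup.m_inv_closed)
next
  fix x y assume "x \<in> torsion W n" "y \<in> torsion W n"
  then show "x \<otimes> y \<in> torsion W n" using assms
    by (simp add: torsion_def commuting_pow_distrib subgroup.m_closed)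
qed

lemma normalizes_torsion:
  assumes "normalizes H W" "H \<subseteq> carrier G" "W \<subseteq> carrier G"
  shows "normalizes H (torsion W n)"
  using assms by (auto simp: normalizes_def torsion_def conj_pow subset_iff)

context
  fixes W :: "'a set" and p :: nat
  assumes W: "subgroup W G" and comm: "commuting W W" and pW: "p_elements p W"
    and fin: "finite (torsion W p)"
begin

text \<open>The \<open>p\<close>-th power map sends the elements killed by \<open>p ^ Suc n\<close>
  into those killed by \<open>p ^ n\<close>, and each nonempty fibre lies in a coset of the finite
  socle.\<close>

lemma finite_torsion_prime_power: "finite (torsion W (p ^ n))"
proof (induction n)
  case 0
  have "torsion W (p ^ 0) \<subseteq> {\<one>}" using subgroup.mem_carrier [OF W] by (auto simp: torsion_def)
  then show ?case using finite_subset by blast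
next
  case (Suc n)
  let ?h = "\<lambda>x. x [^] p"
  have "finite (?h -` {y} \<inter> torsion W (p ^ Suc n))" for y
  proof (cases "?h -` {y} \<inter> torsion W (p ^ Suc n) = {}")
    case False
    then obtain x where x: "x \<in> W" "x [^] p = y" by (auto simp: torsion_def)
    have "?h -` {y} \<inter> torsion W (p ^ Suc n) \<subseteq> (\<lambda>t. t \<otimes> x) ` torsion W p"
    proof
      fix z assume "z \<in> ?h -` {y} \<inter> torsion W (p ^ Suc n)"
      then have z: "z \<in> W" "z [^] p = y" by (auto simp: torsion_def)
      have c: "x \<in> carrier G" "z \<in> carrier G" using x z subgroup.mem_carrier [OF W] by auto
      have "z \<otimes> inv x \<in> torsion W p" using x z c commuting_pow_diff [OF W comm z(1) x(1)] W
        by (auto simp: torsion_def subgroup_mult_inv)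
      moreover have "z = (z \<otimes> inv x) \<otimes> x" using c by (simp add: m_assoc)
      ultimately show "z \<in> (\<lambda>t. t \<otimes> x) ` torsion W p" by blast
    qed
    then show ?thesis using fin finite_subset by blast
  qed simp
  then have "finite (?h -` torsion W (p ^ n) \<inter> torsion W (p ^ Suc n))"
    using Suc finite_finite_vimage_IntI by blast
  moreover have "torsion W (p ^ Suc n) \<subseteq> ?h -` torsion W (p ^ n)"
    using subgroup.mem_carrier [OF W] subgroup_nat_pow [OF W] by (auto simp: torsion_def nat_pow_pow)
  ultimately show ?case by (simp add: Int_absorb1)
qed

text \<open>A descending chain of finite sets stabilizes, so from some \<open>k\<close> on every socle element of
  \<open>W\<^sup>p\<^sup>k\<close> has infinite height; induction on the order then gives divisibility.\<close>

lemma divisible_power_image: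
  "\<exists>k. \<forall>x \<in> (\<lambda>w. w [^] (p ^ k)) ` W. \<exists>y \<in> (\<lambda>w. w [^] (p ^ k)) ` W. x = y [^] p"
proof -
  define D where "D k = (\<lambda>w. w [^] (p ^ k)) ` W" for k
  define S where "S k = D k \<inter> torsion W p" for k
  have DW: "D k \<subseteq> W" for k using subgroup_nat_pow [OF W] by (auto simp: D_def)
  have Dadd: "D (k + j) \<subseteq> D k" for k j
  proof
    fix x assume "x \<in> D (k + j)"
    then obtain w where w: "w \<in> W" "x = w [^] (p ^ (k + j))" by (auto simp: D_def)
    then have "x = (w [^] (p ^ j)) [^] (p ^ k)"
      using subgroup.mem_carrier [OF W] by (simp add: nat_pow_pow power_add mult.commute)
    then show "x \<in> D k" using subgroup_nat_pow [OF W w(1)] by (auto simp: D_def)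
  qed
  have Dmul: "x \<otimes> y \<in> D k" if xy: "x \<in> D k" "y \<in> D k" for x y k
  proof -
    obtain u v where "u \<in> W" "v \<in> W" "x = u [^] (p ^ k)" "y = v [^] (p ^ k)" using xy by (auto simp: D_def)
    then show ?thesis using commuting_pow_distrib [OF W comm, of u v] subgroup.m_closed [OF W, of u v]
      by (auto simp: D_def intro!: image_eqI [of _ _ "u \<otimes> v"])
  qed
  have Dinv: "inv x \<in> D k" if x: "x \<in> D k" for x k
  proof -
    obtain u where "u \<in> W" "x = u [^] (p ^ k)" using x by (auto simp: D_def)
    then show ?thesis using subgroup.m_inv_closed [OF W, of u] subgroup.mem_carrier [OF W, of u]
      by (auto simp: D_def nat_pow_inv intro!: image_eqI [of _ _ "inv u"])
  qed
  have Dpow: "x [^] n \<in> D k" if x: "x \<in> D k" for x k and n :: nat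
  proof (induction n)
    case 0
    have "\<one> \<in> D k" using subgroup.one_closed [OF W] by (auto simp: D_def intro!: image_eqI [of _ _ "\<one>"])
    then show ?case by simp
  next
    case (Suc n) then show ?case using x Dmul by simp
  qed
  define k where "k = arg_min (\<lambda>k. card (S k)) (\<lambda>_. True)"
  have kmin: "card (S k) \<le> card (S j)" for j unfolding k_def by (rule arg_min_nat_le) simp
  have Sfin: "finite (S j)" for j using fin by (simp add: S_def)
  have Sk: "S (k + j) = S k" for j
    using card_seteq [OF Sfin, of "S (k + j)" k] kmin [of "k + j"] Dadd [of k j] by (auto simp: S_def)
  have div: "\<exists>y\<in>D k. x = y [^] p" if "x \<in> D k" "x [^] (p ^ n) = \<one>" for n x
    using that
  proof (induction n arbitrary: x)
    case 0
    moreover have "x \<in> carrier G" using 0(1) DW subgroup.mem_carrier [OF W] by blast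
    ultimately have "x = \<one>" by simp
    then show ?case using Dpow [OF 0(1), of 0] by (intro bexI [of _ \<one>]) auto
  next
    case (Suc n)
    have xc: "x \<in> W" "x \<in> carrier G" using Suc DW subgroup.mem_carrier [OF W] by auto
    have "(x [^] (p ^ n)) [^] p = \<one>" using Suc.prems xc by (simp add: nat_pow_pow mult.commute)
    then have "x [^] (p ^ n) \<in> S k"
      using Dpow [OF Suc.prems(1)] DW by (auto simp: S_def torsion_def)
    \<comment> \<open>The socle of \<open>D k\<close> does not shrink further down the chain, so
      \<open>x [^] (p ^ n)\<close> equals \<open>y [^] (p ^ Suc n)\<close> for some \<open>y\<close>
      in \<open>D k\<close>. Dividing \<open>x\<close> by \<open>y [^] p\<close> lowers the
      exponent, and the induction hypothesis applies to the quotient.\<close>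
    then have "x [^] (p ^ n) \<in> D (k + Suc n)" using Sk [of "Suc n"] by (auto simp: S_def)
    then obtain w where w: "w \<in> W" "x [^] (p ^ n) = w [^] (p ^ (k + Suc n))" by (auto simp: D_def)
    define y where "y = w [^] (p ^ k)"
    have y: "y \<in> D k" "y \<in> W" "y \<in> carrier G" using w DW subgroup.mem_carrier [OF W] by (auto simp: y_def D_def)
    have eq: "x [^] (p ^ n) = (y [^] p) [^] (p ^ n)"
      using w subgroup.mem_carrier [OF W] by (simp add: y_def nat_pow_pow power_add mult_ac)
    have "(x \<otimes> inv (y [^] p)) [^] (p ^ n) = \<one>"
      using commuting_pow_diff [OF W comm xc(1) subgroup_nat_pow [OF W y(2)]] y eq by simp
    then obtain z where z: "z \<in> D k" "x \<otimes> inv (y [^] p) = z [^] p"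
      using Suc.IH [of "x \<otimes> inv (y [^] p)"] Dmul Dinv Dpow Suc.prems(1) y(1) by blast
    have zc: "z \<in> W" "z \<in> carrier G" using z DW subgroup.mem_carrier [OF W] by auto
    have "x = z [^] p \<otimes> y [^] p" using mult_inv_eqD [OF z(2)] xc y by simp
    then have "x = (z \<otimes> y) [^] p" using commuting_pow_distrib [OF W comm zc(1) y(2)] by simp
    then show ?case using Dmul z y by blast
  qed
  have "\<exists>y\<in>D k. x = y [^] p" if x: "x \<in> D k" for x
  proof -
    have "x \<in> W" using x DW by blast
    then obtain n where "x [^] (p ^ n) = \<one>" using pW by (auto simp: p_elements_def)
    then show ?thesis using div x by blast
  qed
  then show ?thesis unfolding D_def by (intro exI [of _ k]) blast
qed

text \<open>\<open>W\<close> is the product of a group of exponent dividing \<open>p ^ k\<close> and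
  the divisible group of \<open>p ^ k\<close>-th powers. Given \<open>w\<close>, write
  \<open>w [^] (p ^ k)\<close> as \<open>d [^] (p ^ (k + j))\<close>; then \<open>w\<close> divided
  by \<open>d [^] (p ^ j)\<close> is killed by \<open>p ^ k\<close>.\<close>

lemma torsion_times_divisible:
  "\<exists>k. (\<forall>w\<in>W. \<forall>j::nat. \<exists>e \<in> torsion W (p ^ k). \<exists>d \<in> W. w = e \<otimes> d [^] (p ^ j)) \<and>
       (\<forall>w\<in>W. \<forall>j::nat. \<exists>d \<in> W. w [^] (p ^ k) = d [^] (p ^ (k + j)))"
proof -
  obtain k where k: "\<forall>x \<in> (\<lambda>w. w [^] (p ^ k)) ` W. \<exists>y \<in> (\<lambda>w. w [^] (p ^ k)) ` W. x = y [^] p"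
    using divisible_power_image ..
  have A: "\<exists>d \<in> W. w [^] (p ^ k) = d [^] (p ^ (k + j))" if w: "w \<in> W" for w and j :: nat
  proof (induction j)
    case 0 then show ?case using w by auto
  next
    case (Suc j)
    then obtain d where d: "d \<in> W" "w [^] (p ^ k) = d [^] (p ^ (k + j))" by auto
    then obtain y where y: "y \<in> W" "d [^] (p ^ k) = (y [^] (p ^ k)) [^] p" using k by auto
    have c: "d \<in> carrier G" "y \<in> carrier G" using d y subgroup.mem_carrier [OF W] by auto
    have "w [^] (p ^ k) = (d [^] (p ^ k)) [^] (p ^ j)" using d c by (simp add: nat_pow_pow power_add)
    also have "\<dots> = y [^] (p ^ (k + Suc j))"
      using y c by (simp add: nat_pow_pow power_add mult_ac)
    finally show ?case using y by blast
  qed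
  have "\<exists>e \<in> torsion W (p ^ k). \<exists>d \<in> W. w = e \<otimes> d [^] (p ^ j)" if w: "w \<in> W" for w and j :: nat
  proof -
    obtain d where d: "d \<in> W" "w [^] (p ^ k) = d [^] (p ^ (k + j))" using A w by blast
    have c: "d \<in> carrier G" "w \<in> carrier G" using d w subgroup.mem_carrier [OF W] by auto
    define e where "e = w \<otimes> inv (d [^] (p ^ j))"
    have "e [^] (p ^ k) = \<one>"
      using commuting_pow_diff [OF W comm w subgroup_nat_pow [OF W d(1)]] d c
      by (simp add: e_def nat_pow_pow power_add mult.commute)
    moreover have "e \<in> W" using w d W by (simp add: e_def subgroup_mult_inv subgroup_nat_pow)
    moreover have "w = e \<otimes> d [^] (p ^ j)" using c by (simp add: e_def m_assoc)
    ultimately show ?thesis using d by (auto simp: torsion_def)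
  qed
  then show ?thesis using A by (intro exI [of _ k] conjI ballI allI)
qed

text \<open>Modulo \<open>p ^ e\<close>-th powers every element agrees with one of the finite group
  \<open>torsion W (p ^ k)\<close>, where \<open>k\<close> does not depend on
  \<open>e\<close>.\<close>

lemma finitely_covered_power_image:
  "finitely_covered W ((\<lambda>w. w [^] (p ^ e)) ` W)"
proof -
  from torsion_times_divisible
  obtain k where k: "\<forall>w\<in>W. \<forall>j::nat. \<exists>e \<in> torsion W (p ^ k). \<exists>d \<in> W. w = e \<otimes> d [^] (p ^ j)"
    "\<forall>w\<in>W. \<forall>j::nat. \<exists>d \<in> W. w [^] (p ^ k) = d [^] (p ^ (k + j))"
    by (elim exE conjE)
  have "\<exists>f\<in>torsion W (p ^ k). w \<otimes> inv f \<in> (\<lambda>w. w [^] (p ^ e)) ` W" if w: "w \<in> W" for w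
  proof -
    obtain f d where fd: "f \<in> torsion W (p ^ k)" "d \<in> W" "w = f \<otimes> d [^] (p ^ e)" using k(1) w by blast
    have c: "f \<in> W" "f \<in> carrier G" "d \<in> carrier G" "d [^] (p ^ e) \<in> W"
      using fd subgroup.mem_carrier [OF W] subgroup_nat_pow [OF W] by (auto simp: torsion_def)
    have "f \<otimes> d [^] (p ^ e) = d [^] (p ^ e) \<otimes> f" using comm c unfolding commuting_def by blast
    then have "w \<otimes> inv f = d [^] (p ^ e)" using fd c by (simp add: m_assoc)
    then show ?thesis using fd by auto
  qed
  moreover have "torsion W (p ^ k) \<subseteq> carrier G" using subgroup.subset [OF W] by (auto simp: torsion_def)
  ultimately show ?thesis unfolding finitely_covered_def using finite_torsion_prime_power
    by (intro exI [of _ "torsion W (p ^ k)"]) auto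
qed

text \<open>If \<open>\<psi>\<close> has order \<open>p\<close> and fixes the elements of order dividing \<open>p\<^sup>m\<close>, \<open>m \<ge> 2\<close>, write
  \<open>x = y\<^sup>p\<close> and \<open>\<psi> y = y u\<close>; then \<open>u\<close> is fixed, so \<open>y = \<psi>\<^sup>p y = y u\<^sup>p\<close> and \<open>\<psi> x = x u\<^sup>p = x\<close>.\<close>

lemma endomorphism_trivial_step:
  assumes hom: "\<And>x y. x \<in> W \<Longrightarrow> y \<in> W \<Longrightarrow> \<psi> (x \<otimes> y) = \<psi> x \<otimes> \<psi> y"
    and cl: "\<And>x. x \<in> W \<Longrightarrow> \<psi> x \<in> W"
    and per: "\<And>x. x \<in> W \<Longrightarrow> (\<psi> ^^ p) x = x"
    and fixed: "\<And>x. x \<in> torsion W (p ^ m) \<Longrightarrow> \<psi> x = x"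
    and dv: "\<And>x. x \<in> D \<Longrightarrow> \<exists>y \<in> D. x = y [^] p" and DW: "D \<subseteq> W" and Dp: "\<And>x. x \<in> D \<Longrightarrow> x [^] p \<in> D"
    and m: "m \<ge> 2" and x: "x \<in> D"
  shows "\<psi> x = x"
proof -
  note WG = subgroup.mem_carrier [OF W]
  have one: "\<psi> \<one> = \<one>"
    using fixed subgroup.one_closed [OF W] by (simp add: torsion_def)
  have pw: "\<psi> (x [^] n) = \<psi> x [^] n" if "x \<in> W" for x and n :: nat
    by (induction n) (use that hom one subgroup_nat_pow [OF W] in auto)
  have "\<psi> x = x" if "x \<in> D" "x [^] (p ^ (m + n)) = \<one>" for n x
    using that
  proof (induction n arbitrary: x)
    case 0 then show ?case using fixed DW by (auto simp: torsion_def)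
  next
    case (Suc n)
    obtain y where y: "y \<in> D" "x = y [^] p" using dv Suc by blast
    have c: "x \<in> W" "y \<in> W" "x \<in> carrier G" "y \<in> carrier G" "\<psi> y \<in> W" "\<psi> x \<in> W" "\<psi> y \<in> carrier G" "\<psi> x \<in> carrier G"
      using y Suc DW cl WG by auto
    define u where "u = \<psi> y \<otimes> inv y"
    have u: "u \<in> W" "u \<in> carrier G" using c W WG by (auto simp: u_def subgroup_mult_inv)
    have up: "u [^] p = \<psi> x \<otimes> inv x"
      using commuting_pow_diff [OF W comm c(5,2)] pw [OF c(2), of p] y by (simp add: u_def)
    have xp: "x [^] p \<in> D" "(x [^] p) [^] (p ^ (m + n)) = \<one>"
      using Dp Suc.prems c by (auto simp: nat_pow_pow)
    \<comment> \<open>The induction hypothesis applies to \<open>x [^] p\<close> and shows that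
      \<open>\<psi>\<close> fixes it. Hence \<open>u\<close> is killed by \<open>p ^ 2\<close>, and
      \<open>m \<ge> 2\<close> places \<open>u\<close> among the elements fixed by
      assumption.\<close>
    have "(u [^] p) [^] p = \<psi> (x [^] p) \<otimes> inv (x [^] p)"
      using up commuting_pow_diff [OF W comm c(6,1)] pw [OF c(1)] by simp
    also have "\<dots> = \<one>" using Suc.IH [OF xp] c by simp
    finally have "u [^] (p ^ 2) = \<one>" using u by (simp add: nat_pow_pow power2_eq_square)
    moreover obtain j where "m = 2 + j" using m le_Suc_ex by blast
    ultimately have "u [^] (p ^ m) = \<one>"
      using u nat_pow_pow [of u "p\<^sup>2" "p ^ j"] by (simp add: power_add power2_eq_square mult.assoc)
    then have fu: "\<psi> u = u" using fixed u by (simp add: torsion_def)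
    have yu: "\<psi> y = u \<otimes> y" using c by (simp add: u_def m_assoc)
    have "(\<psi> ^^ i) y = u [^] i \<otimes> y" for i
    proof (induction i)
      case (Suc i)
      have "(\<psi> ^^ Suc i) y = \<psi> (u [^] i) \<otimes> \<psi> y" using Suc hom u c subgroup_nat_pow [OF W] by simp
      also have "\<dots> = u [^] i \<otimes> u \<otimes> y" using fu pw [OF u(1)] yu u c by (simp add: m_assoc)
      finally show ?case by simp
    qed (use c in simp)
    then have "y = u [^] p \<otimes> y" using per [OF c(2)] by simp
    then have "u [^] p = \<one>" using u c r_cancel_one' [of y "u [^] p"] by simp
    then show ?case using mult_inv_eqD [of "\<psi> x" x \<one>] up c by simp
  qed
  moreover obtain n where "x [^] (p ^ n) = \<one>" using x DW pW by (auto simp: p_elements_def)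
  moreover from this have "x [^] (p ^ (m + n)) = \<one>" using x DW WG
    by (simp add: power_add mult.commute [of "p ^ m"] nat_pow_pow [symmetric] subsetD)
  ultimately show ?thesis using x by blast
qed

text \<open>One finite subgroup detects triviality of all endomorphisms of \<open>p\<close>-power
  order. They fix the bounded factor of \<open>W\<close> by assumption and the divisible factor by
  the preceding argument, after a reduction from order \<open>p ^ k\<close> to order
  \<open>p\<close>.\<close>

lemma endomorphism_trivial:
  "\<exists>m. \<forall>\<phi> k. (\<forall>x\<in>W. \<forall>y\<in>W. \<phi> (x \<otimes> y) = \<phi> x \<otimes> \<phi> y) \<longrightarrow> (\<forall>x\<in>W. \<phi> x \<in> W) \<longrightarrow>
     (\<forall>x\<in>W. (\<phi> ^^ (p ^ k)) x = x) \<longrightarrow> (\<forall>x\<in>torsion W (p ^ m). \<phi> x = x) \<longrightarrow> (\<forall>x\<in>W. \<phi> x = x)"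
proof -
  note WG = subgroup.mem_carrier [OF W]
  from torsion_times_divisible
  obtain k where k: "\<forall>w\<in>W. \<forall>j::nat. \<exists>e \<in> torsion W (p ^ k). \<exists>d \<in> W. w = e \<otimes> d [^] (p ^ j)"
    "\<forall>w\<in>W. \<forall>j::nat. \<exists>d \<in> W. w [^] (p ^ k) = d [^] (p ^ (k + j))"
    by (elim exE conjE)
  define D where "D = (\<lambda>w. w [^] (p ^ k)) ` W"
  have dv: "\<exists>y \<in> D. x = y [^] p" if x: "x \<in> D" for x
  proof -
    obtain w where w: "w \<in> W" "x = w [^] (p ^ k)" using x by (auto simp: D_def)
    then obtain d where "d \<in> W" "x = d [^] (p ^ (k + 1))" using k(2) by blast
    then show ?thesis using WG by (intro bexI [of _ "d [^] (p ^ k)"]) (auto simp: D_def nat_pow_pow mult.commute)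
  qed
  have DW: "D \<subseteq> W" using subgroup_nat_pow [OF W] by (auto simp: D_def)
  have Dp: "x [^] p \<in> D" if x: "x \<in> D" for x
  proof -
    obtain w where w: "w \<in> W" "x = w [^] (p ^ k)" using x by (auto simp: D_def)
    then have "x [^] p = (w [^] p) [^] (p ^ k)" using WG by (simp add: nat_pow_pow mult.commute)
    then show ?thesis using w subgroup_nat_pow [OF W] by (auto simp: D_def)
  qed
  \<comment> \<open>The summand \<open>k\<close> makes \<open>torsion W (p ^ m)\<close> contain the
    bounded factor of \<open>W\<close>; the summand 2 is what the step for endomorphisms of order
    \<open>p\<close> requires.\<close>
  define m where "m = k + 2"
  have step: "\<psi> x = x" if st: "\<And>x y. x \<in> W \<Longrightarrow> y \<in> W \<Longrightarrow> \<psi> (x \<otimes> y) = \<psi> x \<otimes> \<psi> y" "\<And>x. x \<in> W \<Longrightarrow> \<psi> x \<in> W"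
     "\<And>x. x \<in> W \<Longrightarrow> (\<psi> ^^ p) x = x" "\<And>x. x \<in> torsion W (p ^ m) \<Longrightarrow> \<psi> x = x" "x \<in> W" for \<psi> x
  proof -
    obtain e d where ed: "e \<in> torsion W (p ^ k)" "d \<in> W" "x = e \<otimes> d [^] (p ^ k)"
      using k(1) st(5) by blast
    have eW: "e \<in> W" using ed by (simp add: torsion_def)
    have "torsion W (p ^ k) \<subseteq> torsion W (p ^ m)" using WG
      by (auto simp: torsion_def m_def intro!: pow_one_dvd [of _ "p ^ k"])
    then have "\<psi> e = e" using ed st(4) by blast
    moreover have "\<psi> (d [^] (p ^ k)) = d [^] (p ^ k)"
      using endomorphism_trivial_step [of \<psi> m D, OF st(1-4) dv DW Dp] ed(2) by (simp add: m_def D_def)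
    ultimately show ?thesis using st(1) [OF eW subgroup_nat_pow [OF W ed(2)]] ed(3) by simp
  qed
  have "\<phi> x = x" if "\<And>x y. x \<in> W \<Longrightarrow> y \<in> W \<Longrightarrow> \<phi> (x \<otimes> y) = \<phi> x \<otimes> \<phi> y" "\<And>x. x \<in> W \<Longrightarrow> \<phi> x \<in> W"
     "\<And>x. x \<in> W \<Longrightarrow> (\<phi> ^^ (p ^ j)) x = x" "\<And>x. x \<in> torsion W (p ^ m) \<Longrightarrow> \<phi> x = x" "x \<in> W" for \<phi> j x
    using that
  proof (induction j arbitrary: \<phi> x)
    case 0 then show ?case by simp
  next
    case (Suc j)
    \<comment> \<open>The \<open>p\<close>-th iterate of this power of \<open>\<phi>\<close> is the
      identity, so it is itself the identity by \<open>step\<close>. Then \<open>\<phi>\<close>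
      satisfies the induction hypothesis for \<open>j\<close>.\<close>
    let ?\<psi> = "\<phi> ^^ (p ^ j)"
    have cl: "(\<phi> ^^ i) x \<in> W" if "x \<in> W" for i x
      by (induction i) (use Suc.prems(2) that in auto)
    have hm: "(\<phi> ^^ i) (x \<otimes> y) = (\<phi> ^^ i) x \<otimes> (\<phi> ^^ i) y" if "x \<in> W" "y \<in> W" for i x y
      by (induction i) (use Suc.prems(1) cl that in auto)
    have fx: "(\<phi> ^^ i) x = x" if "x \<in> torsion W (p ^ m)" for i x
      by (induction i) (use Suc.prems(4) that in auto)
    have "?\<psi> ^^ p = \<phi> ^^ (p ^ Suc j)" by (simp add: funpow_mult mult.commute)
    then have "?\<psi> x = x" if "x \<in> W" for x
      using step [of ?\<psi> x] hm cl fx that Suc.prems(3) by simp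
    then show ?case using Suc.IH [of \<phi> x] Suc.prems by blast
  qed
  then show ?thesis by (intro exI [of _ m] allI impI ballI) blast
qed

text \<open>Conjugation by a \<open>p\<close>-element is an endomorphism of \<open>p\<close>-power order.\<close>

lemma finitely_covered_centralizer_abelian:
  assumes "subgroup H G" "p_elements p H" "normalizes H W"
  shows "finitely_covered H (centralizer_in H W)"
proof -
  note WG = subgroup.mem_carrier [OF W] note HG = subgroup.mem_carrier [OF assms(1)]
  obtain m where m: "\<forall>\<phi> k. (\<forall>x\<in>W. \<forall>y\<in>W. \<phi> (x \<otimes> y) = \<phi> x \<otimes> \<phi> y) \<longrightarrow> (\<forall>x\<in>W. \<phi> x \<in> W) \<longrightarrow>
     (\<forall>x\<in>W. (\<phi> ^^ (p ^ k)) x = x) \<longrightarrow> (\<forall>x\<in>torsion W (p ^ m). \<phi> x = x) \<longrightarrow> (\<forall>x\<in>W. \<phi> x = x)"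
    using endomorphism_trivial ..
  let ?E = "torsion W (p ^ m)"
  have EG: "?E \<subseteq> carrier G" using WG by (auto simp: torsion_def)
  \<comment> \<open>By the choice of \<open>m\<close>, acting trivially on the finite group
    \<open>?E\<close> forces acting trivially on \<open>W\<close>; the centralizer of a finite
    normalized set has finite index.\<close>
  have "centralizer_in H ?E \<subseteq> centralizer_in H W"
  proof
    fix h assume "h \<in> centralizer_in H ?E"
    then have h: "h \<in> H" "\<And>a. a \<in> ?E \<Longrightarrow> h \<otimes> a = a \<otimes> h" by (auto simp: centralizer_in_def)
    have hc: "h \<in> carrier G" using h HG by auto
    obtain k where k: "h [^] (p ^ k) = \<one>" using assms(2) h by (auto simp: p_elements_def)
    let ?\<phi> = "\<lambda>x. h \<otimes> x \<otimes> inv h"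
    have it: "(?\<phi> ^^ i) x = h [^] i \<otimes> x \<otimes> inv (h [^] i)" if "x \<in> carrier G" for i x
    proof (induction i)
      case (Suc i)
      have "(?\<phi> ^^ Suc i) x = h \<otimes> (h [^] i \<otimes> x \<otimes> inv (h [^] i)) \<otimes> inv h" using Suc by simp
      also have "\<dots> = (h \<otimes> h [^] i) \<otimes> x \<otimes> inv (h \<otimes> h [^] i)"
        using hc that by (simp add: m_assoc inv_mult_group)
      also have "h \<otimes> h [^] i = h [^] Suc i" using hc nat_pow_Suc2 by simp
      finally show ?case .
    qed (use that in simp)
    have "?\<phi> x = x" if x: "x \<in> W" for x
    proof (rule m [rule_format, of ?\<phi> k])
      show "h \<otimes> (a \<otimes> b) \<otimes> inv h = h \<otimes> a \<otimes> inv h \<otimes> (h \<otimes> b \<otimes> inv h)" if "a \<in> W" "b \<in> W" for a b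
        using that WG hc by (simp add: m_assoc)
      show "h \<otimes> a \<otimes> inv h \<in> W" if "a \<in> W" for a using that assms(3) h by (simp add: normalizes_def)
      show "(?\<phi> ^^ (p ^ k)) a = a" if "a \<in> W" for a using it [of a] k WG that by simp
      show "h \<otimes> a \<otimes> inv h = a" if "a \<in> ?E" for a
        using that h(2) [OF that] hc EG by (auto simp: m_assoc subset_iff)
    qed (use x in auto)
    then have "h \<otimes> x = x \<otimes> h" if "x \<in> W" for x
      using mult_inv_eqD [of "h \<otimes> x" h x] that WG hc by simp
    then show "h \<in> centralizer_in H W" using h by (auto simp: centralizer_in_def)
  qed
  moreover have "finitely_covered H (centralizer_in H ?E)"
  proof (rule finitely_covered_centralizer)
    show "finite ?E" by (rule finite_torsion_prime_power)
    fix a assume "a \<in> ?E"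
    then have "(\<lambda>h. h \<otimes> a \<otimes> inv h) ` H \<subseteq> ?E"
      using normalizes_torsion [OF assms(3), of "p ^ m"] HG WG by (auto simp: normalizes_def)
    then show "finite ((\<lambda>h. h \<otimes> a \<otimes> inv h) ` H)" using \<open>finite ?E\<close> finite_subset by blast
  qed (use assms EG in auto)
  ultimately show ?thesis using finitely_covered_mono by blast
qed

end

section \<open>Soluble p-groups whose abelian subnormal subgroups have finite socle\<close>

lemma p_elements_mono: "p_elements p W \<Longrightarrow> U \<subseteq> W \<Longrightarrow> p_elements p U"
  by (auto simp: p_elements_def)

lemma finite_index_power:
  assumes "Factorial_Ring.prime (p::nat)" "subgroup H G" "subgroup Y G" "p_elements p H" "finitely_covered H Y"
  obtains e where "\<forall>x\<in>H. x [^] (p ^ e) \<in> Y"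
proof -
  obtain F where F: "finite F" "F \<subseteq> carrier G" "\<forall>h\<in>H. \<exists>f\<in>F. h \<otimes> inv f \<in> Y"
    using assms(5) finitely_covered_def by auto
  have "x [^] (p ^ card F) \<in> Y" if x: "x \<in> H" for x
  proof -
    have xc: "x \<in> carrier G" using subgroup.mem_carrier [OF assms(2) x] .
    have "\<exists>f\<in>F. x [^] i \<otimes> inv f \<in> Y" for i :: nat
      using F(3) subgroup_nat_pow [OF assms(2) x, of i] by blast
    then obtain c where c: "\<And>i::nat. c i \<in> F" "\<And>i. x [^] i \<otimes> inv (c i) \<in> Y" by metis
    have "\<not> inj_on c {0..card F}"
    proof
      assume "inj_on c {0..card F}"
      then have "card (c ` {0..card F}) = Suc (card F)" by (simp add: card_image)
      moreover have "card (c ` {0..card F}) \<le> card F" using c(1) F(1) by (intro card_mono) auto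
      ultimately show False by simp
    qed
    then obtain i j where ij: "i < j" "j \<le> card F" "c i = c j"
      by (auto simp: inj_on_def) (metis linorder_neqE_nat)
    have cc: "c j \<in> carrier G" using c(1) F(2) by blast
    have "(x [^] j \<otimes> inv (c j)) \<otimes> inv (x [^] i \<otimes> inv (c i)) \<in> Y"
      using subgroup_mult_inv [OF assms(3) c(2) c(2)] .
    then have "x [^] j \<otimes> inv (x [^] i) \<in> Y"
      using ij(3) cc xc by (simp add: inv_mult_group m_assoc)
    moreover have "x [^] j = x [^] (j - i) \<otimes> x [^] i" using ij xc by (simp add: nat_pow_mult)
    ultimately have d: "x [^] (j - i) \<in> Y" using xc by (simp add: m_assoc)
    obtain m where m: "x [^] (p ^ m) = \<one>" using assms(4) x by (auto simp: p_elements_def)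
    obtain u v where uv: "(j - i) * u = p ^ m * v + gcd (j - i) (p ^ m)"
      using bezout_nat [of "j - i" "p ^ m"] ij by auto
    \<comment> \<open>Since \<open>x\<close> has \<open>p\<close>-power order, Bezout replaces the
      exponent \<open>j - i\<close> by its gcd with \<open>p ^ m\<close>, which is a power
      \<open>p ^ l\<close> of \<open>p\<close>.\<close>
    have "x [^] ((j - i) * u) = x [^] (p ^ m * v) \<otimes> x [^] gcd (j - i) (p ^ m)"
      unfolding uv using xc by (simp add: nat_pow_mult)
    moreover have "x [^] (p ^ m * v) = \<one>" using pow_one_dvd [OF m _ xc] by simp
    moreover have "x [^] ((j - i) * u) \<in> Y"
      using subgroup_nat_pow [OF assms(3) d, of u] xc by (simp add: nat_pow_pow)
    ultimately have g: "x [^] gcd (j - i) (p ^ m) \<in> Y" using xc by simp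
    obtain l where l: "gcd (j - i) (p ^ m) = p ^ l"
      using divides_primepow_nat [OF assms(1)] gcd_dvd2 [of "j - i" "p ^ m"] by blast
    \<comment> \<open>From \<open>l < 2 ^ l \<le> p ^ l \<le> card F\<close> it follows that
      \<open>card F\<close> is a uniform choice of the exponent \<open>e\<close>.\<close>
    have "p ^ l \<le> j - i" using gcd_le1_nat [of "j - i" "p ^ m"] ij l by simp
    moreover have "l < 2 ^ l" by simp
    moreover have "(2::nat) ^ l \<le> p ^ l" using prime_ge_2_nat [OF assms(1)] power_mono by blast
    ultimately have "l \<le> card F" using ij by linarith
    then have "p ^ card F = p ^ l * p ^ (card F - l)" by (simp add: power_add [symmetric])
    then have "x [^] (p ^ card F) = (x [^] (p ^ l)) [^] (p ^ (card F - l))"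
      using xc by (simp add: nat_pow_pow)
    then show ?thesis using subgroup_nat_pow [OF assms(3) g] l by simp
  qed
  then show thesis using that by blast
qed

text \<open>A maximal commuting subset is its own centralizer, hence a subgroup.\<close>

lemma maximal_abelian_class_two:
  assumes Q: "subgroup Q G"
    and cen: "\<And>a b c. a \<in> Q \<Longrightarrow> b \<in> Q \<Longrightarrow> c \<in> Q \<Longrightarrow>
      (a \<otimes> b \<otimes> inv a \<otimes> inv b) \<otimes> c = c \<otimes> (a \<otimes> b \<otimes> inv a \<otimes> inv b)"
  obtains Y where "Y \<subseteq> Q" "subgroup Y G" "commuting Y Y" "normalizes Q Y" "centralizer_in Q Y = Y"
proof -
  note QG = subgroup.mem_carrier [OF Q]
  define \<A> where "\<A> = {Y. Y \<subseteq> Q \<and> commuting Y Y}"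
  have "\<exists>M\<in>\<A>. \<forall>U\<in>\<A>. M \<subseteq> U \<longrightarrow> U = M"
  proof (rule subset_Zorn_nonempty)
    show "\<A> \<noteq> {}" by (auto simp: \<A>_def commuting_def)
    fix C assume C: "C \<noteq> {}" "subset.chain \<A> C"
    have "x \<otimes> y = y \<otimes> x" if xy: "x \<in> \<Union>C" "y \<in> \<Union>C" for x y
    proof -
      obtain U Y where UV: "U \<in> C" "Y \<in> C" "x \<in> U" "y \<in> Y" using xy by auto
      have "U \<subseteq> Y \<or> Y \<subseteq> U" using C UV by (auto simp: subset_chain_def)
      then obtain Z where Z: "Z \<in> C" "x \<in> Z" "y \<in> Z" using UV by auto
      then have "commuting Z Z" using C by (auto simp: \<A>_def subset_chain_def)
      then show ?thesis using Z by (simp add: commuting_def)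
    qed
    moreover have "\<Union>C \<subseteq> Q" using C by (auto simp: \<A>_def subset_chain_def)
    ultimately show "\<Union>C \<in> \<A>" by (simp add: \<A>_def commuting_def)
  qed
  then obtain Y where Y: "Y \<subseteq> Q" "commuting Y Y" and mx: "\<And>U. U \<subseteq> Q \<Longrightarrow> commuting U U \<Longrightarrow> Y \<subseteq> U \<Longrightarrow> U = Y"
    by (auto simp: \<A>_def)
  have cY: "centralizer_in Q Y = Y"
  proof
    show "Y \<subseteq> centralizer_in Q Y" using Y by (auto simp: centralizer_in_def commuting_def)
    show "centralizer_in Q Y \<subseteq> Y"
    proof
      fix c assume c: "c \<in> centralizer_in Q Y"
      then have "commuting (insert c Y) (insert c Y)"
        using Y by (simp add: centralizer_in_def commuting_def)
      moreover have "insert c Y \<subseteq> Q" using c Y by (auto simp: centralizer_in_def)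
      ultimately show "c \<in> Y" using mx [of "insert c Y"] by auto
    qed
  qed
  have sY: "subgroup Y G"
    using centralizer_subgroup [OF Q, of Y] cY Y QG by auto
  have "g \<otimes> y \<otimes> inv g \<in> Y" if g: "g \<in> Q" and y: "y \<in> Y" for g y
  proof -
    have yQ: "y \<in> Q" using y Y by auto
    let ?k = "g \<otimes> y \<otimes> inv g \<otimes> inv y"
    have "?k \<in> Q" using g yQ Q by (simp add: subgroup.m_closed subgroup.m_inv_closed)
    then have "?k \<in> centralizer_in Q Y" using cen [OF g yQ] Y(1) by (auto simp: centralizer_in_def)
    then have "?k \<otimes> y \<in> Y" using cY y sY by (simp add: subgroup.m_closed)
    then show ?thesis using g yQ QG by (simp add: m_assoc)
  qed
  then show thesis using that Y cY sY by (simp add: normalizes_def)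
qed

text \<open>All conjugates of \<open>f\<close> under \<open>Q\<close> have the same
  \<open>q\<close>-th power, because \<open>f [^] q\<close> lies in \<open>D\<close> and
  \<open>D\<close> is centralized by \<open>Q\<close>. Two conjugates in one coset of
  \<open>D\<close> therefore differ by an element of the finite group \<open>torsion D q\<close>,
  and there are only finitely many cosets.\<close>

lemma finite_conjugates:
  assumes "subgroup D G" "subgroup Q G" "subgroup M G" "D \<subseteq> M" "M \<subseteq> Q" "commuting D Q"
    and "normalizes Q M" "finitely_covered M D" "finite (torsion D q)"
    and fD: "f [^] q \<in> D" and f: "f \<in> M"
  shows "finite ((\<lambda>h. h \<otimes> f \<otimes> inv h) ` Q)"
proof -
  note MG = subgroup.mem_carrier [OF assms(3)] note QG = subgroup.mem_carrier [OF assms(2)]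
  let ?O = "(\<lambda>h. h \<otimes> f \<otimes> inv h) ` Q"
  have OM: "?O \<subseteq> M" using assms(7) f by (auto simp: normalizes_def)
  then have OG: "?O \<subseteq> carrier G" using MG by blast
  have Oq: "y [^] q = f [^] q" if y: "y \<in> ?O" for y
  proof -
    obtain h where h: "h \<in> Q" "y = h \<otimes> f \<otimes> inv h" using y by auto
    have "f [^] q \<otimes> h = h \<otimes> f [^] q" using assms(6) fD h unfolding commuting_def by blast
    then have "h \<otimes> f [^] q \<otimes> inv h = f [^] q"
      using h QG f MG by (metis inv_closed m_assoc nat_pow_closed r_inv r_one)
    then show ?thesis using h conj_pow [of f h q] f MG QG by simp
  qed
  have "finitely_covered ?O D" using assms(8) OM by (rule finitely_covered_mono) auto
  then obtain F where F: "finite F" "F \<subseteq> ?O" "\<forall>y\<in>?O. \<exists>z\<in>F. y \<otimes> inv z \<in> D"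
    using finitely_coveredE [OF _ assms(1) OG] by metis
  have "\<exists>z\<in>F. y \<otimes> inv z \<in> torsion D q" if y: "y \<in> ?O" for y
  proof -
    obtain z where z: "z \<in> F" "y \<otimes> inv z \<in> D" using F(3) y by blast
    have yz: "y \<in> M" "z \<in> M" "z \<in> ?O" using y z F OM by auto
    then have c: "y \<in> carrier G" "z \<in> carrier G" using MG by auto
    let ?t = "y \<otimes> inv z"
    have "?t \<otimes> z = z \<otimes> ?t" using assms(5,6) z yz unfolding commuting_def by blast
    then have "(?t \<otimes> z) [^] q = ?t [^] q \<otimes> z [^] q" using c by (intro pow_mult_distrib) auto
    moreover have "?t \<otimes> z = y" using c by (simp add: m_assoc)
    ultimately have "y [^] q = ?t [^] q \<otimes> z [^] q" by simp
    then have "z [^] q = ?t [^] q \<otimes> z [^] q" using Oq y yz by simp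
    then have "?t [^] q = \<one>" using c r_cancel_one' [of "z [^] q" "?t [^] q"] by simp
    then show ?thesis using z by (auto simp: torsion_def)
  qed
  then have "finitely_covered ?O (torsion D q)"
    unfolding finitely_covered_def using F(1,2) OG by (intro exI [of _ F]) auto
  then show ?thesis using finitely_covered_finite assms(9) OG by blast
qed

text \<open>Conjugation permutes \<open>n\<close>-th powers, so the subgroup they generate is
  normalized by whatever normalizes \<open>H\<close>.\<close>

lemma power_subgroup_facts:
  fixes n :: nat
  assumes "subgroup H G" "normalizes K H" "K \<subseteq> carrier G"
  defines "D \<equiv> generate G ((\<lambda>x. x [^] n) ` H)"
  shows "subgroup D G" "D \<subseteq> H" "normalizes K D"
proof -
  note HG = subgroup.mem_carrier [OF assms(1)]
  have c: "(\<lambda>x. x [^] n) ` H \<subseteq> carrier G" using HG by auto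
  show "subgroup D G" unfolding D_def using c by (rule generate_is_subgroup)
  show "D \<subseteq> H" unfolding D_def using assms(1) subgroup_nat_pow by (intro generate_subset_subgroup) auto
  have "normalizes K ((\<lambda>x. x [^] n) ` H)"
    unfolding normalizes_def
  proof (intro ballI)
    fix k y assume k: "k \<in> K" and "y \<in> (\<lambda>x. x [^] n) ` H"
    then obtain x where x: "x \<in> H" "y = x [^] n" by auto
    have "k \<otimes> y \<otimes> inv k = (k \<otimes> x \<otimes> inv k) [^] n" using conj_pow [of x k n] x k HG assms(3) by auto
    moreover have "k \<otimes> x \<otimes> inv k \<in> H" using assms(2) k x by (simp add: normalizes_def)
    ultimately show "k \<otimes> y \<otimes> inv k \<in> (\<lambda>x. x [^] n) ` H" by blast
  qed
  then show "normalizes K D" unfolding D_def using normalizes_generate assms(3) c by blast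
qed

lemma normalizes_self: "subgroup H G \<Longrightarrow> normalizes H H"
  by (simp add: normalizes_def subgroup.m_closed subgroup.m_inv_closed)

lemma normalizes_mono: "normalizes H K \<Longrightarrow> H' \<subseteq> H \<Longrightarrow> normalizes H' K"
  by (auto simp: normalizes_def)

lemma normalizes_Int: "normalizes H K \<Longrightarrow> normalizes H L \<Longrightarrow> normalizes H (K \<inter> L)"
  by (auto simp: normalizes_def)

text \<open>A conjugate of \<open>x\<close> by \<open>k\<close> is the commutator of
  \<open>k\<close> and \<open>x\<close> times \<open>x\<close>.\<close>

lemma normalizes_derived:
  assumes "subgroup K G" shows "normalizes K (derived G K)"
proof -
  note KG = subgroup.mem_carrier [OF assms]
  have "derived_set G K \<subseteq> K" using assms by (auto intro!: subgroup.m_closed subgroup.m_inv_closed)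
  then show ?thesis unfolding derived_def normalizes_def
  proof (intro ballI)
    fix k x assume sub: "derived_set G K \<subseteq> K" and k: "k \<in> K" and x: "x \<in> generate G (derived_set G K)"
    have xK: "x \<in> K" using x sub generate_subset_subgroup [OF assms] by blast
    have "k \<otimes> x \<otimes> inv k \<otimes> inv x \<in> generate G (derived_set G K)"
      using k xK by (intro generate.incl) blast
    then have "(k \<otimes> x \<otimes> inv k \<otimes> inv x) \<otimes> x \<in> generate G (derived_set G K)" using x by (rule generate.eng)
    then show "k \<otimes> x \<otimes> inv k \<in> generate G (derived_set G K)" using k xK KG by (simp add: m_assoc)
  qed
qed

text \<open>The abelian subgroup of finite index is required to be generated by powers because such
  a subgroup is invariant: in the induction step the one found in the derived subgroup is normal in
  \<open>K\<close>, hence subnormal in \<open>G\<close>, and the hypothesis on socles applies to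
  it.\<close>

theorem virtually_abelian_of_finite_socles:
  assumes p: "Factorial_Ring.prime (p::nat)"
  shows "\<lbrakk>subnormal G K; p_elements p K; (derived G ^^ n) K = {\<one>};
     \<And>U. subnormal G U \<Longrightarrow> U \<subseteq> K \<Longrightarrow> commuting U U \<Longrightarrow> finite (torsion U p)\<rbrakk>
    \<Longrightarrow> \<exists>e. commuting (generate G ((\<lambda>x. x [^] (p ^ e)) ` K)) (generate G ((\<lambda>x. x [^] (p ^ e)) ` K)) \<and>
          finitely_covered K (generate G ((\<lambda>x. x [^] (p ^ e)) ` K))"
proof (induction n arbitrary: K)
  case 0
  then have K: "K = {\<one>}" by simp
  have "commuting (generate G ((\<lambda>x. x [^] (p ^ 0)) ` K)) (generate G ((\<lambda>x. x [^] (p ^ 0)) ` K))"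
    using K generate_one by (auto simp: commuting_def)
  moreover have "finitely_covered K (generate G ((\<lambda>x. x [^] (p ^ 0)) ` K))"
    using K by (intro finitely_covered_of_finite generate.one) auto
  ultimately show ?case by blast
next
  case (Suc n K)
  have K: "subgroup K G" using Suc.prems(1) by (rule subnormal_subgroup)
  note KG = subgroup.mem_carrier [OF K]
  have KsG: "K \<subseteq> carrier G" using KG by auto
  define K' where "K' = derived G K"
  have K': "subgroup K' G" "K' \<subseteq> K" "normalizes K K'"
    using K KsG derived_is_subgroup derived_incl [OF subset_refl K] normalizes_derived by (auto simp: K'_def)
  have snK': "subnormal G K'" using subnormal_stepI Suc.prems(1) K' by blast
  have "(derived G ^^ n) K' = {\<one>}" using Suc.prems(3) by (simp add: K'_def funpow_swap1)
  then obtain e where e: "commuting (generate G ((\<lambda>x. x [^] (p ^ e)) ` K')) (generate G ((\<lambda>x. x [^] (p ^ e)) ` K'))"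
    "finitely_covered K' (generate G ((\<lambda>x. x [^] (p ^ e)) ` K'))"
    using Suc.IH [OF snK'] Suc.prems(2,4) K'(2) p_elements_mono by (meson order_trans)
  define D where "D = generate G ((\<lambda>x. x [^] (p ^ e)) ` K')"
  have D: "subgroup D G" "D \<subseteq> K'" "normalizes K D" "commuting D D" "finitely_covered K' D"
    using power_subgroup_facts [OF K'(1,3) KsG] e by (auto simp: D_def)
  have DK: "D \<subseteq> K" and DG: "D \<subseteq> carrier G" using D K' KsG by auto
  have snD: "subnormal G D" using subnormal_stepI Suc.prems(1) D(1) DK D(3) by blast
  have finD: "finite (torsion D p)" using Suc.prems(4) snD DK D(4) by blast
  have pD: "p_elements p D" using Suc.prems(2) DK p_elements_mono by blast
  \<comment> \<open>\<open>D\<close> is an abelian \<open>p\<close>-group with finite socle, so its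
    centralizer has finite index in \<open>K\<close>.\<close>
  define Q where "Q = centralizer_in K D"
  have Q: "subgroup Q G" "Q \<subseteq> K" "normalizes K Q" "finitely_covered K Q"
    using centralizer_subgroup [OF K DG] normalizes_centralizer [OF normalizes_self [OF K] D(3) K KsG DG]
      finitely_covered_centralizer_abelian [OF D(1,4) pD finD K Suc.prems(2) D(3)]
    by (auto simp: Q_def centralizer_in_def)
  have DQ: "D \<subseteq> Q" "commuting D Q" using DK D(4) by (auto simp: Q_def centralizer_in_def commuting_def)
  \<comment> \<open>\<open>M\<close> is the part of the derived subgroup inside \<open>Q\<close>; it
    is a finite extension of \<open>D\<close>, which \<open>Q\<close> centralizes.\<close>
  define M where "M = K' \<inter> Q"
  have M: "subgroup M G" "M \<subseteq> Q" "D \<subseteq> M" "normalizes K M"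
    using subgroups_Inter_pair K' Q D(2) DQ normalizes_Int by (auto simp: M_def)
  have QG: "Q \<subseteq> carrier G" and MG: "M \<subseteq> carrier G" using Q M KsG by auto
  have MD: "finitely_covered M D" using D(5) by (rule finitely_covered_mono) (auto simp: M_def)
  then obtain F where F: "finite F" "F \<subseteq> M" "\<forall>m\<in>M. \<exists>f\<in>F. m \<otimes> inv f \<in> D"
    using finitely_coveredE [OF _ D(1) MG] by metis
  have QF: "finitely_covered Q (centralizer_in Q F)"
  proof (rule finitely_covered_centralizer [OF F(1) Q(1)])
    show "F \<subseteq> carrier G" using F MG by auto
    fix f assume f: "f \<in> F"
    show "finite ((\<lambda>h. h \<otimes> f \<otimes> inv h) ` Q)"
    proof (rule finite_conjugates [OF D(1) Q(1) M(1,3,2) DQ(2) _ MD])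
      show "normalizes Q M" using M(4) Q(2) normalizes_mono by blast
      show "finite (torsion D (p ^ e))" using finite_torsion_prime_power [OF D(1,4) pD finD] .
      show "f \<in> M" using f F by auto
      then show "f [^] (p ^ e) \<in> D" unfolding D_def by (intro generate.incl) (auto simp: M_def)
    qed
  qed
  \<comment> \<open>Centralizing \<open>D\<close> and the finitely many representatives
    \<open>F\<close> is enough to centralize \<open>M\<close>, so \<open>Q2\<close> still has finite
    index. Its commutators lie in \<open>K' \<inter> Q = M\<close>, so it has class at most
    two.\<close>
  define Q2 where "Q2 = centralizer_in Q M"
  have "centralizer_in Q F \<subseteq> Q2"
  proof
    fix h assume "h \<in> centralizer_in Q F"
    then have h: "h \<in> Q" "\<And>f. f \<in> F \<Longrightarrow> h \<otimes> f = f \<otimes> h" by (auto simp: centralizer_in_def)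
    have "h \<otimes> m = m \<otimes> h" if m: "m \<in> M" for m
    proof -
      obtain f where f: "f \<in> F" "m \<otimes> inv f \<in> D" using F(3) m by blast
      have c: "h \<in> carrier G" "f \<in> carrier G" "m \<in> carrier G" using h f m F MG QG by auto
      let ?d = "m \<otimes> inv f"
      have d: "h \<otimes> ?d = ?d \<otimes> h" using DQ(2) f h unfolding commuting_def by metis
      have "h \<otimes> m = (h \<otimes> ?d) \<otimes> f" using c by (simp add: m_assoc)
      also have "\<dots> = ?d \<otimes> (h \<otimes> f)" unfolding d using c by (simp add: m_assoc)
      also have "\<dots> = m \<otimes> h" unfolding h(2) [OF f(1)] using c by (simp add: m_assoc)
      finally show ?thesis .
    qed
    then show "h \<in> Q2" using h by (auto simp: Q2_def centralizer_in_def)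
  qed
  then have QQ2: "finitely_covered Q Q2" using QF finitely_covered_mono by blast
  have Q2: "subgroup Q2 G" "Q2 \<subseteq> Q" "normalizes K Q2"
    using centralizer_subgroup [OF Q(1) MG] normalizes_centralizer [OF Q(3) M(4) K QG MG]
    by (auto simp: Q2_def centralizer_in_def)
  have Q2K: "Q2 \<subseteq> K" using Q2 Q by auto
  have snQ2: "subnormal G Q2" using subnormal_stepI Suc.prems(1) Q2(1) Q2K Q2(3) by blast
  have cen: "(a \<otimes> b \<otimes> inv a \<otimes> inv b) \<otimes> c = c \<otimes> (a \<otimes> b \<otimes> inv a \<otimes> inv b)"
    if abc: "a \<in> Q2" "b \<in> Q2" "c \<in> Q2" for a b c
  proof -
    let ?k = "a \<otimes> b \<otimes> inv a \<otimes> inv b"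
    have "?k \<in> Q2" using abc Q2(1) by (simp add: subgroup.m_closed subgroup.m_inv_closed)
    moreover have "?k \<in> K'" unfolding K'_def derived_def using abc Q2K by (intro generate.incl) blast
    ultimately have "?k \<in> M" using Q2 by (auto simp: M_def)
    then show ?thesis using abc(3) by (simp add: Q2_def centralizer_in_def)
  qed
  from maximal_abelian_class_two [OF Q2(1) cen]
  obtain Y where Y: "Y \<subseteq> Q2" "subgroup Y G" "commuting Y Y" "normalizes Q2 Y" "centralizer_in Q2 Y = Y" .
  have YK: "Y \<subseteq> K" using Y Q2K by auto
  have snY: "subnormal G Y" using subnormal_stepI snQ2 Y(1,2,4) by blast
  have finY: "finite (torsion Y p)" using Suc.prems(4) snY YK Y(3) by blast
  have pY: "p_elements p Y" "p_elements p Q2" using Suc.prems(2) YK Q2K p_elements_mono by blast+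
  have "finitely_covered Q2 Y"
    using finitely_covered_centralizer_abelian [OF Y(2,3) pY(1) finY Q2(1) pY(2) Y(4)] Y(5) by simp
  \<comment> \<open>\<open>Y\<close> comes from Zorn's lemma and need not be normal in
    \<open>K\<close>. The \<open>p ^ e'\<close>-th powers of \<open>K\<close> generate a subgroup of
    \<open>Y\<close>, hence an abelian one, and it contains the \<open>p ^ e'\<close>-th powers of
    \<open>Y\<close>, which already cover \<open>Y\<close> up to finitely many translates.\<close>
  then have KY: "finitely_covered K Y"
    using finitely_covered_trans Q(4) QQ2 KsG QG by blast
  obtain e' where e': "\<forall>x\<in>K. x [^] (p ^ e') \<in> Y"
    using finite_index_power [OF p K Y(2) Suc.prems(2) KY] .
  let ?E = "generate G ((\<lambda>x. x [^] (p ^ e')) ` K)"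
  have "?E \<subseteq> Y" using e' by (intro generate_subset_subgroup [OF Y(2)]) auto
  then have "commuting ?E ?E" using Y(3) commuting_mono by blast
  moreover have "finitely_covered Y ?E"
    using finitely_covered_power_image [OF Y(2,3) pY(1) finY, of e']
    by (rule finitely_covered_mono) (use YK in \<open>auto intro: generate.incl\<close>)
  then have "finitely_covered K ?E" using finitely_covered_trans KY KsG by blast
  ultimately show ?case by blast
qed

section \<open>Finite rank\<close>

text \<open>The bound is kept explicit so that the ranks of different primary components can be
  compared.\<close>

definition rank_at_most :: "nat \<Rightarrow> 'a set \<Rightarrow> bool" where
  "rank_at_most r H \<longleftrightarrow> (\<forall>S. finite S \<and> S \<subseteq> H \<longrightarrow>
      (\<exists>T. finite T \<and> T \<subseteq> H \<and> card T \<le> r \<and> generate G T = generate G S))"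

lemma finite_rank_iff: "finite_rank G H \<longleftrightarrow> (\<exists>r. rank_at_most r H)"
  by (simp add: finite_rank_def rank_at_most_def)

lemma rank_at_mostE:
  assumes "rank_at_most r H" "finite S" "S \<subseteq> H"
  obtains T where "finite T" "T \<subseteq> H" "card T \<le> r" "generate G T = generate G S"
  using assms unfolding rank_at_most_def by auto

lemma rank_at_most_le: "rank_at_most r H \<Longrightarrow> r \<le> s \<Longrightarrow> rank_at_most s H"
  unfolding rank_at_most_def by (meson order_trans)

text \<open>A generating set found in \<open>K\<close> automatically lies in \<open>H\<close>, since
  it generates the same subgroup as a subset of \<open>H\<close>.\<close>

lemma rank_at_most_mono:
  assumes "rank_at_most r K" "H \<subseteq> K" "subgroup H G" shows "rank_at_most r H"
  unfolding rank_at_most_def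
proof (intro allI impI)
  fix S assume S: "finite S \<and> S \<subseteq> H"
  then obtain T where T: "finite T" "card T \<le> r" "generate G T = generate G S"
    using rank_at_mostE [OF assms(1), of S] assms(2) by (metis subset_trans)
  have "T \<subseteq> generate G T" by (auto intro: generate.incl)
  also have "\<dots> \<subseteq> H" using T(3) generate_subset_subgroup [OF assms(3)] S by simp
  finally show "\<exists>T. finite T \<and> T \<subseteq> H \<and> card T \<le> r \<and> generate G T = generate G S" using T by blast
qed

lemma finite_rank_mono:
  "finite_rank G K \<Longrightarrow> H \<subseteq> K \<Longrightarrow> subgroup H G \<Longrightarrow> finite_rank G H"
  using rank_at_most_mono unfolding finite_rank_iff by metis

lemma bounded_exponent_finite_set:
  assumes "finite E" "E \<subseteq> carrier G" "p_elements p E"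
  obtains n where "\<forall>x\<in>E. x [^] (p ^ n) = \<one>"
proof -
  have "\<forall>b\<in>E. \<exists>n. b [^] (p ^ n) = \<one>" using assms(3) by (simp add: p_elements_def)
  then obtain e where e: "\<forall>b\<in>E. b [^] (p ^ e b) = \<one>" by metis
  have "b [^] (p ^ Max (e ` E)) = \<one>" if "b \<in> E" for b
  proof -
    have "p ^ e b dvd p ^ Max (e ` E)" using that assms(1) by (intro le_imp_power_dvd Max_ge) auto
    with e that assms(2) show ?thesis using pow_one_dvd [of b "p ^ e b"] by blast
  qed
  then show thesis using that by blast
qed

text \<open>Counting shows that \<open>B / B\<^sup>p\<close> is no larger than the socle of \<open>B\<close>; a transversal of it
  generates \<open>B\<close> because \<open>B\<^sup>p\<close> consists of non-generators.\<close>

lemma finite_abelian_p_group_generators: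
  assumes B: "subgroup B G" "commuting B B" "p_elements p B" and fin: "finite B"
  obtains T where "T \<subseteq> B" "card T \<le> card (torsion B p)" "generate G T = B"
proof -
  note BG = subgroup.mem_carrier [OF B(1)]
  define P where "P = (\<lambda>x. x [^] p) ` B"
  have PB: "P \<subseteq> B" using subgroup_nat_pow [OF B(1)] by (auto simp: P_def)
  have P: "subgroup P G"
  proof (rule subgroupI)
    show "P \<subseteq> carrier G" using PB BG by auto
    show "P \<noteq> {}" using subgroup.one_closed [OF B(1)] by (auto simp: P_def)
    fix x assume "x \<in> P"
    then obtain b where b: "b \<in> B" "x = b [^] p" by (auto simp: P_def)
    then have "inv x = (inv b) [^] p" using BG by (simp add: nat_pow_inv)
    then show "inv x \<in> P" using b subgroup.m_inv_closed [OF B(1)] by (auto simp: P_def)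
  next
    fix x y assume "x \<in> P" "y \<in> P"
    then obtain a b where ab: "a \<in> B" "b \<in> B" "x = a [^] p" "y = b [^] p" by (auto simp: P_def)
    then have "x \<otimes> y = (a \<otimes> b) [^] p" using commuting_pow_distrib [OF B(1,2)] by simp
    then show "x \<otimes> y \<in> P" using ab subgroup.m_closed [OF B(1)] by (auto simp: P_def)
  qed
  \<comment> \<open>The choice depends only on the coset of \<open>b\<close>, so the image of
    \<open>r\<close> is a transversal of \<open>P\<close> in \<open>B\<close>.\<close>
  define r where "r b = (SOME c. c \<in> P #> b)" for b
  have r: "r b \<otimes> inv b \<in> P" "r b \<in> B" if b: "b \<in> B" for b
  proof -
    have "b \<in> P #> b" using rcos_self P b BG by blast
    then have "r b \<in> P #> b" unfolding r_def by (rule someI)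
    then obtain y where y: "y \<in> P" "r b = y \<otimes> b" by (auto simp: r_coset_def)
    then have "y \<in> B" using PB by auto
    then show "r b \<in> B" using y b subgroup.m_closed [OF B(1)] by simp
    show "r b \<otimes> inv b \<in> P" using y b BG \<open>y \<in> B\<close> by (simp add: m_assoc)
  qed
  define T where "T = r ` B"
  have TB: "T \<subseteq> B" using r by (auto simp: T_def)
  have rT: "r t = t" if t: "t \<in> T" for t
  proof -
    obtain b where b: "b \<in> B" "t = r b" using t by (auto simp: T_def)
    then have "P #> t = P #> b" using rcos_eq_iff [OF P, of t b] r [of b] BG by simp
    then show ?thesis using b by (simp add: r_def)
  qed
  have inj: "inj_on (\<lambda>(t, y). y \<otimes> t) (T \<times> P)"
  proof (rule inj_onI, clarify)
    fix t y t' y' assume a: "t \<in> T" "y \<in> P" "t' \<in> T" "y' \<in> P" "y \<otimes> t = y' \<otimes> t'"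
    have c: "t \<in> carrier G" "y \<in> carrier G" "t' \<in> carrier G" "y' \<in> carrier G" using a TB PB BG by auto
    have "t \<otimes> inv t' = inv y \<otimes> (y \<otimes> t) \<otimes> inv t'" using c by simp
    also have "\<dots> = inv y \<otimes> y'" unfolding a(5) using c by (simp add: m_assoc)
    finally have "t \<otimes> inv t' \<in> P" using a P by (simp add: subgroup.m_closed subgroup.m_inv_closed)
    then have "P #> t = P #> t'" using rcos_eq_iff [OF P] c by simp
    then have "t = t'" using rT [OF a(1)] rT [OF a(3)] by (simp add: r_def)
    then show "t = t' \<and> y = y'" using a(5) c by simp
  qed
  have finP: "finite P" "finite T" using PB TB fin finite_subset by auto
  have "card T * card P = card ((\<lambda>(t, y). y \<otimes> t) ` (T \<times> P))"
    using inj by (simp add: card_image card_cartesian_product)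
  also have "\<dots> \<le> card B"
    using TB PB subgroup.m_closed [OF B(1)] fin by (intro card_mono) auto
  finally have c1: "card T * card P \<le> card B" .
  define s where "s y = (SOME b. b \<in> B \<and> b [^] p = y)" for y
  have s: "s (b [^] p) \<in> B \<and> s (b [^] p) [^] p = b [^] p" if "b \<in> B" for b
    unfolding s_def by (rule someI [where x = b]) (simp add: that)
  \<comment> \<open>Elements with equal \<open>p\<close>-th power differ by a socle element, which
    bounds \<open>card B\<close> by \<open>card P * card (torsion B p)\<close>. Comparison with
    \<open>card T * card P \<le> card B\<close> bounds \<open>card T\<close>.\<close>
  have "B \<subseteq> (\<lambda>(y, t). t \<otimes> s y) ` (P \<times> torsion B p)"
  proof
    fix b assume b: "b \<in> B"
    let ?s = "s (b [^] p)"
    have c: "b \<in> carrier G" "?s \<in> carrier G" using b s BG by auto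
    have "(b \<otimes> inv ?s) [^] p = \<one>" using commuting_pow_diff [OF B(1,2) b, of ?s] s [OF b] c by simp
    then have "b \<otimes> inv ?s \<in> torsion B p" using b s subgroup_mult_inv [OF B(1)] by (auto simp: torsion_def)
    moreover have "b = (b \<otimes> inv ?s) \<otimes> ?s" using c by (simp add: m_assoc)
    moreover have "b [^] p \<in> P" using b by (auto simp: P_def)
    ultimately show "b \<in> (\<lambda>(y, t). t \<otimes> s y) ` (P \<times> torsion B p)" by force
  qed
  moreover have finS: "finite (torsion B p)" using fin by (auto simp: torsion_def)
  ultimately have "card B \<le> card (P \<times> torsion B p)"
    using finP by (meson surj_card_le finite_SigmaI)
  then have "card T * card P \<le> card (torsion B p) * card P"
    using c1 by (simp only: card_cartesian_product mult.commute [of "card P"])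
  moreover have "card P > 0" using finP subgroup.one_closed [OF P] card_gt_0_iff by blast
  ultimately have cT: "card T \<le> card (torsion B p)" by simp
  have gTB: "generate G T \<subseteq> B" using generate_subset_subgroup [OF B(1) TB] .
  have gT: "subgroup (generate G T) G" using TB BG by (intro generate_is_subgroup) auto
  \<comment> \<open>Successive approximation: \<open>b\<close> is a product of an element generated
    by \<open>T\<close> and a \<open>p ^ n\<close>-th power. For large \<open>n\<close> the second
    factor vanishes, as \<open>B\<close> is a finite \<open>p\<close>-group.\<close>
  have step: "\<exists>t \<in> generate G T. \<exists>c \<in> B. b = t \<otimes> c [^] (p ^ n)" if "b \<in> B" for b n
  proof (induction n)
    case 0
    show ?case using that BG generate.one by (intro bexI [of _ \<one>] bexI [of _ b]) auto
  next
    case (Suc n)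
    then obtain t c where tc: "t \<in> generate G T" "c \<in> B" "b = t \<otimes> c [^] (p ^ n)" by blast
    have "inv (r c \<otimes> inv c) \<in> P" using r(1) [OF tc(2)] P by (simp add: subgroup.m_inv_closed)
    then have "c \<otimes> inv (r c) \<in> P" using r(2) [OF tc(2)] tc(2) BG by (simp add: inv_mult_group)
    then obtain d where d: "d \<in> B" "c \<otimes> inv (r c) = d [^] p" by (auto simp: P_def)
    have rc: "r c \<in> B" using r tc by blast
    have "c = d [^] p \<otimes> r c" using mult_inv_eqD [OF d(2)] tc rc BG by simp
    moreover have dp: "d [^] p \<in> B" using d subgroup_nat_pow [OF B(1)] by blast
    ultimately have c: "c = r c \<otimes> d [^] p" using rc B(2) unfolding commuting_def by metis
    have "c [^] (p ^ n) = (r c \<otimes> d [^] p) [^] (p ^ n)" using c by simp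
    also have "\<dots> = (r c) [^] (p ^ n) \<otimes> (d [^] p) [^] (p ^ n)"
      using commuting_pow_distrib [OF B(1,2) rc dp] .
    also have "(d [^] p) [^] (p ^ n) = d [^] (p ^ Suc n)" using d BG by (simp add: nat_pow_pow)
    finally have "b = (t \<otimes> (r c) [^] (p ^ n)) \<otimes> d [^] (p ^ Suc n)"
      using tc(3) tc(1) gTB rc d BG by (simp add: m_assoc subsetD)
    moreover have "r c \<in> generate G T" using tc by (auto simp: T_def intro: generate.incl)
    then have "t \<otimes> (r c) [^] (p ^ n) \<in> generate G T"
      using tc(1) gT subgroup_nat_pow subgroup.m_closed by metis
    ultimately show ?case using d by blast
  qed
  obtain n where n: "\<forall>b\<in>B. b [^] (p ^ n) = \<one>"
    using bounded_exponent_finite_set [OF fin subgroup.subset [OF B(1)] B(3)] .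
  have "B \<subseteq> generate G T"
  proof
    fix b assume "b \<in> B"
    from step [OF this, of n] obtain t c where "t \<in> generate G T" "c \<in> B" "b = t \<otimes> c [^] (p ^ n)" by blast
    then show "b \<in> generate G T" using n gTB BG by auto
  qed
  then show thesis using that TB cT gTB by blast
qed

text \<open>With representatives \<open>F\<close> of \<open>K\<close> modulo \<open>D\<close> and a
  finite normalized subgroup \<open>A\<close> of \<open>D\<close>, the set of products of
  \<open>A\<close> and \<open>F\<close> is closed under multiplication once \<open>A\<close>
  contains the \<open>D\<close>-parts of all products of two representatives.\<close>

lemma virtually_abelian_locally_finite:
  assumes K: "subgroup K G" and D: "subgroup D G" "D \<subseteq> K" "normalizes K D" "commuting D D"
    and pD: "p_elements p D" and finD: "finite (torsion D p)" and cov: "finitely_covered K D"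
    and S: "finite S" "S \<subseteq> K"
  shows "finite (generate G S)"
proof -
  note KG = subgroup.mem_carrier [OF K] note DG = subgroup.mem_carrier [OF D(1)]
  obtain F where F: "finite F" "F \<subseteq> K" "\<forall>h\<in>K. \<exists>f\<in>F. h \<otimes> inv f \<in> D"
    using finitely_coveredE [OF cov D(1) subgroup.subset [OF K]] .
  then have "\<forall>h\<in>K. \<exists>f. f \<in> F \<and> h \<otimes> inv f \<in> D" by blast
  then obtain c where c: "\<forall>h\<in>K. c h \<in> F \<and> h \<otimes> inv (c h) \<in> D" by metis
  \<comment> \<open>Besides products of representatives, \<open>L\<close> contains \<one>, the
    generators and their inverses; \<open>E\<close> collects the \<open>D\<close>-parts of these
    finitely many elements. A common exponent of \<open>E\<close> determines
    \<open>A\<close>.\<close>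
  define L where "L = insert \<one> (S \<union> (\<lambda>x. inv x) ` S \<union> (\<lambda>(f, f'). f \<otimes> f') ` (F \<times> F))"
  have LK: "L \<subseteq> K" using S F K by (auto simp: L_def subgroup.one_closed subgroup.m_inv_closed subgroup.m_closed subset_iff)
  have finL: "finite L" using S F by (simp add: L_def)
  define E where "E = (\<lambda>l. l \<otimes> inv (c l)) ` L"
  have ED: "E \<subseteq> D" using c LK by (auto simp: E_def)
  obtain m where m: "\<forall>x\<in>E. x [^] (p ^ m) = \<one>"
    using bounded_exponent_finite_set [of E p] finL ED DG p_elements_mono [OF pD ED] by (auto simp: E_def)
  define A where "A = torsion D (p ^ m)"
  have A: "subgroup A G" "finite A" "normalizes K A" "A \<subseteq> carrier G"
    using torsion_subgroup [OF D(1,4)] finite_torsion_prime_power [OF D(1,4) pD finD]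
      normalizes_torsion [OF D(3) subgroup.subset [OF K] subgroup.subset [OF D(1)]] DG
    by (auto simp: A_def torsion_def)
  define Z where "Z = (\<lambda>(a, f). a \<otimes> f) ` (A \<times> F)"
  have finZ: "finite Z" using A F by (simp add: Z_def)
  have LZ: "L \<subseteq> Z"
  proof
    fix l assume l: "l \<in> L"
    then have "l \<otimes> inv (c l) \<in> A" "c l \<in> F" using m ED c LK by (auto simp: A_def torsion_def E_def)
    moreover have "l = (l \<otimes> inv (c l)) \<otimes> c l" using l LK c F KG by (simp add: m_assoc subset_iff)
    ultimately show "l \<in> Z" unfolding Z_def by force
  qed
  have Zm: "x \<otimes> y \<in> Z" if xy: "x \<in> Z" "y \<in> Z" for x y
  proof -
    obtain a f b g where ab: "a \<in> A" "f \<in> F" "b \<in> A" "g \<in> F" "x = a \<otimes> f" "y = b \<otimes> g"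
      using xy by (auto simp: Z_def)
    have "f \<otimes> g \<in> Z" using LZ ab by (auto simp: L_def)
    then obtain d h where dh: "d \<in> A" "h \<in> F" "f \<otimes> g = d \<otimes> h" by (auto simp: Z_def)
    have cc: "a \<in> carrier G" "b \<in> carrier G" "d \<in> carrier G" "f \<in> carrier G" "g \<in> carrier G" "h \<in> carrier G"
      using ab dh A F KG by auto
    have n: "f \<otimes> b \<otimes> inv f \<in> A" using A(3) ab F by (auto simp: normalizes_def)
    have "x \<otimes> y = a \<otimes> (f \<otimes> b \<otimes> inv f) \<otimes> (f \<otimes> g)" using ab cc by (simp add: m_assoc)
    also have "\<dots> = (a \<otimes> (f \<otimes> b \<otimes> inv f) \<otimes> d) \<otimes> h" unfolding dh(3) using cc by (simp add: m_assoc)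
    finally have e: "x \<otimes> y = (a \<otimes> (f \<otimes> b \<otimes> inv f) \<otimes> d) \<otimes> h" .
    have "a \<otimes> (f \<otimes> b \<otimes> inv f) \<otimes> d \<in> A" using n ab(1) dh(1) A(1) by (simp add: subgroup.m_closed)
    then show ?thesis unfolding e Z_def using dh(2) by blast
  qed
  have "generate G S \<subseteq> Z"
  proof
    fix x assume "x \<in> generate G S"
    then show "x \<in> Z"
      by (induction rule: generate.induct) (use LZ Zm in \<open>auto simp: L_def\<close>)
  qed
  then show ?thesis using finZ finite_subset by blast
qed

text \<open>A finitely generated subgroup \<open>H\<close> is finite. It is generated by generators
  of \<open>H \<inter> D\<close>, at most as many as the socle of \<open>D\<close> has elements,
  together with representatives of \<open>H\<close> modulo \<open>D\<close>, at most
  \<open>card E\<close> in number.\<close>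

lemma virtually_abelian_finite_rank:
  assumes K: "subgroup K G" and D: "subgroup D G" "D \<subseteq> K" "normalizes K D" "commuting D D"
    and pD: "p_elements p D" and finD: "finite (torsion D p)" and cov: "finitely_covered K D"
  shows "finite_rank G K"
proof -
  note KG = subgroup.mem_carrier [OF K] note DG = subgroup.mem_carrier [OF D(1)]
  obtain E where E: "finite E" "E \<subseteq> carrier G" "\<forall>h\<in>K. \<exists>f\<in>E. h \<otimes> inv f \<in> D"
    using cov finitely_covered_def by auto
  have "\<exists>T. finite T \<and> T \<subseteq> K \<and> card T \<le> card (torsion D p) + card E \<and> generate G T = generate G S"
    if S: "finite S" "S \<subseteq> K" for S
  proof -
    define H where "H = generate G S"
    have H: "subgroup H G" "H \<subseteq> K" "finite H"
      using generate_is_subgroup [of S] S KG generate_subset_subgroup [OF K S(2)]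
        virtually_abelian_locally_finite [OF assms S] by (auto simp: H_def)
    note HG = subgroup.mem_carrier [OF H(1)]
    have HE: "\<forall>h\<in>H. \<exists>f\<in>E. h \<otimes> inv f \<in> D" using E(3) H(2) by blast
    obtain F where F: "finite F" "F \<subseteq> H" "card F \<le> card E" "\<forall>h\<in>H. \<exists>f\<in>F. h \<otimes> inv f \<in> D"
      using covering_representatives [OF E(1,2) HE D(1) subgroup.subset [OF H(1)]] .
    have B: "subgroup (H \<inter> D) G" "commuting (H \<inter> D) (H \<inter> D)" "p_elements p (H \<inter> D)" "finite (H \<inter> D)"
      using subgroups_Inter_pair [OF H(1) D(1)] H(3) commuting_mono [OF D(4)] p_elements_mono [OF pD] by auto
    obtain T where T: "T \<subseteq> H \<inter> D" "card T \<le> card (torsion (H \<inter> D) p)" "generate G T = H \<inter> D"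
      using finite_abelian_p_group_generators [OF B] .
    have "card (torsion (H \<inter> D) p) \<le> card (torsion D p)"
      using finD by (intro card_mono) (auto simp: torsion_def)
    then have "card (T \<union> F) \<le> card (torsion D p) + card E"
      using card_Un_le [of T F] T(2) F(3) by linarith
    moreover have TF: "T \<union> F \<subseteq> H" using T F by auto
    moreover have "finite (T \<union> F)" using TF H(3) finite_subset by blast
    moreover have "generate G (T \<union> F) = H"
    proof
      show "generate G (T \<union> F) \<subseteq> H" using TF generate_subset_subgroup [OF H(1)] by blast
      show "H \<subseteq> generate G (T \<union> F)"
      proof
        fix h assume h: "h \<in> H"
        obtain f where f: "f \<in> F" "h \<otimes> inv f \<in> D" using F(4) h by blast
        have "f \<in> H" using f F by auto
        then have "h \<otimes> inv f \<in> H \<inter> D" using f h subgroup_mult_inv [OF H(1)] by auto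
        then have "h \<otimes> inv f \<in> generate G (T \<union> F)" using T(3) mono_generate [of T "T \<union> F"] by auto
        moreover have "f \<in> generate G (T \<union> F)" using f by (auto intro: generate.incl)
        ultimately have "h \<otimes> inv f \<otimes> f \<in> generate G (T \<union> F)" by (rule generate.eng)
        then show "h \<in> generate G (T \<union> F)" using h \<open>f \<in> H\<close> HG by (simp add: m_assoc)
      qed
    qed
    ultimately show ?thesis using H(2) by (intro exI [of _ "T \<union> F"]) (auto simp: H_def)
  qed
  then show ?thesis unfolding finite_rank_def by blast
qed

text \<open>Otherwise all socles in question are finite, so \<open>K\<close> is virtually abelian;
  the abelian subgroup has finite socle as well, and \<open>K\<close> would have finite
  rank.\<close>

lemma infinite_rank_infinite_socle:
  assumes "Factorial_Ring.prime (p::nat)" "subnormal G K" "p_elements p K" "(derived G ^^ n) K = {\<one>}" "\<not> finite_rank G K"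
  obtains U where "subnormal G U" "U \<subseteq> K" "commuting U U" "infinite (torsion U p)"
proof -
  have K: "subgroup K G" using assms(2) by (rule subnormal_subgroup)
  have False if no: "\<And>U. subnormal G U \<Longrightarrow> U \<subseteq> K \<Longrightarrow> commuting U U \<Longrightarrow> finite (torsion U p)"
  proof -
    from virtually_abelian_of_finite_socles [OF assms(1-4) no]
    obtain e where e: "commuting (generate G ((\<lambda>x. x [^] (p ^ e)) ` K)) (generate G ((\<lambda>x. x [^] (p ^ e)) ` K))"
      "finitely_covered K (generate G ((\<lambda>x. x [^] (p ^ e)) ` K))" by auto
    let ?D = "generate G ((\<lambda>x. x [^] (p ^ e)) ` K)"
    note D = power_subgroup_facts [OF K normalizes_self [OF K] subgroup.subset [OF K], of "p ^ e"]
    have "subnormal G ?D" using subnormal_stepI assms(2) D by blast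
    then have "finite (torsion ?D p)" using no D e by blast
    then have "finite_rank G K"
      using virtually_abelian_finite_rank [OF K D e(1) _ _ e(2)] p_elements_mono [OF assms(3) D(2)] by blast
    then show False using assms(5) by simp
  qed
  then show thesis using that by blast
qed

end

section \<open>Primary components of locally nilpotent groups\<close>

text \<open>Positivity excludes the exponent 0, which annihilates every element.\<close>

definition pi_number :: "nat set \<Rightarrow> nat \<Rightarrow> bool" where
  "pi_number \<pi> n \<longleftrightarrow> n > 0 \<and> (\<forall>q. Factorial_Ring.prime q \<and> q dvd n \<longrightarrow> q \<in> \<pi>)"

lemma pi_number_1: "pi_number \<pi> 1"
  using not_prime_unit by (auto simp: pi_number_def)

lemma pi_number_mult: "pi_number \<pi> m \<Longrightarrow> pi_number \<pi> n \<Longrightarrow> pi_number \<pi> (m * n)"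
  by (auto simp: pi_number_def prime_dvd_mult_iff)

lemma pi_number_mono: "pi_number \<pi> n \<Longrightarrow> \<pi> \<subseteq> \<rho> \<Longrightarrow> pi_number \<rho> n"
  by (auto simp: pi_number_def)

lemma pi_number_coprime:
  assumes "pi_number \<pi> m" "pi_number \<rho> n" "\<pi> \<inter> \<rho> = {}" shows "coprime m n"
proof (rule ccontr)
  assume "\<not> coprime m n"
  then have "gcd m n \<noteq> 1" by (simp add: coprime_iff_gcd_eq_1)
  then obtain q where "Factorial_Ring.prime q" "q dvd gcd m n" using prime_factor_nat by blast
  then show False using assms by (auto simp: pi_number_def)
qed

text \<open>Split off one prime factor at a time and assign it to a set containing it.\<close>

lemma pi_number_union:
  assumes "pi_number (\<pi> \<union> \<rho>) n"
  shows "\<exists>k l. n = k * l \<and> pi_number \<pi> k \<and> pi_number \<rho> l"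
  using assms
proof (induction n rule: less_induct)
  case (less n)
  show ?case
  proof (cases "n = 1")
    case True then show ?thesis using pi_number_1 by (intro exI [of _ 1]) simp
  next
    case False
    then obtain q where q: "Factorial_Ring.prime q" "q dvd n" using prime_factor_nat by blast
    then obtain m where m: "n = q * m" by (elim dvdE)
    have n0: "n > 0" and q\<pi>: "q \<in> \<pi> \<union> \<rho>" using less.prems q by (auto simp: pi_number_def)
    have "m < n" using m n0 mult_strict_right_mono [OF prime_gt_1_nat [OF q(1)], of m] by auto
    moreover have "pi_number (\<pi> \<union> \<rho>) m" using less.prems m by (auto simp: pi_number_def)
    ultimately obtain k l where kl: "m = k * l" "pi_number \<pi> k" "pi_number \<rho> l" using less.IH by blast
    have "r = q" if "Factorial_Ring.prime r" "r dvd q" for r using that q(1) primes_dvd_imp_eq by blast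
    then have qn: "pi_number \<pi> q \<or> pi_number \<rho> q"
      using q\<pi> prime_gt_0_nat [OF q(1)] by (auto simp: pi_number_def)
    then show ?thesis
    proof
      assume "pi_number \<pi> q"
      then show ?thesis using kl m pi_number_mult by (intro exI [of _ "q * k"] exI [of _ l]) (auto simp: mult.assoc)
    next
      assume "pi_number \<rho> q"
      then show ?thesis using kl m pi_number_mult by (intro exI [of _ k] exI [of _ "q * l"]) (auto simp: mult_ac)
    qed
  qed
qed

lemma pi_number_singleton:
  assumes "pi_number {p} n" shows "\<exists>k. n = p ^ k"
  using assms
proof (induction n rule: less_induct)
  case (less n)
  show ?case
  proof (cases "n = 1")
    case True then show ?thesis by (intro exI [of _ 0]) simp
  next
    case False
    then obtain q where q: "Factorial_Ring.prime q" "q dvd n" using prime_factor_nat by blast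
    then have "q = p" using less.prems by (auto simp: pi_number_def)
    then obtain m where m: "n = p * m" using q by (elim dvdE) simp
    have "m < n" using m less.prems mult_strict_right_mono [OF prime_gt_1_nat [OF q(1)], of m] \<open>q = p\<close>
      by (auto simp: pi_number_def)
    moreover have "pi_number {p} m" using less.prems m by (auto simp: pi_number_def)
    ultimately obtain k where "m = p ^ k" using less.IH by blast
    then show ?thesis using m by (intro exI [of _ "Suc k"]) simp
  qed
qed

context group
begin

definition pi_elements :: "nat set \<Rightarrow> 'a set \<Rightarrow> 'a set" where
  "pi_elements \<pi> H = {x \<in> H. \<exists>n. pi_number \<pi> n \<and> x [^] n = \<one>}"

text \<open>Equality of right cosets of \<open>N\<close>; it permits calculating in a quotient with
  representatives.\<close>

definition congruent_mod :: "'a set \<Rightarrow> 'a \<Rightarrow> 'a \<Rightarrow> bool" where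
  "congruent_mod N x y \<longleftrightarrow> x \<otimes> inv y \<in> N"

section \<open>Computations modulo a normal subgroup with abelian quotient\<close>

context
  fixes A N :: "'a set"
  assumes A: "subgroup A G" and N: "subgroup N G" and NA: "N \<subseteq> A" and nrm: "normalizes A N"
    and ab: "\<And>x y. x \<in> A \<Longrightarrow> y \<in> A \<Longrightarrow> x \<otimes> y \<otimes> inv x \<otimes> inv y \<in> N"
begin

lemma congruent_mod_refl: "x \<in> A \<Longrightarrow> congruent_mod N x x"
  using subgroup.mem_carrier [OF A] subgroup.one_closed [OF N] by (simp add: congruent_mod_def)

lemma congruent_mod_trans:
  assumes "congruent_mod N x y" "congruent_mod N y z" "x \<in> A" "y \<in> A" "z \<in> A"
  shows "congruent_mod N x z"
proof -
  have "(x \<otimes> inv y) \<otimes> (y \<otimes> inv z) \<in> N"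
    using assms(1,2) N by (simp add: congruent_mod_def subgroup.m_closed)
  then show ?thesis using assms(3-5) subgroup.mem_carrier [OF A] by (simp add: congruent_mod_def m_assoc)
qed

lemma congruent_mod_mult:
  assumes "congruent_mod N x x'" "congruent_mod N y y'" "x \<in> A" "y \<in> A" "x' \<in> A" "y' \<in> A"
  shows "congruent_mod N (x \<otimes> y) (x' \<otimes> y')"
proof -
  have "x \<otimes> (y \<otimes> inv y') \<otimes> inv x \<in> N" using assms nrm by (simp add: normalizes_def congruent_mod_def)
  then have "(x \<otimes> (y \<otimes> inv y') \<otimes> inv x) \<otimes> (x \<otimes> inv x') \<in> N"
    using assms(1) N by (simp add: congruent_mod_def subgroup.m_closed)
  then show ?thesis using assms(3-6) subgroup.mem_carrier [OF A]
    by (simp add: congruent_mod_def m_assoc inv_mult_group)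
qed

lemma congruent_mod_commute: "x \<in> A \<Longrightarrow> y \<in> A \<Longrightarrow> congruent_mod N (x \<otimes> y) (y \<otimes> x)"
  using ab [of x y] subgroup.mem_carrier [OF A] by (simp add: congruent_mod_def m_assoc inv_mult_group)

lemma congruent_mod_mem: "congruent_mod N x y \<Longrightarrow> y \<in> N \<Longrightarrow> x \<in> A \<Longrightarrow> x \<in> N"
proof -
  assume a: "congruent_mod N x y" "y \<in> N" "x \<in> A"
  then have "(x \<otimes> inv y) \<otimes> y \<in> N" using N by (simp add: congruent_mod_def subgroup.m_closed)
  then show ?thesis using a subgroup.mem_carrier [OF A] subgroup.mem_carrier [OF N] by (simp add: m_assoc)
qed

lemma congruent_mod_pow_mult:
  assumes "x \<in> A" "y \<in> A"
  shows "congruent_mod N ((x \<otimes> y) [^] (n::nat)) (x [^] n \<otimes> y [^] n)"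
proof (induction n)
  case 0 then show ?case using congruent_mod_refl subgroup.one_closed [OF A] by simp
next
  case (Suc n)
  note cl = subgroup.m_closed [OF A] subgroup_nat_pow [OF A] assms
  note AG = subgroup.mem_carrier [OF A]
  have 1: "congruent_mod N ((x \<otimes> y) [^] n \<otimes> (x \<otimes> y)) ((x [^] n \<otimes> y [^] n) \<otimes> (x \<otimes> y))"
    using Suc by (intro congruent_mod_mult congruent_mod_refl) (auto intro!: cl)
  have "congruent_mod N (x [^] n \<otimes> (y [^] n \<otimes> x) \<otimes> y) (x [^] n \<otimes> (x \<otimes> y [^] n) \<otimes> y)"
    by (intro congruent_mod_mult congruent_mod_commute congruent_mod_refl) (auto intro!: cl)
  then have 2: "congruent_mod N ((x [^] n \<otimes> y [^] n) \<otimes> (x \<otimes> y)) (x [^] Suc n \<otimes> y [^] Suc n)"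
    using AG assms by (simp add: m_assoc)
  have "congruent_mod N ((x \<otimes> y) [^] n \<otimes> (x \<otimes> y)) (x [^] Suc n \<otimes> y [^] Suc n)"
    by (rule congruent_mod_trans [OF 1 2]) (auto intro!: cl)
  then show ?case by simp
qed

text \<open>These are the preimages of the \<open>\<pi>\<close>-elements of the abelian group
  \<open>A / N\<close>; for a product the exponents multiply.\<close>

lemma pi_exponent_mod_subgroup:
  "subgroup {x \<in> A. \<exists>n. pi_number \<pi> n \<and> x [^] n \<in> N} G" (is "subgroup ?B G")
proof (rule subgroupI)
  note AG = subgroup.mem_carrier [OF A]
  show "?B \<subseteq> carrier G" using AG by auto
  show "?B \<noteq> {}" using subgroup.one_closed [OF A] subgroup.one_closed [OF N] pi_number_1 [of \<pi>]
    by (auto intro!: exI [of _ \<one>] exI [of _ 1])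
  fix x assume "x \<in> ?B"
  then obtain n where n: "x \<in> A" "pi_number \<pi> n" "x [^] n \<in> N" by auto
  then have "inv x [^] n \<in> N" using N AG by (simp add: nat_pow_inv subgroup.m_inv_closed)
  then show "inv x \<in> ?B" using n A by (auto simp: subgroup.m_inv_closed)
next
  note AG = subgroup.mem_carrier [OF A]
  fix x y assume "x \<in> ?B" "y \<in> ?B"
  then obtain m n where mn: "x \<in> A" "y \<in> A" "pi_number \<pi> m" "x [^] m \<in> N" "pi_number \<pi> n" "y [^] n \<in> N" by auto
  have "x [^] (m * n) \<in> N" "y [^] (n * m) \<in> N"
    using mn AG subgroup_nat_pow [OF N] by (simp_all add: nat_pow_pow [symmetric])
  then have "x [^] (m * n) \<otimes> y [^] (m * n) \<in> N" using N by (simp add: subgroup.m_closed mult.commute)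
  then have "(x \<otimes> y) [^] (m * n) \<in> N"
    using congruent_mod_mem [OF congruent_mod_pow_mult [OF mn(1,2)]]
      subgroup_nat_pow [OF A] subgroup.m_closed [OF A mn(1,2)] by blast
  then show "x \<otimes> y \<in> ?B" using mn pi_number_mult subgroup.m_closed [OF A] by blast
qed

end

section \<open>Torsion in nilpotent and locally nilpotent groups\<close>

lemma lower_central_facts:
  assumes H: "subgroup H G"
  shows "subgroup (lower_central G H i) G \<and> lower_central G H i \<subseteq> H \<and> normalizes H (lower_central G H i) \<and>
    lower_central G H (Suc i) \<subseteq> lower_central G H i"
proof (induction i)
  case 0
  have "commutator_set G H H \<subseteq> H"
    using H by (auto simp: commutator_set_def intro!: subgroup.m_closed subgroup.m_inv_closed)
  then show ?case using H normalizes_self generate_subset_subgroup by auto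
next
  case (Suc i)
  note HG = subgroup.mem_carrier [OF H]
  let ?L = "lower_central G H i" and ?M = "lower_central G H (Suc i)"
  have M: "?M \<subseteq> ?L" "?M \<subseteq> H" using Suc by auto
  have LH: "commutator_set G ?L H \<subseteq> H"
    using H Suc by (auto simp: commutator_set_def intro!: subgroup.m_closed subgroup.m_inv_closed)
  have "normalizes H (commutator_set G ?L H)"
    unfolding normalizes_def
  proof (intro ballI)
    fix h k assume h: "h \<in> H" and "k \<in> commutator_set G ?L H"
    then obtain a b where ab: "a \<in> ?L" "b \<in> H" "k = a \<otimes> b \<otimes> inv a \<otimes> inv b" by (auto simp: commutator_set_def)
    have c: "h \<in> carrier G" "a \<in> carrier G" "b \<in> carrier G" using h ab Suc HG by auto
    let ?a = "h \<otimes> a \<otimes> inv h" and ?b = "h \<otimes> b \<otimes> inv h"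
    have "h \<otimes> k \<otimes> inv h = ?a \<otimes> ?b \<otimes> inv ?a \<otimes> inv ?b" using c ab by (simp add: m_assoc inv_mult_group)
    moreover have "?a \<in> ?L" using Suc h ab by (simp add: normalizes_def)
    moreover have "?b \<in> H" using h ab H by (simp add: subgroup.m_closed subgroup.m_inv_closed)
    ultimately show "h \<otimes> k \<otimes> inv h \<in> commutator_set G ?L H" unfolding commutator_set_def by blast
  qed
  then have nM: "normalizes H ?M" using normalizes_generate [of H "commutator_set G ?L H"] LH HG by auto
  have sM: "subgroup ?M G" using generate_is_subgroup [of "commutator_set G ?L H"] LH HG by auto
  have "commutator_set G ?M H \<subseteq> ?M"
  proof
    fix k assume "k \<in> commutator_set G ?M H"
    then obtain a b where ab: "a \<in> ?M" "b \<in> H" "k = a \<otimes> b \<otimes> inv a \<otimes> inv b" by (auto simp: commutator_set_def)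
    have c: "a \<in> carrier G" "b \<in> carrier G" using ab HG M by blast+
    have "b \<otimes> inv a \<otimes> inv b \<in> ?M" using nM ab sM by (simp add: normalizes_def subgroup.m_inv_closed)
    then have "a \<otimes> (b \<otimes> inv a \<otimes> inv b) \<in> ?M" using ab sM by (simp add: subgroup.m_closed)
    then show "k \<in> ?M" using c ab(3) by (simp add: m_assoc)
  qed
  then have "lower_central G H (Suc (Suc i)) \<subseteq> ?M" using generate_subset_subgroup [OF sM] by simp
  then show ?case using sM M nM by blast
qed

text \<open>Modulo \<open>N\<close> the elements of \<open>A\<close> are central in
  \<open>H\<close>. The commutator of \<open>a [^] Suc n\<close> with \<open>b\<close> is a
  conjugate of the commutator of \<open>a\<close> and \<open>b\<close> times that of
  \<open>a [^] n\<close> and \<open>b\<close>, and modulo \<open>N\<close> the conjugation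
  disappears.\<close>

lemma commutator_pow_congruent:
  assumes A: "subgroup A G" "normalizes H A" "A \<subseteq> H" and N: "subgroup N G" "normalizes H N" "N \<subseteq> A" and H: "subgroup H G"
    and cen: "\<And>x y. x \<in> A \<Longrightarrow> y \<in> H \<Longrightarrow> x \<otimes> y \<otimes> inv x \<otimes> inv y \<in> N"
    and a: "a \<in> H" and b: "b \<in> H" and com: "\<And>n::nat. a [^] n \<otimes> b \<otimes> inv (a [^] n) \<otimes> inv b \<in> A"
  shows "congruent_mod N (a [^] n \<otimes> b \<otimes> inv (a [^] n) \<otimes> inv b) ((a \<otimes> b \<otimes> inv a \<otimes> inv b) [^] (n::nat))"
proof -
  note HG = subgroup.mem_carrier [OF H]
  have nA: "normalizes A N" using N(2) A(3) normalizes_mono by blast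
  have cenA: "\<And>x y. x \<in> A \<Longrightarrow> y \<in> A \<Longrightarrow> x \<otimes> y \<otimes> inv x \<otimes> inv y \<in> N" using cen A(3) by blast
  note ctx = A(1) N(1,3) nA cenA
  have cA: "a \<otimes> b \<otimes> inv a \<otimes> inv b \<in> A" (is "?c \<in> A") using com [of 1] a HG by simp
  have c: "a \<in> carrier G" "b \<in> carrier G" "?c \<in> carrier G" using a b HG by auto
  show ?thesis
  proof (induction n)
    case 0
    have "congruent_mod N \<one> \<one>" using congruent_mod_refl [OF ctx subgroup.one_closed [OF A(1)]] .
    then show ?case using c by simp
  next
    case (Suc n)
    let ?d = "a [^] n \<otimes> b \<otimes> inv (a [^] n) \<otimes> inv b"
    have dA: "?d \<in> A" by (rule com)
    have anH: "a [^] n \<in> H" using subgroup_nat_pow [OF H a] .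
    have e: "a [^] Suc n \<otimes> b \<otimes> inv (a [^] Suc n) \<otimes> inv b = (a [^] n \<otimes> ?c \<otimes> inv (a [^] n)) \<otimes> ?d"
      using c by (simp add: m_assoc inv_mult_group)
    have kA: "a [^] n \<otimes> ?c \<otimes> inv (a [^] n) \<in> A" using A(2) anH cA by (simp add: normalizes_def)
    have "inv (?c \<otimes> a [^] n \<otimes> inv ?c \<otimes> inv (a [^] n)) \<in> N"
      using cen [OF cA anH] N(1) by (simp add: subgroup.m_inv_closed)
    moreover have "inv (?c \<otimes> g \<otimes> inv ?c \<otimes> inv g) = g \<otimes> ?c \<otimes> inv g \<otimes> inv ?c" if "g \<in> carrier G" for g
      using that c by (simp add: m_assoc inv_mult_group)
    ultimately have 1: "congruent_mod N (a [^] n \<otimes> ?c \<otimes> inv (a [^] n)) ?c"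
      using c by (simp add: congruent_mod_def)
    have cnA: "?c [^] n \<in> A" using subgroup_nat_pow [OF A(1) cA] .
    have "congruent_mod N (a [^] Suc n \<otimes> b \<otimes> inv (a [^] Suc n) \<otimes> inv b) (?c \<otimes> ?c [^] n)"
      unfolding e using congruent_mod_mult [OF ctx 1 Suc.IH kA dA cA cnA] .
    then show ?case using nat_pow_Suc2 [OF c(3), of n] by simp
  qed
qed

text \<open>Every lower central factor consists of \<open>\<pi>\<close>-elements: the first because
  its generators do, the next because the \<open>n\<close>-th power of the commutator of
  \<open>a\<close> and \<open>b\<close> is congruent to the commutator of \<open>a [^] n\<close> and
  \<open>b\<close>, which drops one step further if \<open>a [^] n\<close> does. The series is
  finite, so the exponents of the factors multiply up.\<close>

lemma nilpotent_pi_elements: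
  assumes S: "S \<subseteq> carrier G" "\<And>s. s \<in> S \<Longrightarrow> \<exists>n. pi_number \<pi> n \<and> s [^] n = \<one>"
    and nil: "nilpotent_subgroup G (generate G S)" and x: "x \<in> generate G S"
  shows "\<exists>n. pi_number \<pi> n \<and> x [^] n = \<one>"
proof -
  define H where "H = generate G S"
  have H: "subgroup H G" using nil by (simp add: nilpotent_subgroup_def H_def)
  note HG = subgroup.mem_carrier [OF H]
  define L where "L = lower_central G H"
  have L: "subgroup (L i) G" "L i \<subseteq> H" "normalizes H (L i)" "L (Suc i) \<subseteq> L i" for i
    using lower_central_facts [OF H, of i] by (auto simp: L_def)
  have com: "x \<otimes> y \<otimes> inv x \<otimes> inv y \<in> L (Suc i)" if "x \<in> L i" "y \<in> H" for x y i
    using that unfolding L_def lower_central.simps commutator_set_def by (intro generate.incl) blast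
  have com': "x \<otimes> y \<otimes> inv x \<otimes> inv y \<in> L (Suc i)" if "x \<in> L i" "y \<in> L i" for x y i
    using com that L(2) by blast
  have nLL: "normalizes (L i) (L (Suc i))" for i using L(3) L(2) normalizes_mono by blast
  \<comment> \<open>As \<open>B i\<close> is a subgroup, \<open>L i \<subseteq> B i\<close> only has
    to be checked on generators of \<open>L i\<close>.\<close>
  define B where "B i = {x \<in> L i. \<exists>n. pi_number \<pi> n \<and> x [^] n \<in> L (Suc i)}" for i
  have B: "subgroup (B i) G" for i
    unfolding B_def by (rule pi_exponent_mod_subgroup [OF L(1) L(1) L(4) nLL com'])
  have "L i \<subseteq> B i" for i
  proof (induction i)
    case 0
    have "S \<subseteq> B 0"
    proof
      fix s assume s: "s \<in> S"
      then obtain n where "pi_number \<pi> n" "s [^] n = \<one>" using S by blast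
      moreover have "s \<in> L 0" using s by (auto simp: L_def H_def intro: generate.incl)
      ultimately show "s \<in> B 0" using subgroup.one_closed [OF L(1)] by (auto simp: B_def)
    qed
    then have "H \<subseteq> B 0" using generate_subset_subgroup [OF B] by (simp add: H_def)
    then show ?case by (simp add: L_def)
  next
    case (Suc i)
    have "commutator_set G (L i) H \<subseteq> B (Suc i)"
    proof
      fix k assume "k \<in> commutator_set G (L i) H"
      then obtain a b where ab: "a \<in> L i" "b \<in> H" "k = a \<otimes> b \<otimes> inv a \<otimes> inv b" by (auto simp: commutator_set_def)
      have kL: "k \<in> L (Suc i)" using ab com by simp
      obtain n where n: "pi_number \<pi> n" "a [^] n \<in> L (Suc i)" using Suc ab by (auto simp: B_def)
      have aH: "a \<in> H" using ab L(2) by blast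
      have cp: "a [^] m \<otimes> b \<otimes> inv (a [^] m) \<otimes> inv b \<in> L (Suc i)" for m :: nat
        using com [OF subgroup_nat_pow [OF L(1) ab(1)] ab(2)] .
      have "congruent_mod (L (Suc (Suc i))) (a [^] n \<otimes> b \<otimes> inv (a [^] n) \<otimes> inv b) (k [^] n)"
        unfolding ab(3)
        by (rule commutator_pow_congruent [OF L(1) L(3) L(2) L(1) L(3) L(4) H com aH ab(2) cp])
      then have "inv ((a [^] n \<otimes> b \<otimes> inv (a [^] n) \<otimes> inv b) \<otimes> inv (k [^] n)) \<in> L (Suc (Suc i))"
        using subgroup.m_inv_closed [OF L(1)] by (simp add: congruent_mod_def)
      moreover have u: "a [^] n \<otimes> b \<otimes> inv (a [^] n) \<otimes> inv b \<in> L (Suc (Suc i))" using com [OF n(2) ab(2)] .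
      ultimately have "inv ((a [^] n \<otimes> b \<otimes> inv (a [^] n) \<otimes> inv b) \<otimes> inv (k [^] n)) \<otimes>
          (a [^] n \<otimes> b \<otimes> inv (a [^] n) \<otimes> inv b) \<in> L (Suc (Suc i))" using subgroup.m_closed [OF L(1)] by blast
      moreover have "k \<in> carrier G" using kL L(2) HG by blast
      ultimately have "k [^] n \<in> L (Suc (Suc i))"
        using subgroup.mem_carrier [OF L(1) u] by (simp only: inv_mult_group inv_closed nat_pow_closed inv_inv m_assoc l_inv r_one)
      then show "k \<in> B (Suc i)" using kL n by (auto simp: B_def)
    qed
    then have "generate G (commutator_set G (L i) H) \<subseteq> B (Suc i)" using generate_subset_subgroup [OF B] by blast
    then show ?case by (simp add: L_def)
  qed
  then have Lp: "\<exists>n. pi_number \<pi> n \<and> x [^] n \<in> L (Suc i)" if "x \<in> L i" for x i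
    using that unfolding B_def by blast
  have "\<exists>n. pi_number \<pi> n \<and> x [^] n \<in> L i" for i
  proof (induction i)
    case 0
    have "x [^] (1::nat) \<in> L 0" using x HG by (simp add: L_def H_def)
    then show ?case using pi_number_1 by blast
  next
    case (Suc i)
    then obtain n where n: "pi_number \<pi> n" "x [^] n \<in> L i" by blast
    then obtain m where m: "pi_number \<pi> m" "(x [^] n) [^] m \<in> L (Suc i)" using Lp by blast
    have "x \<in> carrier G" using x HG by (simp add: H_def)
    then have "x [^] (n * m) \<in> L (Suc i)" using m by (simp add: nat_pow_pow)
    then show ?case using n m pi_number_mult by blast
  qed
  moreover obtain c where "L c = {\<one>}" using nil by (auto simp: nilpotent_subgroup_def L_def H_def)
  ultimately show ?thesis by (metis singletonD)
qed

text \<open>A product of two \<open>\<pi>\<close>-elements lies in the nilpotent subgroup that they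
  generate.\<close>

lemma pi_elements_subgroup:
  assumes "locally_nilpotent G R" shows "subgroup (pi_elements \<pi> R) G"
proof (rule subgroupI)
  have R: "subgroup R G" using assms by (simp add: locally_nilpotent_def)
  note RG = subgroup.mem_carrier [OF R]
  show "pi_elements \<pi> R \<subseteq> carrier G" using RG by (auto simp: pi_elements_def)
  show "pi_elements \<pi> R \<noteq> {}" using subgroup.one_closed [OF R] pi_number_1 [of \<pi>]
    by (auto simp: pi_elements_def intro!: exI [of _ \<one>] exI [of _ 1])
  fix x assume "x \<in> pi_elements \<pi> R"
  then obtain n where n: "x \<in> R" "pi_number \<pi> n" "x [^] n = \<one>" by (auto simp: pi_elements_def)
  then have "inv x [^] n = \<one>" using RG by (simp add: nat_pow_inv)
  then show "inv x \<in> pi_elements \<pi> R" using n R by (auto simp: pi_elements_def subgroup.m_inv_closed)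
next
  have R: "subgroup R G" using assms by (simp add: locally_nilpotent_def)
  note RG = subgroup.mem_carrier [OF R]
  fix x y assume xy: "x \<in> pi_elements \<pi> R" "y \<in> pi_elements \<pi> R"
  have xyR: "x \<in> R" "y \<in> R" using xy by (auto simp: pi_elements_def)
  have nil: "nilpotent_subgroup G (generate G {x, y})" using assms xyR by (simp add: locally_nilpotent_def)
  have "x \<otimes> y \<in> generate G {x, y}" by (intro generate.eng generate.incl) auto
  then have "\<exists>n. pi_number \<pi> n \<and> (x \<otimes> y) [^] n = \<one>"
    by (rule nilpotent_pi_elements [rotated 3]) (use nil xy xyR RG in \<open>auto simp: pi_elements_def\<close>)
  then show "x \<otimes> y \<in> pi_elements \<pi> R" using xyR R by (auto simp: pi_elements_def subgroup.m_closed)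
qed

lemma pi_elements_normalizes:
  assumes "normalizes K R" "K \<subseteq> carrier G" "R \<subseteq> carrier G"
  shows "normalizes K (pi_elements \<pi> R)"
  unfolding normalizes_def
proof (intro ballI)
  fix k x assume k: "k \<in> K" and "x \<in> pi_elements \<pi> R"
  then obtain n where n: "x \<in> R" "pi_number \<pi> n" "x [^] n = \<one>" by (auto simp: pi_elements_def)
  have "(k \<otimes> x \<otimes> inv k) [^] n = \<one>" using conj_pow [of x k n] n k assms by auto
  then show "k \<otimes> x \<otimes> inv k \<in> pi_elements \<pi> R" using n k assms by (auto simp: pi_elements_def normalizes_def)
qed

section \<open>Elements of coprime orders\<close>

lemma coprime_orders_component:
  assumes "a \<otimes> b = b \<otimes> a" "a [^] (m::nat) = \<one>" "b [^] n = \<one>" "coprime m n" "n > 0"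
    and "subgroup H G" "a \<otimes> b \<in> H" "a \<in> carrier G" "b \<in> carrier G"
  shows "a \<in> H"
proof -
  \<comment> \<open>The exponent \<open>n * u\<close> is 0 modulo \<open>n\<close> and 1 modulo
    \<open>m\<close>, so raising \<open>a \<otimes> b\<close> to it kills \<open>b\<close> and keeps
    \<open>a\<close>.\<close>
  obtain u v where uv: "n * u = m * v + 1" using bezout_nat [of n m] assms(4,5)
    by (auto simp: coprime_iff_gcd_eq_1 gcd.commute)
  have "(a \<otimes> b) [^] (n * u) = a [^] (n * u) \<otimes> b [^] (n * u)" using assms by (intro pow_mult_distrib)
  also have "b [^] (n * u) = \<one>" using pow_one_dvd [OF assms(3) _ assms(9)] by simp
  also have "a [^] (n * u) = a [^] (m * v) \<otimes> a" unfolding uv using assms by simp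
  also have "a [^] (m * v) = \<one>" using pow_one_dvd [OF assms(2) _ assms(8)] by simp
  finally have "(a \<otimes> b) [^] (n * u) = a" using assms by simp
  then show ?thesis using subgroup_nat_pow [OF assms(6,7), of "n * u"] by simp
qed

text \<open>Both factors are powers of \<open>x\<close> or inverses of such, with exponents from
  \<open>n * u = m * v + 1\<close>; hence they stay in every subgroup containing
  \<open>x\<close>.\<close>

lemma coprime_decomposition:
  assumes "x [^] (m * n :: nat) = \<one>" "coprime m n" "n > 0" "x \<in> carrier G" "subgroup H G" "x \<in> H"
  obtains a b where "x = a \<otimes> b" "a \<in> H" "b \<in> H" "a [^] m = \<one>" "b [^] n = \<one>"
proof -
  obtain u v where uv: "n * u = m * v + 1" using bezout_nat [of n m] assms(2,3)
    by (auto simp: coprime_iff_gcd_eq_1 gcd.commute)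
  have e: "x [^] (n * u) = x [^] (m * v) \<otimes> x" unfolding uv using assms by simp
  show thesis
  proof (rule that [of "x [^] (n * u)" "inv (x [^] (m * v))"])
    show "x = x [^] (n * u) \<otimes> inv (x [^] (m * v))"
      using e assms(4) nat_pow_Suc [of x "m * v"] nat_pow_Suc2 [OF assms(4), of "m * v"] by (simp add: m_assoc)
    show "x [^] (n * u) \<in> H" using subgroup_nat_pow assms by blast
    show "inv (x [^] (m * v)) \<in> H" using subgroup_nat_pow subgroup.m_inv_closed assms by metis
    have "x [^] (n * u * m) = \<one>" using pow_one_dvd [OF assms(1) _ assms(4), of "n * u * m"] by (simp add: mult_ac)
    then show "(x [^] (n * u)) [^] m = \<one>" using assms(4) by (simp add: nat_pow_pow)
    have "x [^] (m * v * n) = \<one>" using pow_one_dvd [OF assms(1) _ assms(4), of "m * v * n"] by (simp add: mult_ac)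
    then show "inv (x [^] (m * v)) [^] n = \<one>" using assms(4) by (simp add: nat_pow_inv nat_pow_pow)
  qed
qed

text \<open>Apply the recovery of a coprime factor to \<open>x\<close> and \<open>inv x\<close>,
  whose product lies in the trivial subgroup.\<close>

lemma pi_elements_Int:
  assumes "\<pi> \<inter> \<rho> = {}" "R \<subseteq> carrier G" "x \<in> pi_elements \<pi> R" "x \<in> pi_elements \<rho> R"
  shows "x = \<one>"
proof -
  obtain m n where mn: "pi_number \<pi> m" "x [^] m = \<one>" "pi_number \<rho> n" "x [^] n = \<one>"
    using assms by (auto simp: pi_elements_def)
  have "coprime m n" using pi_number_coprime mn assms(1) by blast
  then have "x \<in> {\<one>}"
    using mn assms coprime_orders_component [of x "inv x" m n "{\<one>}"] triv_subgroup
    by (auto simp: nat_pow_inv pi_elements_def pi_number_def)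
  then show ?thesis by simp
qed

text \<open>Both components are normal in \<open>R\<close>, so a commutator of their elements lies
  in both and is trivial.\<close>

lemma pi_elements_commute:
  assumes "locally_nilpotent G R" "\<pi> \<inter> \<rho> = {}"
  shows "commuting (pi_elements \<pi> R) (pi_elements \<rho> R)"
  unfolding commuting_def
proof (intro ballI)
  have R: "subgroup R G" using assms by (simp add: locally_nilpotent_def)
  note RG = subgroup.subset [OF R]
  note s = pi_elements_subgroup [OF assms(1)]
  note n = pi_elements_normalizes [OF normalizes_self [OF R] RG RG]
  fix a b assume ab: "a \<in> pi_elements \<pi> R" "b \<in> pi_elements \<rho> R"
  have abR: "a \<in> R" "b \<in> R" using ab by (auto simp: pi_elements_def)
  have c: "a \<in> carrier G" "b \<in> carrier G" using abR RG by auto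
  have "b \<otimes> inv a \<otimes> inv b \<in> pi_elements \<pi> R"
    using n [of \<pi>] abR(2) ab(1) s by (simp add: normalizes_def subgroup.m_inv_closed)
  then have "a \<otimes> (b \<otimes> inv a \<otimes> inv b) \<in> pi_elements \<pi> R" using s ab by (simp add: subgroup.m_closed)
  moreover have "a \<otimes> b \<otimes> inv a \<in> pi_elements \<rho> R" using n [of \<rho>] ab abR by (simp add: normalizes_def)
  then have "(a \<otimes> b \<otimes> inv a) \<otimes> inv b \<in> pi_elements \<rho> R" using s ab by (simp add: subgroup_mult_inv)
  ultimately have "(a \<otimes> b) \<otimes> inv a \<otimes> inv b = \<one>"
    using pi_elements_Int [OF assms(2) RG] c by (simp add: m_assoc)
  then have "a \<otimes> b \<otimes> inv a = b" using mult_inv_eqD [of "a \<otimes> b \<otimes> inv a" b \<one>] c by simp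
  then show "a \<otimes> b = b \<otimes> a" using mult_inv_eqD [of "a \<otimes> b" a b] c by simp
qed

section \<open>Ranks of primary components\<close>

lemma finite_set_enumeration:
  assumes "finite T" "card T \<le> r"
  obtains f :: "nat \<Rightarrow> 'a" where "T \<subseteq> f ` {..<r}" "f ` {..<r} \<subseteq> insert \<one> T"
proof -
  obtain h where h: "bij_betw h {0..<card T} T" using ex_bij_betw_nat_finite [OF assms(1)] by blast
  \<comment> \<open>Padding with \<one> gives exactly \<open>r\<close> indices, so that two
    generating sets of different size can be multiplied term by term.\<close>
  define f where "f i = (if i < card T then h i else \<one>)" for i
  have "T \<subseteq> f ` {..<r}"
  proof
    fix t assume "t \<in> T"
    then have "t \<in> h ` {0..<card T}" using h by (simp add: bij_betw_def)
    then obtain i where "i < card T" "t = h i" by auto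
    then show "t \<in> f ` {..<r}" using assms(2) by (intro image_eqI [of _ _ i]) (auto simp: f_def)
  qed
  moreover have "f ` {..<r} \<subseteq> insert \<one> T" using h by (auto simp: f_def bij_betw_def)
  ultimately show thesis using that by blast
qed

text \<open>Generators of the two coprime factors can be multiplied pairwise, since each
  factor is recovered from the product as a power of it.\<close>

lemma rank_at_most_coprime_union:
  assumes R: "locally_nilpotent G R" and dj: "\<pi> \<inter> \<rho> = {}"
    and r: "rank_at_most r (pi_elements \<pi> R)" "rank_at_most r (pi_elements \<rho> R)"
  shows "rank_at_most r (pi_elements (\<pi> \<union> \<rho>) R)"
  unfolding rank_at_most_def
proof (intro allI impI)
  let ?P = "pi_elements \<pi> R" and ?Q = "pi_elements \<rho> R" and ?U = "pi_elements (\<pi> \<union> \<rho>) R"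
  note s = pi_elements_subgroup [OF R]
  note UG = subgroup.mem_carrier [OF s, of _ "\<pi> \<union> \<rho>"]
  have PU: "?P \<subseteq> ?U" "?Q \<subseteq> ?U"
    using pi_number_mono [of \<pi> _ "\<pi> \<union> \<rho>"] pi_number_mono [of \<rho> _ "\<pi> \<union> \<rho>"] by (auto simp: pi_elements_def)
  fix S assume S: "finite S \<and> S \<subseteq> ?U"
  have SG: "S \<subseteq> carrier G" using S UG by blast
  have gS: "subgroup (generate G S) G" using SG by (rule generate_is_subgroup)
  \<comment> \<open>The factors are taken inside \<open>generate G S\<close>, so that generators of
    the two parts generate no more than \<open>S\<close> does.\<close>
  have "\<exists>a b. x = a \<otimes> b \<and> a \<in> ?P \<inter> generate G S \<and> b \<in> ?Q \<inter> generate G S" if x: "x \<in> S" for x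
  proof -
    have xU: "x \<in> ?U" "x \<in> carrier G" using x S SG by auto
    then obtain n where n: "pi_number (\<pi> \<union> \<rho>) n" "x [^] n = \<one>" "x \<in> R" by (auto simp: pi_elements_def)
    then obtain k l where kl: "n = k * l" "pi_number \<pi> k" "pi_number \<rho> l" using pi_number_union by blast
    have cop: "coprime k l" "l > 0" using pi_number_coprime [OF kl(2,3) dj] kl(3) by (auto simp: pi_number_def)
    have H: "subgroup (R \<inter> generate G S) G"
      using R gS subgroups_Inter_pair by (simp add: locally_nilpotent_def)
    have xH: "x \<in> R \<inter> generate G S" using n x by (simp add: generate.incl)
    have x1: "x [^] (k * l) = \<one>" using n kl by simp
    obtain a b where "x = a \<otimes> b" "a \<in> R \<inter> generate G S" "b \<in> R \<inter> generate G S" "a [^] k = \<one>" "b [^] l = \<one>"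
      using coprime_decomposition [OF x1 cop xU(2) H xH] .
    then show ?thesis using kl by (intro exI [of _ a] exI [of _ b]) (auto simp: pi_elements_def)
  qed
  then obtain a b where ab: "\<And>x. x \<in> S \<Longrightarrow> x = a x \<otimes> b x \<and> a x \<in> ?P \<inter> generate G S \<and> b x \<in> ?Q \<inter> generate G S"
    by metis
  have S1: "finite (a ` S)" "a ` S \<subseteq> ?P" "a ` S \<subseteq> generate G S" using S ab by auto
  have S2: "finite (b ` S)" "b ` S \<subseteq> ?Q" "b ` S \<subseteq> generate G S" using S ab by auto
  obtain T1 where T1: "finite T1" "T1 \<subseteq> ?P" "card T1 \<le> r" "generate G T1 = generate G (a ` S)"
    using rank_at_mostE [OF r(1) S1(1,2)] .
  obtain T2 where T2: "finite T2" "T2 \<subseteq> ?Q" "card T2 \<le> r" "generate G T2 = generate G (b ` S)"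
    using rank_at_mostE [OF r(2) S2(1,2)] .
  obtain f where f: "T1 \<subseteq> f ` {..<r}" "f ` {..<r} \<subseteq> insert \<one> T1" using finite_set_enumeration [OF T1(1,3)] .
  obtain g where g: "T2 \<subseteq> g ` {..<r}" "g ` {..<r} \<subseteq> insert \<one> T2" using finite_set_enumeration [OF T2(1,3)] .
  define T where "T = (\<lambda>i. f i \<otimes> g i) ` {..<r}"
  have fP: "f i \<in> ?P" "f i \<in> generate G T1" if "i < r" for i
  proof -
    have "f i \<in> insert \<one> T1" using f that by blast
    then show "f i \<in> ?P" "f i \<in> generate G T1" using T1(2) subgroup.one_closed [OF s]
      by (auto intro: generate.intros)
  qed
  have gQ: "g i \<in> ?Q" "g i \<in> generate G T2" if "i < r" for i
  proof -
    have "g i \<in> insert \<one> T2" using g that by blast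
    then show "g i \<in> ?Q" "g i \<in> generate G T2" using T2(2) subgroup.one_closed [OF s]
      by (auto intro: generate.intros)
  qed
  have fgS: "f i \<in> generate G S" "g i \<in> generate G S" if "i < r" for i
    using fP(2) [OF that] gQ(2) [OF that] T1(4) T2(4)
      generate_subset_subgroup [OF gS S1(3)] generate_subset_subgroup [OF gS S2(3)] by auto
  have TS: "T \<subseteq> generate G S" using fgS by (auto simp: T_def intro: generate.eng)
  have TU: "T \<subseteq> ?U"
  proof
    fix t assume "t \<in> T"
    then obtain i where i: "i < r" "t = f i \<otimes> g i" by (auto simp: T_def)
    have "f i \<in> ?U" "g i \<in> ?U" using fP(1) [OF i(1)] gQ(1) [OF i(1)] PU by auto
    then show "t \<in> ?U" unfolding i(2) by (rule subgroup.m_closed [OF s])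
  qed
  have TG: "T \<subseteq> carrier G" using TU UG by blast
  have gT: "subgroup (generate G T) G" using TG by (rule generate_is_subgroup)
  have fgT: "f i \<in> generate G T \<and> g i \<in> generate G T" if i: "i < r" for i
  proof -
    have P: "f i \<in> ?P" "g i \<in> ?Q" using fP gQ i by auto
    then have c: "f i \<in> carrier G" "g i \<in> carrier G" using PU UG by auto
    obtain m where m: "pi_number \<pi> m" "f i [^] m = \<one>" using P by (auto simp: pi_elements_def)
    obtain n where n: "pi_number \<rho> n" "g i [^] n = \<one>" using P by (auto simp: pi_elements_def)
    have cop: "coprime m n" "n > 0" using pi_number_coprime [OF m(1) n(1) dj] n by (auto simp: pi_number_def)
    have fg: "f i \<otimes> g i = g i \<otimes> f i" using pi_elements_commute [OF R dj] P unfolding commuting_def by blast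
    have t: "f i \<otimes> g i \<in> generate G T" using i by (auto simp: T_def intro: generate.incl)
    have "f i \<in> generate G T" using coprime_orders_component [OF fg m(2) n(2) cop gT t c] .
    then show ?thesis using subgroup_memI [OF gT t c] by simp
  qed
  have "T1 \<subseteq> generate G T" "T2 \<subseteq> generate G T" using f g fgT by blast+
  then have "generate G (a ` S) \<subseteq> generate G T" "generate G (b ` S) \<subseteq> generate G T"
    unfolding T1(4) [symmetric] T2(4) [symmetric] by (auto dest: generate_subset_subgroup [OF gT])
  then have abT: "a x \<in> generate G T \<and> b x \<in> generate G T" if "x \<in> S" for x
    using that generate.incl [of "a x" "a ` S"] generate.incl [of "b x" "b ` S"] by blast
  have "x \<in> generate G T" if x: "x \<in> S" for x
  proof -
    have "a x \<otimes> b x \<in> generate G T" using abT [OF x] by (intro generate.eng) auto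
    then show ?thesis using ab [OF x] by simp
  qed
  then have "generate G T = generate G S"
    using generate_subset_subgroup [OF gT, of S] generate_subset_subgroup [OF gS TS] by blast
  moreover have "card T \<le> r" "finite T" using card_image_le [of "{..<r}"] by (auto simp: T_def)
  ultimately show "\<exists>T. finite T \<and> T \<subseteq> ?U \<and> card T \<le> r \<and> generate G T = generate G S" using TU by blast
qed

text \<open>A finite subset involves only finitely many primes, and by induction on their number the
  coprime union keeps the bound \<open>r\<close>.\<close>

lemma rank_at_most_of_primary_components:
  assumes R: "locally_nilpotent G R" and per: "periodic_group G"
    and r: "\<And>p. Factorial_Ring.prime p \<Longrightarrow> rank_at_most r (pi_elements {p} R)"
  shows "rank_at_most r R"
  unfolding rank_at_most_def
proof (intro allI impI)
  have sR: "subgroup R G" using R by (simp add: locally_nilpotent_def)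
  note RG = subgroup.mem_carrier [OF sR]
  have fin: "rank_at_most r (pi_elements \<pi> R)" if "finite \<pi>" "\<And>q. q \<in> \<pi> \<Longrightarrow> Factorial_Ring.prime q" for \<pi>
    using that
  proof (induction \<pi> rule: finite_induct)
    case empty
    have "pi_elements {} R \<subseteq> {\<one>}"
    proof
      fix x assume "x \<in> pi_elements {} R"
      then obtain n where n: "x \<in> R" "pi_number {} n" "x [^] n = \<one>" by (auto simp: pi_elements_def)
      have "n = 1" using n(2) prime_factor_nat [of n] by (auto simp: pi_number_def)
      then show "x \<in> {\<one>}" using n RG [of x] by simp
    qed
    then have "generate G {} = generate G S" if "S \<subseteq> pi_elements {} R" for S
      using that generate_subset_subgroup [OF triv_subgroup, of S] generate_empty generate.one [of G S] by auto
    then show ?case unfolding rank_at_most_def by (intro allI impI exI [of _ "{}"]) auto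
  next
    case (insert q \<pi>)
    then show ?case using rank_at_most_coprime_union [OF R, of "{q}" \<pi> r] r by simp
  qed
  fix S assume S: "finite S \<and> S \<subseteq> R"
  define n where "n = (\<Prod>x\<in>S. ord x)"
  have ordp: "ord x > 0" if "x \<in> S" for x
    using per S RG that by (auto simp: periodic_group_def)
  then have n0: "n > 0" using S by (simp add: n_def)
  define \<pi> where "\<pi> = {q. Factorial_Ring.prime q \<and> q dvd n}"
  have "\<pi> \<subseteq> {..n}" using n0 by (auto simp: \<pi>_def intro: dvd_imp_le)
  then have "finite \<pi>" using finite_subset by blast
  then have rk: "rank_at_most r (pi_elements \<pi> R)" using fin by (auto simp: \<pi>_def)
  have "S \<subseteq> pi_elements \<pi> R"
  proof
    fix x assume x: "x \<in> S"
    have "ord x dvd n" unfolding n_def using x S by (intro dvd_prodI) auto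
    then have "pi_number \<pi> (ord x)" using ordp [OF x] by (auto simp: pi_number_def \<pi>_def)
    moreover have "x [^] ord x = \<one>" using x S RG by (auto intro: pow_ord_eq_1)
    ultimately show "x \<in> pi_elements \<pi> R" using x S by (auto simp: pi_elements_def)
  qed
  then obtain T where "finite T" "T \<subseteq> pi_elements \<pi> R" "card T \<le> r" "generate G T = generate G S"
    using rank_at_mostE [OF rk] S by metis
  then show "\<exists>T. finite T \<and> T \<subseteq> R \<and> card T \<le> r \<and> generate G T = generate G S"
    by (intro exI [of _ T]) (auto simp: pi_elements_def)
qed

text \<open>The ranks of the components are unbounded beyond every \<open>m\<close>, which gives a
  strictly increasing sequence \<open>f\<close> such that the component of \<open>f n\<close> is not
  of rank at most \<open>n\<close>. The even and the odd terms form the two sets.\<close>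

lemma disjoint_infinite_rank_components:
  assumes R: "locally_nilpotent G R" and per: "periodic_group G" and inf: "\<not> finite_rank G R"
    and fr: "\<And>p. Factorial_Ring.prime p \<Longrightarrow> finite_rank G (pi_elements {p} R)"
  obtains \<pi> \<rho> where "\<pi> \<inter> \<rho> = {}" "\<not> finite_rank G (pi_elements \<pi> R)" "\<not> finite_rank G (pi_elements \<rho> R)"
proof -
  have ex: "\<exists>p>m. \<not> rank_at_most r (pi_elements {p} R)" for m r
  proof (rule ccontr)
    assume "\<not> (\<exists>p>m. \<not> rank_at_most r (pi_elements {p} R))"
    then have big: "rank_at_most r (pi_elements {p} R)" if "p > m" for p using that by blast
    have "\<forall>p. \<exists>s. Factorial_Ring.prime p \<longrightarrow> rank_at_most s (pi_elements {p} R)"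
      using fr by (auto simp: finite_rank_iff)
    then obtain s where s: "\<And>p. Factorial_Ring.prime p \<Longrightarrow> rank_at_most (s p) (pi_elements {p} R)" by metis
    \<comment> \<open>A common bound for all components: \<open>r\<close> beyond \<open>m\<close>,
      and the maximum of the finitely many individual bounds up to \<open>m\<close>.\<close>
    define t where "t = Max (insert r (s ` {..m}))"
    have t: "r \<le> t" "p \<le> m \<Longrightarrow> s p \<le> t" for p unfolding t_def by (auto intro!: Max_ge simp del: Max_insert)
    have "rank_at_most t (pi_elements {p} R)" if p: "Factorial_Ring.prime p" for p
    proof (cases "p \<le> m")
      case True then show ?thesis using rank_at_most_le [OF s [OF p] t(2)] by simp
    next
      case False then show ?thesis using rank_at_most_le [OF big t(1)] by simp
    qed
    then have "rank_at_most t R" by (rule rank_at_most_of_primary_components [OF R per])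
    then show False using inf by (auto simp: finite_rank_iff)
  qed
  have "\<exists>f. \<forall>n. \<not> rank_at_most n (pi_elements {f n} R) \<and> f n < f (Suc n)"
    by (rule dependent_nat_choice) (use ex in blast)+
  then obtain f where f: "\<And>n. \<not> rank_at_most n (pi_elements {f n} R)" "\<And>n. f n < f (Suc n)" by blast
  have "strict_mono f" using f(2) by (simp add: strict_mono_Suc_iff)
  then have inj: "f i = f j \<longleftrightarrow> i = j" for i j by (simp add: strict_mono_eq)
  have no: "\<not> finite_rank G (pi_elements \<pi> R)" if large: "\<And>n. \<exists>k\<ge>n. f k \<in> \<pi>" for \<pi>
  proof
    assume "finite_rank G (pi_elements \<pi> R)"
    then obtain r where r: "rank_at_most r (pi_elements \<pi> R)" by (auto simp: finite_rank_iff)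
    obtain k where k: "k \<ge> r" "f k \<in> \<pi>" using large by blast
    have "pi_elements {f k} R \<subseteq> pi_elements \<pi> R"
      using pi_number_mono [of "{f k}" _ \<pi>] k(2) by (auto simp: pi_elements_def)
    then have "rank_at_most r (pi_elements {f k} R)"
      using rank_at_most_mono [OF r _ pi_elements_subgroup [OF R]] by blast
    then show False using rank_at_most_le k(1) f(1) by blast
  qed
  show thesis
  proof (rule that [of "range (\<lambda>n. f (2 * n))" "range (\<lambda>n. f (2 * n + 1))"])
    show "range (\<lambda>n. f (2 * n)) \<inter> range (\<lambda>n. f (2 * n + 1)) = {}" by (auto simp: inj) presburger
    show "\<not> finite_rank G (pi_elements (range (\<lambda>n. f (2 * n))) R)"
      by (rule no, rule_tac x = "2 * n" in exI) auto
    show "\<not> finite_rank G (pi_elements (range (\<lambda>n. f (2 * n + 1))) R)"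
      by (rule no, rule_tac x = "2 * n + 1" in exI) auto
  qed
qed

section \<open>Elementary abelian groups\<close>

context
  fixes V :: "'a set" and p :: nat
  assumes V: "subgroup V G" and comm: "commuting V V" and exp: "\<And>v. v \<in> V \<Longrightarrow> v [^] p = \<one>"
    and p: "Factorial_Ring.prime p"
begin

lemma pow_mod_exponent:
  assumes "v \<in> V" shows "v [^] (n::nat) = v [^] (n mod p)"
proof -
  have c: "v \<in> carrier G" using subgroup.mem_carrier [OF V assms] .
  have "v [^] n = v [^] (p * (n div p)) \<otimes> v [^] (n mod p)" using c by (simp add: nat_pow_mult)
  also have "v [^] (p * (n div p)) = \<one>" using pow_one_dvd [OF exp [OF assms] _ c] by simp
  finally show ?thesis using c by simp
qed

text \<open>\<open>B\<close> is the subgroup generated by \<open>A\<close> and \<open>v\<close>.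
  Exponents are reduced below \<open>p\<close>, so that it has at most \<open>p\<close> times as
  many elements as a finite \<open>A\<close>.\<close>

lemma adjoin_subgroup:
  assumes A: "subgroup A G" "A \<subseteq> V" and v: "v \<in> V"
  defines "B \<equiv> (\<lambda>(a, i). a \<otimes> v [^] i) ` (A \<times> {..<p})"
  shows "subgroup B G" "A \<subseteq> B" "v \<in> B" "B \<subseteq> V"
proof -
  note VG = subgroup.mem_carrier [OF V]
  have p0: "p > 1" using prime_gt_1_nat [OF p] .
  have BI: "a \<otimes> v [^] i \<in> B" if "a \<in> A" for a and i :: nat
    unfolding B_def using that pow_mod_exponent [OF v, of i] p0
    by (intro image_eqI [of _ _ "(a, i mod p)"]) auto
  have BE: "\<exists>a\<in>A. \<exists>i::nat. x = a \<otimes> v [^] i" if "x \<in> B" for x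
    using that unfolding B_def by auto
  show BV: "B \<subseteq> V" using A(2) v subgroup_nat_pow [OF V] subgroup.m_closed [OF V] by (auto simp: B_def)
  have "a \<in> B" if "a \<in> A" for a using BI [OF that, of 0] that A(2) VG by auto
  then show AB: "A \<subseteq> B" by blast
  have "\<one> \<otimes> v [^] (1::nat) \<in> B" using BI [OF subgroup.one_closed [OF A(1)]] .
  then show "v \<in> B" using v VG by simp
  have mult: "x \<otimes> y \<in> B" if xy: "x \<in> B" "y \<in> B" for x y
  proof -
    obtain a i where a: "a \<in> A" "x = a \<otimes> v [^] (i::nat)" using BE [OF xy(1)] by blast
    obtain b j where b: "b \<in> A" "y = b \<otimes> v [^] (j::nat)" using BE [OF xy(2)] by blast
    have c: "a \<in> carrier G" "b \<in> carrier G" "v \<in> carrier G" using a b v A(2) VG by auto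
    have "v [^] i \<in> V" "b \<in> V" using b v A(2) subgroup_nat_pow [OF V] by auto
    then have e: "v [^] i \<otimes> b = b \<otimes> v [^] i" using comm unfolding commuting_def by blast
    have "x \<otimes> y = a \<otimes> (v [^] i \<otimes> b) \<otimes> v [^] j" using a b c by (simp add: m_assoc)
    also have "\<dots> = (a \<otimes> b) \<otimes> v [^] (i + j)" unfolding e using c by (simp add: m_assoc nat_pow_mult)
    finally show ?thesis using BI [OF subgroup.m_closed [OF A(1) a(1) b(1)]] by simp
  qed
  have one: "\<one> \<in> B" using AB subgroup.one_closed [OF A(1)] by blast
  have pw: "x [^] n \<in> B" if "x \<in> B" for x and n :: nat
    by (induction n) (use one mult that in auto)
  have inv: "inv x \<in> B" if x: "x \<in> B" for x
  proof -
    have c: "x \<in> V" "x \<in> carrier G" using x BV VG by auto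
    have "x [^] (p - 1) \<otimes> x = x [^] p" using p0 c by (metis Suc_diff_1 less_trans nat_pow_Suc zero_less_one)
    then have "x [^] (p - 1) = inv x" using exp [OF c(1)] c by (intro inv_equality [symmetric]) auto
    then show ?thesis using pw [OF x, of "p - 1"] by simp
  qed
  show "subgroup B G" by (rule subgroupI) (use BV VG one inv mult in auto)
qed

lemma finite_subgroup_generated:
  assumes "finite T" "T \<subseteq> V"
  shows "finite (generate G T) \<and> card (generate G T) \<le> p ^ card T"
  using assms
proof (induction T rule: finite_induct)
  case empty
  then show ?case by (simp add: generate_empty)
next
  case (insert v T)
  note VG = subgroup.mem_carrier [OF V]
  let ?A = "generate G T"
  have A: "subgroup ?A G" "?A \<subseteq> V"
    using insert.prems subgroup.subset [OF V] generate_is_subgroup [of T] generate_subset_subgroup [OF V, of T] by auto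
  let ?B = "(\<lambda>(a, i). a \<otimes> v [^] i) ` (?A \<times> {..<p})"
  have v: "v \<in> V" using insert.prems by auto
  note B = adjoin_subgroup [OF A v]
  have "insert v T \<subseteq> ?B" using B(2,3) generate.incl [of _ T] by blast
  then have sub: "generate G (insert v T) \<subseteq> ?B" using generate_subset_subgroup [OF B(1)] by blast
  have fB: "finite ?B" using insert by simp
  have "card ?B \<le> card (?A \<times> {..<p})" using insert by (intro card_image_le) simp
  also have "\<dots> \<le> p ^ card (insert v T)" using insert by (simp add: card_cartesian_product mult.commute)
  finally show ?case using sub fB card_mono finite_subset by (meson order_trans)
qed

text \<open>A subgroup of \<open>V\<close> with \<open>r\<close> generators has at most
  \<open>p ^ r\<close> elements, so it cannot contain a set of \<open>p ^ r + 1\<close>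
  elements.\<close>

lemma elementary_finite_rank_finite:
  assumes "finite_rank G V" shows "finite V"
proof (rule ccontr)
  assume inf: "infinite V"
  obtain r where r: "rank_at_most r V" using assms by (auto simp: finite_rank_iff)
  obtain S where S: "S \<subseteq> V" "finite S" "card S = Suc (p ^ r)"
    using infinite_arbitrarily_large [OF inf] by blast
  obtain T where T: "finite T" "T \<subseteq> V" "card T \<le> r" "generate G T = generate G S"
    using rank_at_mostE [OF r S(2,1)] .
  have "card S \<le> card (generate G S)"
    using finite_subgroup_generated [OF S(2,1)] by (intro card_mono) (auto intro: generate.incl)
  also have "\<dots> \<le> p ^ card T" using finite_subgroup_generated [OF T(1,2)] T(4) by simp
  also have "\<dots> \<le> p ^ r" using T(3) prime_gt_0_nat [OF p] by (intro power_increasing) auto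
  finally show False using S(3) by simp
qed

text \<open>Adjoin to \<open>A\<close> an element \<open>v\<close> outside the finite set of
  products of \<open>A\<close> and \<open>B\<close>. If \<open>a \<otimes> v [^] i\<close> were in
  \<open>B\<close> with \<open>0 < i < p\<close>, then \<open>v\<close>, being a power of
  \<open>v [^] i\<close>, would be such a product.\<close>

lemma enlarge_disjoint:
  assumes inf: "infinite V" and A: "subgroup A G" "A \<subseteq> V" "finite A" and B: "subgroup B G" "B \<subseteq> V" "finite B"
    and AB: "A \<inter> B = {\<one>}"
  shows "\<exists>A'. subgroup A' G \<and> A' \<subseteq> V \<and> finite A' \<and> A \<subset> A' \<and> A' \<inter> B = {\<one>}"
proof -
  note VG = subgroup.mem_carrier [OF V]
  let ?C = "(\<lambda>(a, b). a \<otimes> b) ` (A \<times> B)"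
  have "finite ?C" using A B by simp
  then obtain v where v: "v \<in> V" "v \<notin> ?C" using inf by (metis finite_subset subsetI)
  let ?A = "(\<lambda>(a, i). a \<otimes> v [^] i) ` (A \<times> {..<p})"
  note A' = adjoin_subgroup [OF A(1,2) v(1)]
  have vc: "v \<in> carrier G" using v VG by auto
  have "v \<notin> A"
  proof
    assume "v \<in> A"
    then have "v \<otimes> \<one> \<in> ?C" using subgroup.one_closed [OF B(1)] by blast
    then show False using v vc by simp
  qed
  then have "A \<subset> ?A" using A'(2,3) by blast
  moreover have "x = \<one>" if x: "x \<in> ?A" "x \<in> B" for x
  proof -
    obtain a i where ai: "a \<in> A" "i < p" "x = a \<otimes> v [^] i" using x(1) by auto
    have aV: "a \<in> V" "x \<in> V" using ai(1) A(2) x(2) B(2) by auto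
    have ac: "a \<in> carrier G" "x \<in> carrier G" using aV VG by auto
    have vi: "v [^] i = inv a \<otimes> x" using ai ac vc by simp
    have "i = 0"
    proof (rule ccontr)
      assume "i \<noteq> 0"
      then have "\<not> p dvd i" using ai(2) by (simp add: nat_dvd_not_less)
      then have "coprime i p" using prime_imp_coprime [OF p] coprime_commute by blast
      then obtain u w where uw: "i * u = p * w + 1" using bezout_nat [of i p] \<open>i \<noteq> 0\<close>
        by (auto simp: coprime_iff_gcd_eq_1)
      have "v [^] (i * u) = v [^] (p * w) \<otimes> v" unfolding uw using vc by simp
      also have "v [^] (p * w) = \<one>" using pow_one_dvd [OF exp [OF v(1)] _ vc] by simp
      finally have "v = (v [^] i) [^] u" using vc by (simp add: nat_pow_pow)
      also have "\<dots> = (inv a) [^] u \<otimes> x [^] u"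
        unfolding vi using commuting_pow_distrib [OF V comm subgroup.m_inv_closed [OF V aV(1)] aV(2)] .
      finally have "v = (inv a) [^] u \<otimes> x [^] u" .
      moreover have "(inv a) [^] u \<in> A" using ai A(1) by (simp add: subgroup.m_inv_closed subgroup_nat_pow)
      moreover have "x [^] u \<in> B" using x(2) subgroup_nat_pow [OF B(1)] by blast
      ultimately have "v \<in> ?C" by blast
      then show False using v by simp
    qed
    then have "x = a" using ai ac by simp
    then show "x = \<one>" using ai x AB by blast
  qed
  then have "?A \<inter> B = {\<one>}"
    using subgroup.one_closed [OF A'(1)] subgroup.one_closed [OF B(1)] by blast
  moreover have "finite ?A" using A(3) by simp
  ultimately show ?thesis using A' by blast
qed

lemma strict_chain_union:
  assumes A: "\<And>n::nat. subgroup (A n) G \<and> A n \<subseteq> V \<and> finite (A n)" "\<And>n. A n \<subset> A (Suc n)"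
  shows "subgroup (\<Union>n. A n) G" "(\<Union>n. A n) \<subseteq> V" "infinite (\<Union>n. A n)" "\<And>m n. m \<le> n \<Longrightarrow> A m \<subseteq> A n"
proof -
  show mono: "A m \<subseteq> A n" if "m \<le> n" for m n
    using that A(2) by (meson lift_Suc_mono_le psubset_imp_subset)
  show sub: "(\<Union>n. A n) \<subseteq> V" using A(1) by blast
  show "subgroup (\<Union>n. A n) G"
  proof (rule subgroupI)
    show "(\<Union>n. A n) \<subseteq> carrier G" using sub subgroup.subset [OF V] by blast
    show "(\<Union>n. A n) \<noteq> {}" using A(1) subgroup.one_closed by blast
    fix x assume "x \<in> (\<Union>n. A n)"
    then obtain n where "x \<in> A n" by blast
    then have "inv x \<in> A n" using A(1) [of n] by (simp add: subgroup.m_inv_closed)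
    then show "inv x \<in> (\<Union>n. A n)" by blast
  next
    fix x y assume "x \<in> (\<Union>n. A n)" "y \<in> (\<Union>n. A n)"
    then obtain m n where "x \<in> A m" "y \<in> A n" by blast
    then have "x \<in> A (max m n)" "y \<in> A (max m n)" using mono [of m "max m n"] mono [of n "max m n"] by auto
    then have "x \<otimes> y \<in> A (max m n)" using A(1) [of "max m n"] by (simp add: subgroup.m_closed)
    then show "x \<otimes> y \<in> (\<Union>n. A n)" by blast
  qed
  have "n \<le> card (A n)" for n
  proof (induction n)
    case (Suc n)
    have "card (A n) < card (A (Suc n))" using A by (intro psubset_card_mono) auto
    then show ?case using Suc by simp
  qed simp
  note large = this
  show "infinite (\<Union>n. A n)"
  proof
    assume f: "finite (\<Union>n. A n)"
    have "Suc (card (\<Union>n. A n)) \<le> card (A (Suc (card (\<Union>n. A n))))" by (rule large)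
    also have "\<dots> \<le> card (\<Union>n. A n)" using f by (intro card_mono) blast+
    finally show False by simp
  qed
qed

text \<open>Starting from two trivial subgroups, enlarge both in each step, keeping the intersection
  trivial, and take unions.\<close>

lemma infinite_disjoint_subgroups:
  assumes inf: "infinite V"
  obtains A B where "subgroup A G" "A \<subseteq> V" "infinite A" "subgroup B G" "B \<subseteq> V" "infinite B" "A \<inter> B = {\<one>}"
proof -
  define P where "P = (\<lambda>(A, B). subgroup A G \<and> A \<subseteq> V \<and> finite A \<and> subgroup B G \<and> B \<subseteq> V \<and> finite B \<and> A \<inter> B = {\<one>})"
  define Q where "Q = (\<lambda>(A::'a set, B::'a set) (A', B'). A \<subset> A' \<and> B \<subset> B')"
  have "\<exists>f. \<forall>n::nat. P (f n) \<and> Q (f n) (f (Suc n))"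
  proof (rule dependent_nat_choice)
    have "P ({\<one>}, {\<one>})" using triv_subgroup subgroup.one_closed [OF V] by (simp add: P_def)
    then show "\<exists>x. P x" by blast
    fix x n assume "P x"
    then obtain A B where x: "x = (A, B)" and AB: "subgroup A G" "A \<subseteq> V" "finite A" "subgroup B G" "B \<subseteq> V" "finite B" "A \<inter> B = {\<one>}"
      by (cases x) (auto simp: P_def)
    obtain A' where A': "subgroup A' G" "A' \<subseteq> V" "finite A'" "A \<subset> A'" "A' \<inter> B = {\<one>}"
      using enlarge_disjoint [OF inf AB] by blast
    have BA: "B \<inter> A' = {\<one>}" using A'(5) by blast
    obtain B' where B': "subgroup B' G" "B' \<subseteq> V" "finite B'" "B \<subset> B'" "B' \<inter> A' = {\<one>}"
      using enlarge_disjoint [OF inf AB(4-6) A'(1-3) BA] by blast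
    have "A' \<inter> B' = {\<one>}" using B'(5) by blast
    then have "P (A', B')" using A' B' by (simp add: P_def)
    moreover have "Q x (A', B')" using A' B' x by (simp add: Q_def)
    ultimately show "\<exists>y. P y \<and> Q x y" by blast
  qed
  then obtain f where f: "\<And>n::nat. P (f n)" "\<And>n. Q (f n) (f (Suc n))" by blast
  define A where "A n = fst (f n)" for n
  define B where "B n = snd (f n)" for n
  have A: "subgroup (A n) G \<and> A n \<subseteq> V \<and> finite (A n)" "A n \<subset> A (Suc n)"
    and B: "subgroup (B n) G \<and> B n \<subseteq> V \<and> finite (B n)" "B n \<subset> B (Suc n)" and AB: "A n \<inter> B n = {\<one>}" for n
    using f(1) [of n] f(2) [of n] by (auto simp: P_def Q_def A_def B_def split: prod.splits)
  note UA = strict_chain_union [of A, OF A] note UB = strict_chain_union [of B, OF B]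
  have "x = \<one>" if x: "x \<in> (\<Union>n. A n)" "x \<in> (\<Union>n. B n)" for x
  proof -
    obtain m n where "x \<in> A m" "x \<in> B n" using x by blast
    then have "x \<in> A (max m n)" "x \<in> B (max m n)"
      using UA(4) [of m "max m n"] UB(4) [of n "max m n"] by auto
    then show ?thesis using AB by blast
  qed
  then have "(\<Union>n. A n) \<inter> (\<Union>n. B n) = {\<one>}"
    using subgroup.one_closed [OF UA(1)] subgroup.one_closed [OF UB(1)] by blast
  then show thesis using that [OF UA(1-3) UB(1-3)] by blast
qed

end

section \<open>Products with normal subgroups\<close>

lemma set_mult_normal_subgroup:
  assumes "subgroup H G" "N \<lhd> G" shows "subgroup (H <#> N) G"
  using mult_norm_subgroup [OF assms(2,1)] commut_normal [OF assms] by simp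

lemma subset_set_mult:
  assumes "subgroup H G" "subgroup N G" shows "H \<subseteq> H <#> N" "N \<subseteq> H <#> N"
proof -
  have "h \<otimes> \<one> \<in> H <#> N" if "h \<in> H" for h using that subgroup.one_closed [OF assms(2)] by (auto simp: set_mult_def)
  then show "H \<subseteq> H <#> N" using subgroup.mem_carrier [OF assms(1)] by (metis r_one subsetI)
  have "\<one> \<otimes> n \<in> H <#> N" if "n \<in> N" for n using that subgroup.one_closed [OF assms(1)] by (auto simp: set_mult_def)
  then show "N \<subseteq> H <#> N" using subgroup.mem_carrier [OF assms(2)] by (metis l_one subsetI)
qed

text \<open>Multiply every term of the subnormal series by \<open>N\<close>.\<close>

lemma subnormal_set_mult_normal:
  assumes "subnormal G H" and N: "N \<lhd> G" shows "subnormal G (H <#> N)"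
  using assms(1)
proof (induction rule: subnormal.induct)
  case top
  have "carrier G <#> N = carrier G"
    using subset_set_mult(1) [OF subgroup_self normal_imp_subgroup [OF N]]
      subgroup.subset [OF set_mult_normal_subgroup [OF subgroup_self N]] by blast
  then show ?case using subnormal.top [of G] by simp
next
  case (step K H)
  have K: "subgroup K G" using step.hyps(1) by (rule subnormal_subgroup)
  have sN: "subgroup N G" using normal_imp_subgroup [OF N] .
  note nK = normal_restrictD [OF step.hyps(3) K]
  note nN = normal_imp_normalizes [OF N]
  show ?case
  proof (rule subnormal_stepI [OF step.IH set_mult_normal_subgroup [OF step.hyps(2) N]])
    show "H <#> N \<subseteq> K <#> N" using nK(2) by (auto simp: set_mult_def)
    show "normalizes (K <#> N) (H <#> N)" unfolding normalizes_def
    proof (intro ballI)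
      fix x y assume "x \<in> K <#> N" "y \<in> H <#> N"
      then obtain k n h m where kn: "k \<in> K" "n \<in> N" "x = k \<otimes> n" "h \<in> H" "m \<in> N" "y = h \<otimes> m"
        by (auto simp: set_mult_def)
      have c: "k \<in> carrier G" "n \<in> carrier G" "h \<in> carrier G" "m \<in> carrier G"
        using kn subgroup.mem_carrier [OF K] subgroup.mem_carrier [OF sN] subgroup.mem_carrier [OF step.hyps(2)] by auto
      \<comment> \<open>The factor in \<open>N\<close> that remains when the conjugate of
        \<open>h \<otimes> m\<close> by \<open>k \<otimes> n\<close> is divided on the left by that
        of \<open>h\<close> by \<open>k\<close>.\<close>
      let ?u = "k \<otimes> ((inv h \<otimes> n \<otimes> inv (inv h)) \<otimes> m \<otimes> inv n) \<otimes> inv k"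
      have "inv h \<otimes> n \<otimes> inv (inv h) \<in> N" using nN c kn unfolding normalizes_def by blast
      then have "(inv h \<otimes> n \<otimes> inv (inv h)) \<otimes> m \<otimes> inv n \<in> N"
        using kn sN by (simp add: subgroup.m_closed subgroup.m_inv_closed)
      then have "?u \<in> N" using nN c unfolding normalizes_def by blast
      moreover have "k \<otimes> h \<otimes> inv k \<in> H" using nK(1) kn by (simp add: normalizes_def)
      moreover have "x \<otimes> y \<otimes> inv x = (k \<otimes> h \<otimes> inv k) \<otimes> ?u"
        using c kn by (simp add: m_assoc inv_mult_group)
      ultimately show "x \<otimes> y \<otimes> inv x \<in> H <#> N" unfolding set_mult_def by blast
    qed
  qed
qed

lemma finitely_covered_self: "subgroup L G \<Longrightarrow> H \<subseteq> L \<Longrightarrow> finitely_covered H L"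
  unfolding finitely_covered_def
  by (intro exI [of _ "{\<one>}"]) (auto simp: subset_iff subgroup.mem_carrier)

text \<open>The normal subgroup is the intersection of the approximations of the two products.
  \<open>H\<close> is covered by both of them, and conversely the intersection is covered by both
  products, hence by \<open>H\<close>.\<close>

lemma commensurable_normal_of_two_products:
  assumes cn: "\<forall>H. subnormal G H \<and> \<not> finite_rank G H \<longrightarrow> (\<exists>N. N \<lhd> G \<and> commensurable G H N)"
    and H: "subnormal G H" and N: "N1 \<lhd> G" "N2 \<lhd> G" "\<not> finite_rank G N1" "\<not> finite_rank G N2"
    and cov: "finitely_covered ((H <#> N1) \<inter> (H <#> N2)) H"
  shows "\<exists>N. N \<lhd> G \<and> commensurable G H N"
proof -
  have sH: "subgroup H G" using H by (rule subnormal_subgroup)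
  have prod: "\<exists>M. M \<lhd> G \<and> finitely_covered (H <#> N) M \<and> finitely_covered M (H <#> N)"
    if N: "N \<lhd> G" "\<not> finite_rank G N" for N
  proof -
    have sN: "subgroup N G" using normal_imp_subgroup [OF N(1)] .
    have sHN: "subgroup (H <#> N) G" using set_mult_normal_subgroup [OF sH N(1)] .
    have "\<not> finite_rank G (H <#> N)" using N(2) finite_rank_mono [OF _ subset_set_mult(2) [OF sH sN] sN] by blast
    then obtain M where M: "M \<lhd> G" "commensurable G (H <#> N) M"
      using cn subnormal_set_mult_normal [OF H N(1)] by blast
    then have "finitely_covered (H <#> N) ((H <#> N) \<inter> M)" "finitely_covered M ((H <#> N) \<inter> M)"
      using commensurable_iff [OF sHN normal_imp_subgroup] by auto
    then show ?thesis using M(1) finitely_covered_mono by (metis Int_lower1 Int_lower2 order_refl)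
  qed
  obtain M1 where M1: "M1 \<lhd> G" "finitely_covered (H <#> N1) M1" "finitely_covered M1 (H <#> N1)"
    using prod [OF N(1,3)] by blast
  obtain M2 where M2: "M2 \<lhd> G" "finitely_covered (H <#> N2) M2" "finitely_covered M2 (H <#> N2)"
    using prod [OF N(2,4)] by blast
  define M where "M = M1 \<inter> M2"
  have s: "subgroup M1 G" "subgroup M2 G" "subgroup N1 G" "subgroup N2 G" using M1 M2 N normal_imp_subgroup by auto
  have sM: "subgroup M G" using subgroups_Inter_pair s by (simp add: M_def)
  have nM: "M \<lhd> G" using normalI' [OF sM] normalizes_Int normal_imp_normalizes M1(1) M2(1) by (simp add: M_def)
  have "finitely_covered H M1" using M1(2) subset_set_mult(1) [OF sH s(3)] by (rule finitely_covered_mono) simp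
  moreover have "finitely_covered H M2" using M2(2) subset_set_mult(1) [OF sH s(4)] by (rule finitely_covered_mono) simp
  ultimately have "finitely_covered H M"
    unfolding M_def using s subgroup.subset [OF sH] by (intro finitely_covered_Int)
  then have 1: "finitely_covered H (H \<inter> M)"
    using finitely_covered_self [OF sH subset_refl] sH sM subgroup.subset [OF sH] by (intro finitely_covered_Int)
  have "finitely_covered M (H <#> N1)" using M1(3) by (rule finitely_covered_mono) (auto simp: M_def)
  moreover have "finitely_covered M (H <#> N2)" using M2(3) by (rule finitely_covered_mono) (auto simp: M_def)
  ultimately have "finitely_covered M ((H <#> N1) \<inter> (H <#> N2))"
    using set_mult_normal_subgroup [OF sH N(1)] set_mult_normal_subgroup [OF sH N(2)] subgroup.subset [OF sM]
    by (intro finitely_covered_Int)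
  then have "finitely_covered M H" using cov subgroup.subset [OF sM] by (rule finitely_covered_trans)
  then have "finitely_covered M (H \<inter> M)"
    using finitely_covered_self [OF sM subset_refl] sH sM subgroup.subset [OF sM] by (intro finitely_covered_Int)
  then show ?thesis using 1 nM commensurable_iff [OF sH sM] by blast
qed

text \<open>From \<open>h \<otimes> n = k \<otimes> m\<close> the element
  \<open>m \<otimes> inv n\<close> lies in \<open>H\<close>. Its factors commute and have coprime
  orders, so each of them lies in \<open>H\<close>.\<close>

lemma coprime_products_Int:
  assumes H: "subgroup H G" and R: "locally_nilpotent G R" and dj: "\<pi> \<inter> \<rho> = {}"
  shows "(H <#> pi_elements \<pi> R) \<inter> (H <#> pi_elements \<rho> R) \<subseteq> H"
proof
  fix y assume "y \<in> (H <#> pi_elements \<pi> R) \<inter> (H <#> pi_elements \<rho> R)"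
  then obtain h n k m where y: "h \<in> H" "n \<in> pi_elements \<pi> R" "y = h \<otimes> n" "k \<in> H" "m \<in> pi_elements \<rho> R" "y = k \<otimes> m"
    by (auto simp: set_mult_def)
  note s = pi_elements_subgroup [OF R]
  have n': "inv n \<in> pi_elements \<pi> R" using y(2) s by (simp add: subgroup.m_inv_closed)
  have c: "h \<in> carrier G" "n \<in> carrier G" "k \<in> carrier G" "m \<in> carrier G"
    using y subgroup.mem_carrier [OF H] subgroup.mem_carrier [OF s] by blast+
  have nm: "inv n \<otimes> m = m \<otimes> inv n" using pi_elements_commute [OF R dj] n' y(5) unfolding commuting_def by blast
  have "inv k \<otimes> (k \<otimes> m) \<otimes> inv n = inv k \<otimes> (h \<otimes> n) \<otimes> inv n" using y(3,6) by simp
  then have "m \<otimes> inv n = inv k \<otimes> h" using c by (simp add: m_assoc)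
  then have nmH: "inv n \<otimes> m \<in> H" using nm y H by (simp add: subgroup.m_closed subgroup.m_inv_closed)
  obtain a where a: "pi_number \<pi> a" "inv n [^] a = \<one>" using n' by (auto simp: pi_elements_def)
  obtain b where b: "pi_number \<rho> b" "m [^] b = \<one>" using y(5) by (auto simp: pi_elements_def)
  have cop: "coprime a b" "b > 0" using pi_number_coprime [OF a(1) b(1) dj] b(1) by (auto simp: pi_number_def)
  have "inv n \<in> H" using coprime_orders_component [OF nm a(2) b(2) cop H nmH] c by simp
  then have "inv (inv n) \<in> H" by (rule subgroup.m_inv_closed [OF H])
  then show "y \<in> H" using c y(1,3) H by (simp add: subgroup.m_closed)
qed

text \<open>If \<open>y = h \<otimes> n = k \<otimes> m\<close>, then
  \<open>e = inv k \<otimes> h = m \<otimes> inv n\<close> is one of finitely many elements, and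
  \<open>e\<close> determines \<open>n\<close> up to the finite group \<open>N1 \<inter> N2\<close>.
  The finitely many possible \<open>n\<close> represent all \<open>y\<close>.\<close>

lemma finite_Int_products_covered:
  assumes H: "subgroup H G" and N: "N1 \<lhd> G" "N2 \<lhd> G"
    and fin: "finite (H \<inter> (N2 <#> N1))" "finite (N1 \<inter> N2)"
  shows "finitely_covered ((H <#> N1) \<inter> (H <#> N2)) H"
proof -
  note HG = subgroup.mem_carrier [OF H]
  have s: "subgroup N1 G" "subgroup N2 G" using N normal_imp_subgroup by auto
  let ?E = "H \<inter> (N2 <#> N1)"
  define c where "c e = (SOME n. n \<in> N1 \<and> e \<otimes> n \<in> N2)" for e
  have c: "c e \<in> N1 \<and> e \<otimes> c e \<in> N2" if "n \<in> N1" "e \<otimes> n \<in> N2" for e n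
    unfolding c_def by (rule someI [where x = n]) (simp add: that)
  \<comment> \<open>\<open>c e\<close> is unspecified if no suitable \<open>n\<close> exists for
    \<open>e\<close>; intersecting with the carrier keeps \<open>Z\<close> a legitimate set of
    representatives.\<close>
  define Z where "Z = (\<lambda>(e, d). c e \<otimes> d) ` (?E \<times> (N1 \<inter> N2)) \<inter> carrier G"
  have "\<exists>z\<in>Z. y \<otimes> inv z \<in> H" if y: "y \<in> (H <#> N1) \<inter> (H <#> N2)" for y
  proof -
    obtain h n k m where hn: "h \<in> H" "n \<in> N1" "y = h \<otimes> n" "k \<in> H" "m \<in> N2" "y = k \<otimes> m"
      using y by (auto simp: set_mult_def)
    have cc: "h \<in> carrier G" "n \<in> carrier G" "k \<in> carrier G" "m \<in> carrier G"
      using hn HG subgroup.mem_carrier [OF s(1)] subgroup.mem_carrier [OF s(2)] by auto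
    define e where "e = inv k \<otimes> h"
    have "inv k \<otimes> (k \<otimes> m) \<otimes> inv n = inv k \<otimes> (h \<otimes> n) \<otimes> inv n" using hn(3,6) by simp
    then have e: "e = m \<otimes> inv n" using cc by (simp add: m_assoc e_def)
    have "inv n \<in> N1" using hn(2) s(1) by (simp add: subgroup.m_inv_closed)
    then have "e \<in> N2 <#> N1" using e hn(5) by (auto simp: set_mult_def)
    moreover have "e \<in> H" using hn H by (simp add: e_def subgroup.m_closed subgroup.m_inv_closed)
    ultimately have eE: "e \<in> ?E" by simp
    have ec: "e \<in> carrier G" using cc by (simp add: e_def)
    have en: "e \<otimes> n \<in> N2" using e hn(5) cc by (simp add: m_assoc)
    note ce = c [OF hn(2) en]
    have cec: "c e \<in> carrier G" using ce subgroup.mem_carrier [OF s(1)] by blast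
    have "inv (e \<otimes> c e) \<otimes> (e \<otimes> n) \<in> N2" using ce en s(2) by (simp add: subgroup.m_closed subgroup.m_inv_closed)
    then have "inv (c e) \<otimes> n \<in> N2" using ec cec cc by (simp add: inv_mult_group m_assoc)
    moreover have "inv (c e) \<otimes> n \<in> N1" using ce hn(2) s(1) by (simp add: subgroup.m_closed subgroup.m_inv_closed)
    moreover have "n = c e \<otimes> (inv (c e) \<otimes> n)" using cec cc by simp
    ultimately have "n \<in> Z" using eE cc(2) unfolding Z_def
      by (intro IntI image_eqI [of _ _ "(e, inv (c e) \<otimes> n)"]) auto
    moreover have "y \<otimes> inv n \<in> H" using hn cc by (simp add: m_assoc)
    ultimately show ?thesis by blast
  qed
  moreover have "finite Z" "Z \<subseteq> carrier G" using fin by (auto simp: Z_def)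
  ultimately show ?thesis unfolding finitely_covered_def by (intro exI [of _ Z]) blast
qed

text \<open>Write \<open>n \<otimes> m\<close> as \<open>(n \<otimes> inv g) \<otimes> (g \<otimes>
  m \<otimes> inv g) \<otimes> g\<close>; the middle factor is in \<open>N1\<close> by normality, so
  the products of representatives suffice.\<close>

lemma normal_product_covered:
  assumes N: "N1 \<lhd> G" "N2 \<lhd> G" and V: "subgroup V G" and C: "C1 \<subseteq> V" "C2 \<subseteq> V"
    and cov: "finitely_covered N1 C1" "finitely_covered N2 C2"
  shows "finitely_covered (N2 <#> N1) V"
proof -
  have s: "subgroup N1 G" "subgroup N2 G" using N normal_imp_subgroup by auto
  note nN = normal_imp_normalizes [OF N(1)]
  obtain F1 where F1: "finite F1" "F1 \<subseteq> carrier G" "\<forall>h\<in>N1. \<exists>f\<in>F1. h \<otimes> inv f \<in> C1"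
    using cov(1) finitely_covered_def by auto
  obtain F2 where F2: "finite F2" "F2 \<subseteq> carrier G" "\<forall>h\<in>N2. \<exists>f\<in>F2. h \<otimes> inv f \<in> C2"
    using cov(2) finitely_covered_def by auto
  let ?F = "(\<lambda>(f, g). f \<otimes> g) ` (F1 \<times> F2)"
  have "\<exists>f\<in>?F. y \<otimes> inv f \<in> V" if y: "y \<in> N2 <#> N1" for y
  proof -
    obtain n m where nm: "n \<in> N2" "m \<in> N1" "y = n \<otimes> m" using y by (auto simp: set_mult_def)
    obtain g where g: "g \<in> F2" "n \<otimes> inv g \<in> C2" using F2(3) nm by blast
    have c: "n \<in> carrier G" "m \<in> carrier G" "g \<in> carrier G"
      using nm g F2(2) subgroup.mem_carrier [OF s(1)] subgroup.mem_carrier [OF s(2)] by auto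
    have "g \<otimes> m \<otimes> inv g \<in> N1" using nN c(3) nm(2) unfolding normalizes_def by blast
    then obtain f where f: "f \<in> F1" "g \<otimes> m \<otimes> inv g \<otimes> inv f \<in> C1" using F1(3) by blast
    have fc: "f \<in> carrier G" using f F1(2) by auto
    have "(n \<otimes> inv g) \<otimes> (g \<otimes> m \<otimes> inv g \<otimes> inv f) \<in> V"
      using f(2) g(2) C subgroup.m_closed [OF V] by blast
    then have "y \<otimes> inv (f \<otimes> g) \<in> V" using nm c fc by (simp add: m_assoc inv_mult_group)
    then show ?thesis using f g by force
  qed
  moreover have "finite ?F" "?F \<subseteq> carrier G" using F1 F2 by auto
  ultimately show ?thesis unfolding finitely_covered_def by (intro exI [of _ ?F]) blast
qed

text \<open>Otherwise \<open>C \<inter> N\<close> would be elementary abelian of finite rank, hence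
  finite, and \<open>C\<close> would be finite with it.\<close>

lemma normal_commensurable_infinite_rank:
  assumes p: "Factorial_Ring.prime (p::nat)" and C: "subgroup C G" "commuting C C" "\<And>v. v \<in> C \<Longrightarrow> v [^] p = \<one>" "infinite C"
    and N: "subgroup N G" and cov: "finitely_covered C (C \<inter> N)"
  shows "\<not> finite_rank G N"
proof
  assume fr: "finite_rank G N"
  have s: "subgroup (C \<inter> N) G" using subgroups_Inter_pair [OF C(1) N] .
  have "finite_rank G (C \<inter> N)" using finite_rank_mono [OF fr _ s] by blast
  moreover have "commuting (C \<inter> N) (C \<inter> N)" using commuting_mono [OF C(2)] by blast
  ultimately have "finite (C \<inter> N)" using elementary_finite_rank_finite [OF s _ _ p] C(3) by blast
  then show False using finitely_covered_finite [OF cov _ subgroup.subset [OF C(1)]] C(4) by blast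
qed

end

section \<open>Primary components of finite and of infinite rank\<close>

theorem theoremA:
  fixes G :: "('a, 'b) monoid_scheme" and R :: "'a set"
  assumes "group G"
    and "periodic_group G"
    and "solvable G"
    and "\<forall>H. subnormal G H \<and> \<not> finite_rank G H \<longrightarrow> (\<exists>N. N \<lhd> G \<and> commensurable G H N)"
    and "hirsch_plotkin_radical G R"
    and "\<not> finite_rank G R"
  shows "\<forall>H. subnormal G H \<longrightarrow> (\<exists>N. N \<lhd> G \<and> commensurable G H N)"
proof (intro allI impI)
  interpret group G by fact
  note cn = assms(4)
  have RG: "R \<lhd> G" and lnR: "locally_nilpotent G R"
    using assms(5) by (auto simp: hirsch_plotkin_radical_def)
  have sR: "subgroup R G" using normal_imp_subgroup [OF RG] .
  note RsG = subgroup.subset [OF sR]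
  have nP: "pi_elements \<pi> R \<lhd> G" for \<pi>
    using normalI' [OF pi_elements_subgroup [OF lnR]]
      pi_elements_normalizes [OF normal_imp_normalizes [OF RG] subset_refl RsG] by blast
  fix H assume H: "subnormal G H"
  have sH: "subgroup H G" using H by (rule subnormal_subgroup)
  show "\<exists>N. N \<lhd> G \<and> commensurable G H N"
  proof (cases "finite_rank G H")
    case False then show ?thesis using cn H by blast
  next
    case frH: True
    show ?thesis
    proof (cases "\<forall>p. Factorial_Ring.prime p \<longrightarrow> finite_rank G (pi_elements {p} R)")
      case True
      then obtain \<pi> \<rho> where \<pi>: "\<pi> \<inter> \<rho> = {}" "\<not> finite_rank G (pi_elements \<pi> R)" "\<not> finite_rank G (pi_elements \<rho> R)"
        using disjoint_infinite_rank_components [OF lnR assms(2,6)] by metis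
      have "finitely_covered ((H <#>\<^bsub>G\<^esub> pi_elements \<pi> R) \<inter> (H <#>\<^bsub>G\<^esub> pi_elements \<rho> R)) H"
        using finitely_covered_self [OF sH coprime_products_Int [OF sH lnR \<pi>(1)]] .
      then show ?thesis using commensurable_normal_of_two_products [OF cn H nP nP \<pi>(2,3)] by blast
    next
      case False
      then obtain p :: nat where p: "Factorial_Ring.prime p" "\<not> finite_rank G (pi_elements {p} R)" by blast
      let ?P = "pi_elements {p} R"
      have pP: "p_elements p ?P"
        unfolding p_elements_def pi_elements_def using pi_number_singleton by blast
      have sP: "subgroup ?P G" by (rule pi_elements_subgroup [OF lnR])
      obtain n where n: "(derived G ^^ n) (carrier G) = {\<one>\<^bsub>G\<^esub>}"
        using assms(3) solvable_iff_trivial_derived_seq by blast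
      have "(derived G ^^ n) ?P \<subseteq> {\<one>\<^bsub>G\<^esub>}"
        using mono_exp_of_derived [OF subgroup.subset [OF sP], of n] n by simp
      moreover have "\<one>\<^bsub>G\<^esub> \<in> (derived G ^^ n) ?P"
        using subgroup.one_closed [OF exp_of_derived_is_subgroup [OF sP]] .
      ultimately have dP: "(derived G ^^ n) ?P = {\<one>\<^bsub>G\<^esub>}" by blast
      obtain U where U: "subnormal G U" "U \<subseteq> ?P" "commuting U U" "infinite (torsion U p)"
        using infinite_rank_infinite_socle [OF p(1) normal_imp_subnormal [OF nP] pP dP p(2)] .
      have sU: "subgroup U G" using U(1) by (rule subnormal_subgroup)
      define V where "V = torsion U p"
      have V: "subgroup V G" "commuting V V" "infinite V" "V \<subseteq> U"
        using torsion_subgroup [OF sU U(3)] commuting_mono [OF U(3)] U(4) by (auto simp: V_def torsion_def)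
      have expV: "v [^]\<^bsub>G\<^esub> p = \<one>\<^bsub>G\<^esub>" if "v \<in> V" for v using that by (simp add: V_def torsion_def)
      \<comment> \<open>Subgroups of the abelian group \<open>U\<close> are normal in
        \<open>U\<close>, hence subnormal in \<open>G\<close>; this makes the hypothesis available
        for infinite subgroups of the socle \<open>V\<close>.\<close>
      have sub: "normalizes W C" if WC: "C \<subseteq> W" "W \<subseteq> U" "subgroup C G" for C W
        unfolding normalizes_def
      proof (intro ballI)
        fix w c assume wc: "w \<in> W" "c \<in> C"
        have "w \<otimes>\<^bsub>G\<^esub> c = c \<otimes>\<^bsub>G\<^esub> w" using U(3) wc WC unfolding commuting_def by blast
        moreover have "w \<in> carrier G" "c \<in> carrier G" using wc WC subgroup.mem_carrier [OF sU] by blast+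
        ultimately have "w \<otimes>\<^bsub>G\<^esub> c \<otimes>\<^bsub>G\<^esub> inv\<^bsub>G\<^esub> w = c" by (simp add: m_assoc)
        then show "w \<otimes>\<^bsub>G\<^esub> c \<otimes>\<^bsub>G\<^esub> inv\<^bsub>G\<^esub> w \<in> C" using wc by simp
      qed
      obtain A B where A: "subgroup A G" "A \<subseteq> V" "infinite A" and B: "subgroup B G" "B \<subseteq> V" "infinite B"
        and AB: "A \<inter> B = {\<one>\<^bsub>G\<^esub>}"
        using infinite_disjoint_subgroups [OF V(1,2) expV p(1) V(3)] .
      have normal_approx: "\<exists>N. N \<lhd> G \<and> \<not> finite_rank G N \<and> finitely_covered N C"
        if C: "subgroup C G" "C \<subseteq> V" "infinite C" for C
      proof -
        have CU: "C \<subseteq> U" using C(2) V(4) by blast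
        have comC: "commuting C C" using commuting_mono [OF V(2) C(2,2)] .
        have expC: "v [^]\<^bsub>G\<^esub> p = \<one>\<^bsub>G\<^esub>" if "v \<in> C" for v using expV that C(2) by blast
        have "subnormal G C" using subnormal_stepI [OF U(1) C(1) CU sub [OF CU subset_refl C(1)]] .
        moreover have "\<not> finite_rank G C"
          using elementary_finite_rank_finite [OF C(1) comC expC p(1)] C(3) by blast
        ultimately obtain N where N: "N \<lhd> G" "commensurable G C N" using cn by blast
        have sN: "subgroup N G" using normal_imp_subgroup [OF N(1)] .
        have cov: "finitely_covered C (C \<inter> N)" "finitely_covered N (C \<inter> N)"
          using N(2) commensurable_iff [OF C(1) sN] by auto
        have "\<not> finite_rank G N"
          using normal_commensurable_infinite_rank [OF p(1) C(1) comC expC C(3) sN cov(1)] .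
        moreover have "finitely_covered N C" using cov(2) by (rule finitely_covered_mono) auto
        ultimately show ?thesis using N(1) by blast
      qed
      obtain M where M: "M \<lhd> G" "\<not> finite_rank G M" "finitely_covered M A" using normal_approx [OF A] by blast
      obtain N where N: "N \<lhd> G" "\<not> finite_rank G N" "finitely_covered N B" using normal_approx [OF B] by blast
      have s: "subgroup M G" "subgroup N G" using M N normal_imp_subgroup by auto
      \<comment> \<open>\<open>M\<close> is covered by \<open>A\<close> and \<open>N\<close> by
        \<open>B\<close>, so \<open>M \<inter> N\<close> is covered by the trivial group
        \<open>A \<inter> B\<close>.\<close>
      have "finitely_covered (M \<inter> N) (A \<inter> B)"
      proof (rule finitely_covered_Int [OF _ _ A(1) B(1)])
        show "finitely_covered (M \<inter> N) A" using M(3) by (rule finitely_covered_mono) auto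
        show "finitely_covered (M \<inter> N) B" using N(3) by (rule finitely_covered_mono) auto
        show "M \<inter> N \<subseteq> carrier G" using subgroup.subset [OF s(1)] by blast
      qed
      then have finMN: "finite (M \<inter> N)"
        using AB finitely_covered_finite [of "M \<inter> N" "A \<inter> B"] subgroup.subset [OF s(1)] by auto
      have sHV: "subgroup (V \<inter> H) G" using subgroups_Inter_pair [OF V(1) sH] .
      \<comment> \<open>Here the finite rank of \<open>H\<close> enters: the product of
        \<open>N\<close> and \<open>M\<close> is covered by \<open>V\<close>, so its intersection
        with \<open>H\<close> is covered by \<open>V \<inter> H\<close> and is finite.\<close>
      have "finite (V \<inter> H)"
      proof (rule elementary_finite_rank_finite [OF sHV _ _ p(1)])
        show "commuting (V \<inter> H) (V \<inter> H)" using commuting_mono [OF V(2)] by blast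
        show "finite_rank G (V \<inter> H)" using finite_rank_mono [OF frH _ sHV] by blast
      qed (use expV in auto)
      moreover have NMG: "N <#>\<^bsub>G\<^esub> M \<subseteq> carrier G"
        using subgroup.subset [OF set_mult_normal_subgroup [OF s(2) M(1)]] .
      moreover have "finitely_covered ((N <#>\<^bsub>G\<^esub> M) \<inter> H) (V \<inter> H)"
        using finitely_covered_Int_left [OF normal_product_covered [OF M(1) N(1) V(1) A(2) B(2) M(3) N(3)] V(1) sH NMG] .
      ultimately have "finite ((N <#>\<^bsub>G\<^esub> M) \<inter> H)"
        using finitely_covered_finite [of "(N <#>\<^bsub>G\<^esub> M) \<inter> H" "V \<inter> H"] by blast
      then have "finitely_covered ((H <#>\<^bsub>G\<^esub> M) \<inter> (H <#>\<^bsub>G\<^esub> N)) H"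
        using finite_Int_products_covered [OF sH M(1) N(1) _ finMN] by (simp add: Int_commute)
      then show ?thesis using commensurable_normal_of_two_products [OF cn H M(1) N(1) M(2) N(2)] by blast
    qed
  qed
qed

end
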